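(* Let $G$ be a finite group, and let $A$ and $B$ be $\mathrm{w}$-supersoluble $\mathbb{P}$-subnormal subgroups of $G$ such that $G=AB$. Then the following hold: (1) $G^{\mathrm{w}\mathfrak{U}}=(G^{\mathcal{A}})^{\mathfrak{N}}$; (2) if $N$ is a nilpotent normal subgroup of $G$, then both $AN$ and $BN$ are $\mathrm{w}$-supersoluble; (3) if $(|A/A^{\mathcal{A}}|,\,|B/B^{\mathcal{A}}|)=1$ (that is, these two orders are coprime), then $G$ is $\mathrm{w}$-supersoluble.
   Context: All groups are finite. $\mathbb{P}$ denotes the set of all primes. A subgroup $H$ of a group $G$ is called $\mathbb{P}$-subnormal in $G$ if either $H=G$ or there is a chain of subgroups $H=H_0\le H_1\le\ldots\le H_n=G$ with $|H_i:H_{i-1}|\in\mathbb{P}$ for all $i$. A group is called $\mathrm{w}$-supersoluble (widely supersoluble) if every Sylow subgroup of it is $\mathbb{P}$-subnormal in it. $\mathrm{w}\mathfrak{U}$ denotes the class of all $\mathrm{w}$-supersoluble groups, $\mathfrak{N}$ the class of all nilpotent groups, and $\mathcal{A}$ the class of all groups all of whose Sylow subgroups are abelian; each of these classes is a formation. For a formation $\mathfrak{X}$ and a group $G$, the $\mathfrak{X}$-residual $G^{\mathfrak{X}}$ is the intersection of all normal subgroups $N$ of $G$ with $G/N\in\mathfrak{X}$. The notation $G=AB$ means $G=\{ab\mid a\in A,\ b\in B\}$. *)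

theory Defs
  imports "HOL-Algebra.Sylow"
begin

definition sub_index :: "('a, 'b) monoid_scheme \<Rightarrow> 'a set \<Rightarrow> 'a set \<Rightarrow> nat" where
  "sub_index G K H = card (rcosets\<^bsub>G\<lparr>carrier := K\<rparr>\<^esub> H)"

definition P_subnormal :: "'a set \<Rightarrow> ('a, 'b) monoid_scheme \<Rightarrow> bool" where
  "P_subnormal H G \<longleftrightarrow> subgroup H G \<and>
     (H = carrier G \<or>
      (\<exists>(n::nat) C. C 0 = H \<and> C n = carrier G \<and>
         (\<forall>i\<le>n. subgroup (C i) G) \<and>
         (\<forall>i\<in>{1..n}. C (i - 1) \<subseteq> C i \<and> prime (sub_index G (C i) (C (i - 1))))))"

text \<open>For a prime not dividing the order of the group, the Sylow subgroup is the trivial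
  subgroup.\<close>

definition sylow_subgroup :: "nat \<Rightarrow> 'a set \<Rightarrow> ('a, 'b) monoid_scheme \<Rightarrow> bool" where
  "sylow_subgroup p P G \<longleftrightarrow>
     prime p \<and> subgroup P G \<and> card P = p ^ multiplicity p (order G)"

definition w_supersoluble :: "('a, 'b) monoid_scheme \<Rightarrow> bool" where
  "w_supersoluble G \<longleftrightarrow> group G \<and> finite (carrier G) \<and>
     (\<forall>p P. sylow_subgroup p P G \<longrightarrow> P_subnormal P G)"

definition abelian_sylow :: "('a, 'b) monoid_scheme \<Rightarrow> bool" where
  "abelian_sylow G \<longleftrightarrow> group G \<and> finite (carrier G) \<and>
     (\<forall>p P. sylow_subgroup p P G \<longrightarrow> comm_group (G\<lparr>carrier := P\<rparr>))"

text \<open>Nilpotency by means of a central series \<open>1 = K 0 \<le> \<dots> \<le> K n = G\<close>; the last condition is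
  \<open>[K (i + 1), G] \<le> K i\<close>, i.e. \<open>K (i + 1) / K i\<close> is contained in the centre of \<open>G / K i\<close>.\<close>

definition nilpotent :: "('a, 'b) monoid_scheme \<Rightarrow> bool" where
  "nilpotent G \<longleftrightarrow> group G \<and> finite (carrier G) \<and>
     (\<exists>(n::nat) K. K 0 = {\<one>\<^bsub>G\<^esub>} \<and> K n = carrier G \<and>
        (\<forall>i\<le>n. K i \<lhd> G) \<and>
        (\<forall>i<n. K i \<subseteq> K (Suc i) \<and>
           (\<forall>x\<in>K (Suc i). \<forall>g\<in>carrier G.
              inv\<^bsub>G\<^esub> x \<otimes>\<^bsub>G\<^esub> inv\<^bsub>G\<^esub> g \<otimes>\<^bsub>G\<^esub> x \<otimes>\<^bsub>G\<^esub> g \<in> K i)))"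

text \<open>A class of groups enters only through its members of type \<^typ>\<open>'a set monoid\<close>, the
  type of the quotients of \<open>G\<close>.\<close>

definition residual :: "('a set monoid \<Rightarrow> bool) \<Rightarrow> ('a, 'b) monoid_scheme \<Rightarrow> 'a set" where
  "residual X G = \<Inter> {N. N \<lhd> G \<and> X (G Mod N)}"

end

theory Submission
  imports Defs "HOL-Algebra.Multiplicative_Group" "HOL-Algebra.Generated_Groups"
begin

text \<open>
  A largest-prime argument shows that \<open>G\<close> has a Sylow tower of supersoluble type; its terms are the
  largest normal subgroups whose orders only involve primes \<open>\<ge> n\<close>. A Sylow \<open>q\<close>-subgroup \<open>Q\<close> is
  \<open>\<P>\<close>-subnormal as soon as, for each prime \<open>p > q\<close>, the \<open>p\<close>-section of the tower has a chain of
  \<open>Q\<close>-invariant subgroups with steps of index \<open>p\<close>. A \<open>\<P>\<close>-subnormal subgroup cuts out such a chain by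
  intersection, so both factors of \<open>Q = (Q \<inter> A)(Q \<inter> B)\<close> have one. The commutators of \<open>Q\<close> lie in
  \<open>K = G\<^sup>\<A>\<close>; as \<open>q\<close>-elements of a group that is nilpotent modulo \<open>K\<^sup>\<N>\<close> they centralise the
  \<open>p\<close>-sections modulo \<open>K\<^sup>\<N>\<close>, so \<open>Q\<close> acts there as an abelian group, both factors act by power maps
  on the irreducible sections, and hence so does \<open>Q\<close>. Conversely, in a w-supersoluble group \<open>H\<close> the
  commutators of a Sylow \<open>q\<close>-subgroup centralise the tower above \<open>q\<close> and therefore lie in the
  \<open>q\<close>-core, which makes \<open>H\<^sup>\<A>\<close> nilpotent; moreover \<open>|H/H\<^sup>\<A>|\<close> has the same prime divisors as \<open>|H|\<close>,
  so that in part (3) the orders of \<open>A\<close> and \<open>B\<close> are coprime.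
\<close>

section \<open>Subgroups, conjugation and products\<close>

text \<open>The obstacle is visible in the quaternion group of order 8 acting faithfully on an
  elementary abelian group V of order 25. Two of its subgroups of order 4, each extended by V, are
  normal and w-supersoluble and their product is everything, yet the Sylow 2-subgroup is irreducible
  on V: each factor has an invariant chain, but they share none. Commuting actions remove the
  conflict, because an eigenspace of one factor is then invariant under the other. Power maps w
  \<mapsto> w^c play the role of scalars, so no field structure is put on the sections.

  Only primes above q need care: for n \<le> q a Sylow q-subgroup lies in the tower term for n, and
  the sections below q have chains by Sylow's theorem alone.

  A section U/L is kept as a pair of subgroups of \<open>G\<close>, and an index is an equation
  between orders. Quotient groups enter only through \<open>factor_map\<close>, where computations
  still start from elements of \<open>G\<close>. All chains thus live in one group and can be
  intersected, multiplied and concatenated.\<close>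

locale fin_group = group +
  assumes fin [simp]: "finite (carrier G)"

definition (in group) normalises :: "'a set \<Rightarrow> 'a set \<Rightarrow> bool" where
  "normalises X H \<longleftrightarrow> (\<forall>x\<in>X. \<forall>h\<in>H. x \<otimes> h \<otimes> inv x \<in> H)"

text \<open>The convention is that of \<open>derived_set\<close>, so x y is \<open>comm x y\<close>
  times y x. The definition of \<open>nilpotent\<close> uses the other form, x^-1 g^-1 x g.\<close>

definition (in group) comm :: "'a \<Rightarrow> 'a \<Rightarrow> 'a" where
  "comm a b = a \<otimes> b \<otimes> inv a \<otimes> inv b"

context group
begin

lemma inv_cancel_left [simp]:
  "x \<in> carrier G \<Longrightarrow> y \<in> carrier G \<Longrightarrow> x \<otimes> (inv x \<otimes> y) = y"
  "x \<in> carrier G \<Longrightarrow> y \<in> carrier G \<Longrightarrow> inv x \<otimes> (x \<otimes> y) = y"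
  by (simp_all flip: m_assoc)

lemmas word_simps = m_assoc inv_mult_group

lemma commute_mult:
  assumes "x \<in> carrier G" "y \<in> carrier G" "u \<in> carrier G" "x \<otimes> u = u \<otimes> x" "y \<otimes> u = u \<otimes> y"
  shows "x \<otimes> y \<otimes> u = u \<otimes> (x \<otimes> y)"
proof -
  have "x \<otimes> y \<otimes> u = x \<otimes> (u \<otimes> y)"
    using assms(1-3) by (simp add: m_assoc assms(5))
  also have "\<dots> = u \<otimes> x \<otimes> y"
    using assms(1-3) by (simp flip: m_assoc assms(4))
  finally show ?thesis
    using assms(1-3) by (simp add: m_assoc)
qed

lemma subgroup_carrier: "subgroup H G \<Longrightarrow> x \<in> H \<Longrightarrow> x \<in> carrier G"
  by (rule subgroup.mem_carrier)

lemma comm_closed [simp]: "a \<in> carrier G \<Longrightarrow> b \<in> carrier G \<Longrightarrow> comm a b \<in> carrier G"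
  by (simp add: comm_def)

lemma comm_in_subgroup: "subgroup H G \<Longrightarrow> a \<in> H \<Longrightarrow> b \<in> H \<Longrightarrow> comm a b \<in> H"
  by (simp add: comm_def subgroup.m_closed subgroup.m_inv_closed)

lemma normalisesD: "normalises X H \<Longrightarrow> x \<in> X \<Longrightarrow> h \<in> H \<Longrightarrow> x \<otimes> h \<otimes> inv x \<in> H"
  by (simp add: normalises_def)

lemma normalises_subset: "normalises X H \<Longrightarrow> Y \<subseteq> X \<Longrightarrow> normalises Y H"
  by (auto simp: normalises_def)

lemma normalises_self: "subgroup H G \<Longrightarrow> X \<subseteq> H \<Longrightarrow> normalises X H"
  by (auto simp: normalises_def subsetD intro!: subgroup.m_closed subgroup.m_inv_closed)

lemma normalises_Int: "normalises X H \<Longrightarrow> normalises X K \<Longrightarrow> normalises X (H \<inter> K)"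
  by (auto simp: normalises_def)

lemma normalises_one: "X \<subseteq> carrier G \<Longrightarrow> normalises X {\<one>}"
  by (auto simp: normalises_def)

lemma normalisesD_inv:
  "subgroup X G \<Longrightarrow> normalises X H \<Longrightarrow> x \<in> X \<Longrightarrow> h \<in> H \<Longrightarrow> inv x \<otimes> h \<otimes> x \<in> H"
  using normalisesD[of X H "inv x" h] by (simp add: subgroup.m_inv_closed subgroup_carrier)

lemma normal_iff_normalises: "N \<lhd> G \<longleftrightarrow> subgroup N G \<and> normalises (carrier G) N"
  by (auto simp: normal_inv_iff normalises_def)

lemma setmult_iff: "x \<in> H <#> K \<longleftrightarrow> (\<exists>h\<in>H. \<exists>k\<in>K. x = h \<otimes> k)"
  by (auto simp: set_mult_def)

lemma setmultI: "h \<in> H \<Longrightarrow> k \<in> K \<Longrightarrow> h \<otimes> k \<in> H <#> K"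
  by (auto simp: set_mult_def)

lemma subset_setmult_left: "subgroup H G \<Longrightarrow> subgroup K G \<Longrightarrow> H \<subseteq> H <#> K"
  using setmultI[of _ H \<one> K] subgroup_carrier by (fastforce intro: subgroup.one_closed)

lemma subset_setmult_right: "subgroup H G \<Longrightarrow> subgroup K G \<Longrightarrow> K \<subseteq> H <#> K"
  using setmultI[of \<one> H _ K] subgroup_carrier by (fastforce intro: subgroup.one_closed)

lemma setmult_subset: "subgroup L G \<Longrightarrow> H \<subseteq> L \<Longrightarrow> K \<subseteq> L \<Longrightarrow> H <#> K \<subseteq> L"
  by (auto simp: setmult_iff subgroup.m_closed subsetD)

lemma setmult_mono: "H \<subseteq> H' \<Longrightarrow> K \<subseteq> K' \<Longrightarrow> H <#> K \<subseteq> H' <#> K'"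
  by (rule mono_set_mult)

lemma subgroup_setmult:
  assumes H: "subgroup H G" and K: "subgroup K G" and n: "normalises H K"
  shows "subgroup (H <#> K) G"
proof
  show "H <#> K \<subseteq> carrier G"
    using H K by (simp add: set_mult_closed subgroup.subset)
  show "\<one> \<in> H <#> K"
    using setmultI[OF subgroup.one_closed[OF H] subgroup.one_closed[OF K]] by simp
next
  fix x y assume "x \<in> H <#> K" "y \<in> H <#> K"
  then obtain h k h' k' where *: "h \<in> H" "k \<in> K" "h' \<in> H" "k' \<in> K" "x = h \<otimes> k" "y = h' \<otimes> k'"
    by (auto simp: setmult_iff)
  then have c: "h \<in> carrier G" "k \<in> carrier G" "h' \<in> carrier G" "k' \<in> carrier G"
    using H K subgroup_carrier by auto
  have "x \<otimes> y = (h \<otimes> h') \<otimes> ((inv h' \<otimes> k \<otimes> h') \<otimes> k')"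
    using c by (simp add: * word_simps)
  then show "x \<otimes> y \<in> H <#> K"
    using * n H K by (metis normalisesD_inv setmultI subgroup.m_closed)
next
  fix x assume "x \<in> H <#> K"
  then obtain h k where *: "h \<in> H" "k \<in> K" "x = h \<otimes> k"
    by (auto simp: setmult_iff)
  then have c: "h \<in> carrier G" "k \<in> carrier G"
    using H K subgroup_carrier by auto
  have "inv x = inv h \<otimes> (h \<otimes> inv k \<otimes> inv h)"
    using c by (simp add: * word_simps)
  then show "inv x \<in> H <#> K"
    using * n H K by (metis normalisesD setmultI subgroup.m_inv_closed)
qed

lemma setmult_swap:
  assumes H: "subgroup H G" and K: "subgroup K G" and n: "normalises H K"
  shows "K <#> H = H <#> K"
proof
  show "K <#> H \<subseteq> H <#> K"
    using H K by (intro setmult_subset[OF subgroup_setmult[OF assms]] subset_setmult_left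
        subset_setmult_right)
  show "H <#> K \<subseteq> K <#> H"
  proof
    fix x assume "x \<in> H <#> K"
    then obtain h k where *: "h \<in> H" "k \<in> K" "x = h \<otimes> k"
      by (auto simp: setmult_iff)
    then have c: "h \<in> carrier G" "k \<in> carrier G"
      using H K subgroup_carrier by auto
    have "x = (h \<otimes> k \<otimes> inv h) \<otimes> h"
      using c by (simp add: * word_simps)
    then show "x \<in> K <#> H"
      using * n by (metis normalisesD setmultI)
  qed
qed

lemma normalises_setmult:
  assumes "X \<subseteq> carrier G" "subgroup H G" "subgroup K G" "normalises X H" "normalises X K"
  shows "normalises X (H <#> K)"
  unfolding normalises_def
proof (intro ballI)
  fix x z assume x: "x \<in> X" and "z \<in> H <#> K"
  then obtain h k where *: "h \<in> H" "k \<in> K" "z = h \<otimes> k"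
    by (auto simp: setmult_iff)
  then have c: "h \<in> carrier G" "k \<in> carrier G" "x \<in> carrier G"
    using assms x subgroup_carrier by auto
  have "x \<otimes> z \<otimes> inv x = (x \<otimes> h \<otimes> inv x) \<otimes> (x \<otimes> k \<otimes> inv x)"
    using c by (simp add: * word_simps)
  then show "x \<otimes> z \<otimes> inv x \<in> H <#> K"
    using * assms x by (metis normalisesD setmultI)
qed

lemma normalises_by_setmult:
  assumes "X \<subseteq> carrier G" "Y \<subseteq> carrier G" "H \<subseteq> carrier G" "normalises X H" "normalises Y H"
  shows "normalises (X <#> Y) H"
  unfolding normalises_def
proof (intro ballI)
  fix z h assume h: "h \<in> H" and "z \<in> X <#> Y"
  then obtain x y where *: "x \<in> X" "y \<in> Y" "z = x \<otimes> y"
    by (auto simp: setmult_iff)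
  then have c: "h \<in> carrier G" "x \<in> carrier G" "y \<in> carrier G"
    using assms h by auto
  have "z \<otimes> h \<otimes> inv z = x \<otimes> (y \<otimes> h \<otimes> inv y) \<otimes> inv x"
    using c by (simp add: * word_simps)
  then show "z \<otimes> h \<otimes> inv z \<in> H"
    using * assms h by (metis normalisesD)
qed

lemma subgroup_conj:
  assumes H: "subgroup H G" and g: "g \<in> carrier G"
  shows "subgroup ((\<lambda>h. g \<otimes> h \<otimes> inv g) ` H) G"
proof
  show "(\<lambda>h. g \<otimes> h \<otimes> inv g) ` H \<subseteq> carrier G"
    using H g subgroup_carrier by fastforce
  have "\<one> = g \<otimes> \<one> \<otimes> inv g"
    using g by simp
  then show "\<one> \<in> (\<lambda>h. g \<otimes> h \<otimes> inv g) ` H"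
    using subgroup.one_closed[OF H] by blast
next
  fix x y assume "x \<in> (\<lambda>h. g \<otimes> h \<otimes> inv g) ` H" "y \<in> (\<lambda>h. g \<otimes> h \<otimes> inv g) ` H"
  then obtain h k where *: "h \<in> H" "k \<in> H" "x = g \<otimes> h \<otimes> inv g" "y = g \<otimes> k \<otimes> inv g"
    by auto
  then have "x \<otimes> y = g \<otimes> (h \<otimes> k) \<otimes> inv g"
    using g H subgroup_carrier by (simp add: word_simps)
  then show "x \<otimes> y \<in> (\<lambda>h. g \<otimes> h \<otimes> inv g) ` H"
    using * H by (auto intro!: imageI subgroup.m_closed)
next
  fix x assume "x \<in> (\<lambda>h. g \<otimes> h \<otimes> inv g) ` H"
  then obtain h where *: "h \<in> H" "x = g \<otimes> h \<otimes> inv g"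
    by auto
  then have "inv x = g \<otimes> (inv h) \<otimes> inv g"
    using g H subgroup_carrier by (simp add: word_simps)
  then show "inv x \<in> (\<lambda>h. g \<otimes> h \<otimes> inv g) ` H"
    using * H by (auto intro!: imageI subgroup.m_inv_closed)
qed

lemma inj_conj: "g \<in> carrier G \<Longrightarrow> H \<subseteq> carrier G \<Longrightarrow> inj_on (\<lambda>h. g \<otimes> h \<otimes> inv g) H"
  by (rule inj_onI) (simp add: subset_iff)

lemma card_conj: "g \<in> carrier G \<Longrightarrow> H \<subseteq> carrier G \<Longrightarrow> card ((\<lambda>h. g \<otimes> h \<otimes> inv g) ` H) = card H"
  by (simp add: card_image inj_conj)

end

context fin_group
begin

lemma finite_subgroup: "subgroup H G \<Longrightarrow> finite H"
  using fin finite_subset subgroup.subset by blast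

lemma card_pos: "subgroup H G \<Longrightarrow> card H > 0"
  using finite_subgroup subgroup.one_closed by (fastforce simp: card_gt_0_iff)

text \<open>Inverses come for free: x^-1 is the power of x with exponent |G| - 1.\<close>

lemma finite_group_subgroupI:
  assumes "H \<subseteq> carrier G" "\<one> \<in> H" "\<And>x y. x \<in> H \<Longrightarrow> y \<in> H \<Longrightarrow> x \<otimes> y \<in> H"
  shows "subgroup H G"
proof
  fix x assume x: "x \<in> H"
  have xG: "x \<in> carrier G"
    using x assms(1) by blast
  have p: "x [^] (n::nat) \<in> H" for n
    by (induction n) (simp_all add: assms(2,3) x)
  have "order G > 0"
    by (simp add: order_gt_0_iff_finite)
  then have "x \<otimes> x [^] (order G - 1) = x [^] order G"
    using nat_pow_Suc2[OF xG, of "order G - 1"] by simp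
  then have "x \<otimes> x [^] (order G - 1) = \<one>"
    using pow_order_eq_1[OF xG] by simp
  then have "inv x = x [^] (order G - 1)"
    by (intro inv_equality inv_comm[OF _ xG]) (simp_all add: xG)
  then show "inv x \<in> H"
    using p by simp
qed (fact assms)+

lemma card_subgroup_dvd:
  assumes "subgroup H G" "subgroup K G" "H \<subseteq> K"
  shows "card H dvd card K"
proof -
  interpret K: group "G\<lparr>carrier := K\<rparr>"
    using assms(2) subgroup_imp_group by blast
  have "subgroup H (G\<lparr>carrier := K\<rparr>)"
    using assms subgroup_incl by blast
  from K.lagrange[OF this] have "card (rcosets\<^bsub>G\<lparr>carrier := K\<rparr>\<^esub> H) * card H = card K"
    by (simp add: order_def)
  then show ?thesis
    by (metis dvd_triv_right)
qed

lemma subgroup_eqI: "subgroup K G \<Longrightarrow> H \<subseteq> K \<Longrightarrow> card K \<le> card H \<Longrightarrow> H = K"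
  by (rule card_seteq) (auto simp: finite_subgroup)

text \<open>Fix one factorisation z = a b of each z in the product set. The others are (a d)(d^-1 b)
  with d in \<open>H \<inter> K\<close>, which makes \<open>F\<close> a bijection. The product set
  need not be a subgroup, and the orbit count in \<open>conj_in_small_index\<close> relies on
  this.\<close>

lemma card_setmult:
  assumes H: "subgroup H G" and K: "subgroup K G"
  shows "card (H <#> K) * card (H \<inter> K) = card H * card K"
proof -
  have "\<exists>p. fst p \<in> H \<and> snd p \<in> K \<and> z = fst p \<otimes> snd p" if z: "z \<in> H <#> K" for z
  proof -
    obtain h k where "h \<in> H" "k \<in> K" "z = h \<otimes> k"
      using z by (auto simp: setmult_iff)
    then show ?thesis
      by (intro exI[of _ "(h, k)"]) simp
  qed
  then obtain f where f: "\<And>z. z \<in> H <#> K \<Longrightarrow> fst (f z) \<in> H \<and> snd (f z) \<in> K \<and> z = fst (f z) \<otimes> snd (f z)"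
    by metis
  define F where "F = (\<lambda>(z, d). (fst (f z) \<otimes> d, inv d \<otimes> snd (f z)))"
  have cH: "h \<in> H \<Longrightarrow> h \<in> carrier G" and cK: "k \<in> K \<Longrightarrow> k \<in> carrier G" for h k
    using H K subgroup_carrier by auto
  have "bij_betw F ((H <#> K) \<times> (H \<inter> K)) (H \<times> K)"
    unfolding bij_betw_def
  proof
    show "inj_on F ((H <#> K) \<times> (H \<inter> K))"
    proof (rule inj_onI)
      fix p q assume pq: "p \<in> (H <#> K) \<times> (H \<inter> K)" "q \<in> (H <#> K) \<times> (H \<inter> K)" "F p = F q"
      obtain z d z' d' where e: "p = (z, d)" "q = (z', d')"
        by (cases p; cases q)
      have m: "z \<in> H <#> K" "z' \<in> H <#> K" "d \<in> carrier G" "d' \<in> carrier G"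
        using pq e cH by auto
      have *: "fst (f z) \<otimes> d = fst (f z') \<otimes> d'" "inv d \<otimes> snd (f z) = inv d' \<otimes> snd (f z')"
        using pq(3) by (auto simp: F_def e)
      have "z = (fst (f z) \<otimes> d) \<otimes> (inv d \<otimes> snd (f z))"
        using f[OF m(1)] m cH cK by (auto simp: word_simps)
      also have "\<dots> = z'"
        using f[OF m(2)] m cH cK by (auto simp: word_simps *)
      finally have z: "z = z'" .
      then show "p = q"
        using * e f[OF m(1)] m cH by auto
    qed
    show "F ` ((H <#> K) \<times> (H \<inter> K)) = H \<times> K"
    proof
      show "F ` ((H <#> K) \<times> (H \<inter> K)) \<subseteq> H \<times> K"
        using f H K by (auto simp: F_def subgroup.m_closed subgroup.m_inv_closed)
      show "H \<times> K \<subseteq> F ` ((H <#> K) \<times> (H \<inter> K))"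
      proof
        fix p assume "p \<in> H \<times> K"
        then obtain h k where p: "p = (h, k)" "h \<in> H" "k \<in> K"
          by auto
        define z where "z = h \<otimes> k"
        have z: "z \<in> H <#> K"
          using p by (simp add: z_def setmultI)
        obtain a b where ab: "f z = (a, b)"
          by fastforce
        with f[OF z] have ab': "a \<in> H" "b \<in> K" "h \<otimes> k = a \<otimes> b"
          by (auto simp: z_def)
        have c: "h \<in> carrier G" "k \<in> carrier G" "a \<in> carrier G" "b \<in> carrier G"
          using p ab' cH cK by auto
        \<comment> \<open>Two factorisations of z differ by an element that lies in both
          subgroups.\<close>
        have d: "inv a \<otimes> h = b \<otimes> inv k"
          using c ab'(3) by (metis inv_solve_right' inv_solve_left inv_closed m_assoc m_closed)
        then have "inv a \<otimes> h \<in> H \<inter> K"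
          using p ab' H K by (metis IntI subgroup.m_closed subgroup.m_inv_closed)
        moreover have "F (z, inv a \<otimes> h) = p"
          using c p by (simp add: F_def ab word_simps flip: ab'(3))
        ultimately show "p \<in> F ` ((H <#> K) \<times> (H \<inter> K))"
          using z by blast
      qed
    qed
  qed
  then have "card ((H <#> K) \<times> (H \<inter> K)) = card (H \<times> K)"
    by (rule bij_betw_same_card)
  then show ?thesis
    by (simp add: card_cartesian_product)
qed

lemma subgroup_between_prime_index:
  assumes "subgroup H G" "subgroup M G" "subgroup K G" "H \<subseteq> M" "M \<subseteq> K"
    and "card K = r * card H" "prime (r::nat)"
  shows "M = H \<or> M = K"
proof -
  obtain m where m: "card M = card H * m"
    using card_subgroup_dvd assms by blast
  obtain n where n: "card K = card M * n"
    using card_subgroup_dvd assms by blast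
  have "m * n = r"
    using m n assms(6) card_pos[OF assms(1)] by simp
  then have "m = 1 \<or> n = 1"
    using assms(7) prime_product by blast
  then show ?thesis
    using m n assms by (metis dual_order.refl mult.right_neutral subgroup_eqI)
qed

end

section \<open>Chains of subgroups of prime index\<close>

text \<open>Only the primes in the set matter, so the intervals \<open>{n..}\<close> and
  \<open>{..<n}\<close> can stand for the large and the small primes.\<close>

definition pi_number :: "nat set \<Rightarrow> nat \<Rightarrow> bool" where
  "pi_number \<pi> n \<longleftrightarrow> (\<forall>p. prime p \<longrightarrow> p dvd n \<longrightarrow> p \<in> \<pi>)"

lemma pi_number_dvd: "pi_number \<pi> n \<Longrightarrow> m dvd n \<Longrightarrow> pi_number \<pi> m"
  by (meson dvd_trans pi_number_def)

lemma pi_number_mono: "pi_number \<pi> n \<Longrightarrow> \<pi> \<subseteq> \<sigma> \<Longrightarrow> pi_number \<sigma> n"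
  by (auto simp: pi_number_def)

lemma pi_number_mult: "pi_number \<pi> m \<Longrightarrow> pi_number \<pi> n \<Longrightarrow> pi_number \<pi> (m * n)"
  by (auto simp: pi_number_def prime_dvd_mult_iff)

lemma pi_number_one [simp]: "pi_number \<pi> (Suc 0)"
  by (auto simp: pi_number_def)

lemma pi_number_prime: "prime p \<Longrightarrow> p \<in> \<pi> \<Longrightarrow> pi_number \<pi> p"
  using primes_dvd_imp_eq by (auto simp: pi_number_def)

lemma pi_number_prime_power: "prime p \<Longrightarrow> p \<in> \<pi> \<Longrightarrow> pi_number \<pi> (p ^ k)"
  by (auto simp: pi_number_def dest: prime_dvd_power primes_dvd_imp_eq)

lemma pi_number_coprime:
  assumes "pi_number \<pi> m" "pi_number \<sigma> n" "\<pi> \<inter> \<sigma> = {}"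
  shows "coprime m n"
proof (rule ccontr)
  assume "\<not> coprime m n"
  then obtain d where "d dvd m" "d dvd n" "d \<noteq> 1"
    by (auto simp: coprime_def)
  then obtain p where "prime p" "p dvd m" "p dvd n"
    by (metis dvd_trans prime_factor_nat)
  then show False
    using assms by (auto simp: pi_number_def)
qed

lemma pi_number_trivial:
  assumes "pi_number \<pi> m" "pi_number \<sigma> m" "\<pi> \<inter> \<sigma> = {}"
  shows "m = 1"
  using pi_number_coprime[OF assms] by simp

lemma pi_number_singleton:
  assumes "prime p" "n > 0" "pi_number {p} n"
  shows "\<exists>k. n = p ^ k"
proof -
  obtain m where m: "n = p ^ multiplicity p n * m" "\<not> p dvd m"
    using multiplicity_decompose'[of n p] assms prime_gt_1_nat[of p]
    by (metis nat_neq_iff not_prime_unit)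
  have "m = 1"
  proof (rule ccontr)
    assume "m \<noteq> 1"
    then obtain q where "prime q" "q dvd m"
      using prime_factor_nat by blast
    then show False
      using assms(3) m by (metis dvd_mult pi_number_def singletonD)
  qed
  then show ?thesis
    using m by auto
qed

lemma dvd_prime_powerE:
  assumes "prime p" "(m::nat) dvd p ^ k"
  obtains i where "m = p ^ i" "i \<le> k"
  using assms divides_primepow_nat by blast

context group
begin

text \<open>One relation for two notions: an empty \<open>X\<close> imposes no invariance, so
  \<open>psub\<close> is P-subnormality, while a Sylow q-subgroup for \<open>X\<close> and
  \<open>{p}\<close> for \<open>\<pi>\<close> give the invariant chains in the p-sections. Indices
  are stated through orders, which avoids cosets.\<close>

inductive chain :: "'a set \<Rightarrow> nat set \<Rightarrow> 'a set \<Rightarrow> 'a set \<Rightarrow> bool"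
  for X :: "'a set" and \<pi> :: "nat set" where
  refl: "subgroup H G \<Longrightarrow> normalises X H \<Longrightarrow> chain X \<pi> H H"
| step: "chain X \<pi> H K \<Longrightarrow> subgroup L G \<Longrightarrow> normalises X L \<Longrightarrow> K \<subseteq> L \<Longrightarrow>
    card L = r * card K \<Longrightarrow> prime r \<Longrightarrow> r \<in> \<pi> \<Longrightarrow> chain X \<pi> H L"

abbreviation psub :: "'a set \<Rightarrow> 'a set \<Rightarrow> bool" where
  "psub H K \<equiv> chain {} UNIV H K"

lemma chainD:
  assumes "chain X \<pi> H K"
  shows "subgroup H G" "subgroup K G" "normalises X H" "normalises X K" "H \<subseteq> K"
  using assms by (induction; blast)+

lemma chain_trans: "chain X \<pi> K L \<Longrightarrow> chain X \<pi> H K \<Longrightarrow> chain X \<pi> H L"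
  by (induction rule: chain.induct) (auto intro: chain.step)

lemma chain_mono: "chain X \<pi> H K \<Longrightarrow> Y \<subseteq> X \<Longrightarrow> \<pi> \<subseteq> \<sigma> \<Longrightarrow> chain Y \<sigma> H K"
  by (induction rule: chain.induct) (auto intro: chain.intros normalises_subset)

text \<open>Keeps the members of a chain and only upgrades their invariance. This serves when
  additional operators centralise the whole section.\<close>

lemma chain_normalises:
  assumes "chain X \<pi> H K" "\<And>M. subgroup M G \<Longrightarrow> normalises X M \<Longrightarrow> H \<subseteq> M \<Longrightarrow> M \<subseteq> K \<Longrightarrow> normalises Y M"
  shows "chain Y \<pi> H K"
  using assms
proof (induction rule: chain.induct)
  case (step H K L r)
  have "H \<subseteq> L" "subgroup L G"
    using step.hyps chainD(5) by blast+
  moreover have "chain Y \<pi> H K"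
    using step by blast
  ultimately show ?case
    using step by (meson chain.step subset_refl)
qed (auto intro: chain.refl)

lemma chain_card: "chain X \<pi> H K \<Longrightarrow> \<exists>m. card K = m * card H \<and> pi_number \<pi> m"
proof (induction rule: chain.induct)
  case (step H K L r)
  then obtain m where m: "card K = m * card H" "pi_number \<pi> m"
    by blast
  have "card L = r * m * card H"
    using step.hyps(5) m by simp
  moreover have "pi_number \<pi> (r * m)"
    by (intro pi_number_mult pi_number_prime step.hyps m)
  ultimately
  show ?case
    by blast
qed (auto intro!: exI[of _ 1])

lemma chain_psub: "chain X \<pi> H K \<Longrightarrow> psub H K"
  by (rule chain_mono) auto

end

context fin_group
begin

text \<open>Orders multiply along the chain, so the index of every step divides
  \<open>m\<close>.\<close>

lemma chain_restrict:
  assumes "chain X \<pi> H K" "card K = m * card H" "pi_number \<sigma> m"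
  shows "chain X (\<pi> \<inter> \<sigma>) H K"
  using assms
proof (induction arbitrary: m rule: chain.induct)
  case (step H K L r)
  obtain m' where m': "card K = m' * card H"
    using chain_card step.hyps(1) by blast
  have "m = r * m'"
    using m' step.hyps(5) step.prems(1) card_pos[OF chainD(1)[OF step.hyps(1)]] by simp
  then have "pi_number \<sigma> m'" "pi_number \<sigma> r"
    using step.prems(2) pi_number_dvd by auto
  then have "chain X (\<pi> \<inter> \<sigma>) H K" "r \<in> \<sigma>"
    using step m' by (auto simp: pi_number_def)
  then show ?case
    using step by (meson IntI chain.step)
qed (auto intro: chain.refl)

text \<open>\<open>(K <#> N) \<inter> L\<close> lies between \<open>K\<close> and \<open>L\<close>,
  so it is one of them. If it is \<open>L\<close>, both products agree; if it is \<open>K\<close>,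
  then \<open>L \<inter> N = K \<inter> N\<close> and the product formula carries the index over
  unchanged.\<close>

lemma setmult_prime_step:
  assumes "subgroup K G" "subgroup L G" "subgroup N G" "K \<subseteq> L" "card L = r * card K" "prime r"
    and KN: "subgroup (K <#> N) G" and LN: "subgroup (L <#> N) G"
  shows "L <#> N = K <#> N \<or> card (L <#> N) = r * card (K <#> N)"
proof -
  let ?M = "(K <#> N) \<inter> L"
  have K: "K \<subseteq> K <#> N" and N: "N \<subseteq> K <#> N"
    using assms by (simp_all add: subset_setmult_left subset_setmult_right)
  have "subgroup ?M G"
    using subgroups_Inter_pair assms by blast
  then consider "?M = K" | "?M = L"
    using subgroup_between_prime_index[of K ?M L r] assms K by blast
  then show ?thesis
  proof cases
    case 1
    then have "L \<inter> N = K \<inter> N"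
      using N assms(4) by blast
    then have "card (L <#> N) * card (K \<inter> N) = r * card (K <#> N) * card (K \<inter> N)"
      using card_setmult[OF assms(2,3)] card_setmult[OF assms(1,3)] assms(5) by (simp add: ac_simps)
    moreover have "card (K \<inter> N) > 0"
      using card_pos subgroups_Inter_pair assms by blast
    ultimately show ?thesis
      by simp
  next
    case 2
    then have "L <#> N \<subseteq> K <#> N"
      using setmult_subset[OF KN _ N] by blast
    then show ?thesis
      using setmult_mono[OF assms(4) subset_refl] by blast
  qed
qed

text \<open>The last assumption concerns \<open>X\<close>-invariant subgroups only. It thereby
  admits two choices of \<open>N\<close>: a normal subgroup of \<open>G\<close>, or the acting group
  \<open>X\<close> itself.\<close>

lemma chain_setmult:
  assumes "chain X \<pi> H K" "subgroup N G" "X \<subseteq> carrier G" "normalises X N"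
    and "\<And>M. subgroup M G \<Longrightarrow> normalises X M \<Longrightarrow> subgroup (M <#> N) G"
  shows "chain X \<pi> (H <#> N) (K <#> N)"
  using assms
proof (induction rule: chain.induct)
  case (refl H)
  then show ?case
    by (auto intro!: chain.refl normalises_setmult)
next
  case (step H K L r)
  have K: "subgroup K G" "normalises X K"
    by (rule chainD[OF step.hyps(1)])+
  have IH: "chain X \<pi> (H <#> N) (K <#> N)"
    using step by blast
  have "L <#> N = K <#> N \<or> card (L <#> N) = r * card (K <#> N)"
    using K step by (intro setmult_prime_step) auto
  then show ?case
  proof
    assume *: "card (L <#> N) = r * card (K <#> N)"
    show ?thesis
      by (rule chain.step[OF IH _ _ _ * step.hyps(6,7)])
        (use step in \<open>simp_all add: normalises_setmult setmult_mono\<close>)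
  qed (use IH in simp)
qed

lemma chain_setmult_normal:
  assumes "chain X \<pi> H K" "subgroup N G" "normalises (carrier G) N" "X \<subseteq> carrier G"
  shows "chain X \<pi> (H <#> N) (K <#> N)"
proof (rule chain_setmult[OF assms(1,2,4)])
  show "normalises X N"
    using assms(3,4) normalises_subset by blast
  show "subgroup (M <#> N) G" if "subgroup M G" for M
    using that assms by (meson normalises_subset subgroup.subset subgroup_setmult)
qed

text \<open>Turns invariance into subnormality: \<open>Q\<close> times a \<open>Q\<close>-invariant
  subgroup is a subgroup, so an invariant chain yields an ordinary one above
  \<open>Q\<close>.\<close>

lemma psub_setmult_left:
  assumes "chain Q \<pi> H K" "subgroup Q G"
  shows "psub (Q <#> H) (Q <#> K)"
proof -
  have Q: "Q \<subseteq> carrier G"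
    by (simp add: assms(2) subgroup.subset)
  have "subgroup (M <#> Q) G" if "subgroup M G" "normalises Q M" for M
    using setmult_swap[of Q M] subgroup_setmult[of Q M] that assms(2) by simp
  then have "chain Q \<pi> (H <#> Q) (K <#> Q)"
    using assms Q by (intro chain_setmult) (simp_all add: normalises_self)
  moreover have "H <#> Q = Q <#> H" "K <#> Q = Q <#> K"
    using setmult_swap assms chainD by blast+
  ultimately show ?thesis
    using chain_psub by simp
qed

lemma subgroup_Int: "subgroup H G \<Longrightarrow> subgroup K G \<Longrightarrow> subgroup (H \<inter> K) G"
  by (rule subgroups_Inter_pair)

text \<open>A step of index p meets \<open>D\<close> in a step of index at most p, which could be
  any number in that range. The hypothesis on \<open>U\<close>, a bound that stays fixed while the
  top of the chain grows, forces a power of p, hence 1 or p.\<close>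

lemma chain_Int:
  assumes "chain X {p} L K" "subgroup D G" "normalises X D" "K \<subseteq> U" "subgroup U G"
    and "card (U \<inter> D) = p ^ j * card (L \<inter> D)"
  shows "chain X {p} (L \<inter> D) (K \<inter> D)"
  using assms
proof (induction rule: chain.induct)
  case (refl H)
  then show ?case
    by (auto intro!: chain.refl normalises_Int subgroup_Int)
next
  case (step H K L r)
  have K: "subgroup K G" "subgroup H G" "H \<subseteq> K"
    by (rule chainD[OF step.hyps(1)])+
  have r: "r = p" "prime p"
    using step by auto
  have IH: "chain X {p} (H \<inter> D) (K \<inter> D)"
    using step by blast
  have sub: "subgroup (K \<inter> D) G" "subgroup (L \<inter> D) G" "subgroup (H \<inter> D) G" "subgroup (U \<inter> D) G"
    using K step subgroup_Int by auto
  obtain m where m: "card (L \<inter> D) = card (K \<inter> D) * m"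
    using card_subgroup_dvd[of "K \<inter> D" "L \<inter> D"] sub step.hyps(4) by blast
  obtain x where x: "card (K \<inter> D) = card (H \<inter> D) * x"
    using card_subgroup_dvd[of "H \<inter> D" "K \<inter> D"] sub K by blast
  obtain y where y: "card (U \<inter> D) = card (L \<inter> D) * y"
    using card_subgroup_dvd[of "L \<inter> D" "U \<inter> D"] sub step.prems by blast
  have "card (H \<inter> D) * (m * x * y) = card (H \<inter> D) * p ^ j"
    using m x y step.prems by (simp add: ac_simps)
  then have mxy: "m * x * y = p ^ j"
    using card_pos[OF sub(3)] by simp
  have "m dvd p ^ j"
    by (simp add: mult.assoc flip: mxy)
  then obtain i where i: "m = p ^ i"
    using dvd_prime_powerE r by metis
  \<comment> \<open>The product is perhaps only a subset of \<open>L\<close>, but its size |L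
    \<inter> D| |K| / |K \<inter> D| bounds the new index by p.\<close>
  have "card ((L \<inter> D) <#> K) \<le> card L"
    by (intro card_mono finite_subgroup setmult_subset) (use step in auto)
  moreover have "(L \<inter> D) \<inter> K = K \<inter> D"
    using step.hyps(4) by blast
  then have "card ((L \<inter> D) <#> K) * card (K \<inter> D) = card (L \<inter> D) * card K"
    using card_setmult[OF sub(2) K(1)] by simp
  ultimately have "card (L \<inter> D) * card K \<le> card L * card (K \<inter> D)"
    by (metis mult_le_mono1)
  then have "m * (card (K \<inter> D) * card K) \<le> p * (card (K \<inter> D) * card K)"
    using m step r by (simp add: ac_simps)
  then have "p ^ i \<le> p ^ 1"
    using card_pos sub K i by simp
  then have "i \<le> 1"
    using r by (metis power_le_imp_le_exp prime_gt_1_nat)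
  then consider "i = 0" | "i = 1"
    by linarith
  then show ?case
  proof cases
    case 1
    then have "card (L \<inter> D) \<le> card (K \<inter> D)"
      using m i by simp
    then have "K \<inter> D = L \<inter> D"
      using subgroup_eqI[OF sub(2)] step.hyps(4) by blast
    then show ?thesis
      using IH by simp
  next
    case 2
    then have *: "card (L \<inter> D) = p * card (K \<inter> D)"
      using m i by simp
    show ?thesis
      by (rule chain.step[OF IH _ _ _ * r(2)])
        (use step sub in \<open>auto intro!: normalises_Int\<close>)
  qed
qed

text \<open>If a step \<open>K \<subset> M\<close> of index \<open>r\<close> enlarges the intersection with \<open>U\<close>, then \<open>K(M \<inter> U) = M\<close>, so
  \<open>r\<close> divides a power of \<open>p\<close>.\<close>

lemma psub_Int_section:
  assumes "chain {} \<pi> H K" "subgroup U G" "normalises (carrier G) U" "subgroup L G" "L \<subseteq> H" "L \<subseteq> U"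
    and "card U = p ^ j * card L" "prime p"
  shows "chain H {p} (H \<inter> U) (K \<inter> U)"
  using assms
proof (induction rule: chain.induct)
  case (refl H)
  then have "normalises H U" "normalises H H"
    by (auto intro: normalises_subset normalises_self dest: subgroup.subset)
  then show ?case
    using refl by (auto intro!: chain.refl normalises_Int subgroup_Int)
next
  case (step H K M r)
  have K: "subgroup K G" "subgroup H G" "H \<subseteq> K"
    by (rule chainD[OF step.hyps(1)])+
  have IH: "chain H {p} (H \<inter> U) (K \<inter> U)"
    using step by blast
  have sub: "subgroup (K \<inter> U) G" "subgroup (M \<inter> U) G"
    using K step subgroup_Int by auto
  have norm: "normalises M (M \<inter> U)"
    using step.prems step.hyps
    by (meson normalises_Int normalises_self normalises_subset subgroup.subset subset_refl)
  have "subgroup (K <#> (M \<inter> U)) G"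
    using norm K sub step.hyps(4) by (auto intro: subgroup_setmult normalises_subset)
  moreover have "K \<subseteq> K <#> (M \<inter> U)"
    using K sub by (simp add: subset_setmult_left)
  moreover have "K <#> (M \<inter> U) \<subseteq> M"
    using step by (intro setmult_subset) auto
  ultimately consider "K <#> (M \<inter> U) = K" | "K <#> (M \<inter> U) = M"
    using subgroup_between_prime_index[of K "K <#> (M \<inter> U)" M r] K step by blast
  then show ?case
  proof cases
    case 1
    then have "M \<inter> U \<subseteq> K"
      using K sub subset_setmult_right by metis
    then have "K \<inter> U = M \<inter> U"
      using step.hyps(4) by blast
    then show ?thesis
      using IH by simp
  next
    case 2
    have "K \<inter> (M \<inter> U) = K \<inter> U"
      using step.hyps(4) by blast
    then have "card K * card (M \<inter> U) = card K * (r * card (K \<inter> U))"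
      using card_setmult[OF K(1) sub(2)] 2 step.hyps by (auto simp: ac_simps)
    then have *: "card (M \<inter> U) = r * card (K \<inter> U)"
      using card_pos[OF K(1)] by simp
    obtain x where x: "card (K \<inter> U) = card L * x"
      using card_subgroup_dvd[of L "K \<inter> U"] sub K step.prems by blast
    obtain y where y: "card U = card (M \<inter> U) * y"
      using card_subgroup_dvd[of "M \<inter> U" U] sub step.prems by blast
    have "card L * (r * x * y) = card L * p ^ j"
      using x y * step.prems by (auto simp: ac_simps)
    then have "r * x * y = p ^ j"
      using card_pos[OF step.prems(3)] by simp
    then have "r dvd p ^ j"
      by (metis dvd_triv_left mult.assoc)
    then have "r = p"
      using step by (metis prime_dvd_power primes_dvd_imp_eq)
    \<comment> \<open>Invariance is claimed for the bottom \<open>H\<close> alone, and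
      \<open>H\<close> is contained in every member of the chain.\<close>
    moreover have "normalises H (M \<inter> U)"
      using norm K step.hyps(4) by (meson normalises_subset subset_trans)
    ultimately show ?thesis
      using chain.step[OF IH sub(2) _ _ *] step by blast
  qed
qed

end

section \<open>Largest normal \<open>\<pi>\<close>-subgroups\<close>

context group
begin

definition Opi :: "nat set \<Rightarrow> 'a set \<Rightarrow> 'a set" where
  "Opi \<pi> K = \<Union>{R. subgroup R G \<and> R \<subseteq> K \<and> normalises K R \<and> pi_number \<pi> (card R)}"

definition is_sylow :: "nat \<Rightarrow> 'a set \<Rightarrow> 'a set \<Rightarrow> bool" where
  "is_sylow q Q D \<longleftrightarrow> prime q \<and> subgroup Q G \<and> Q \<subseteq> D \<and> card Q = q ^ multiplicity q (card D)"

end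

context fin_group
begin

lemma Opi_max: "subgroup R G \<Longrightarrow> R \<subseteq> K \<Longrightarrow> normalises K R \<Longrightarrow> pi_number \<pi> (card R) \<Longrightarrow> R \<subseteq> Opi \<pi> K"
  by (auto simp: Opi_def)

text \<open>A member \<open>R\<close> of largest order absorbs every other member \<open>S\<close>,
  since \<open>R <#> S\<close> is again in the family. So the defining union is \<open>R\<close>
  itself.\<close>

lemma Opi_greatest:
  assumes K: "subgroup K G"
  shows "subgroup (Opi \<pi> K) G \<and> Opi \<pi> K \<subseteq> K \<and> normalises K (Opi \<pi> K) \<and> pi_number \<pi> (card (Opi \<pi> K))"
proof -
  let ?S = "{R. subgroup R G \<and> R \<subseteq> K \<and> normalises K R \<and> pi_number \<pi> (card R)}"
  have KG: "K \<subseteq> carrier G"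
    using K by (rule subgroup.subset)
  have "{\<one>} \<in> ?S"
    using K KG by (auto simp: triv_subgroup normalises_one subgroup.one_closed)
  moreover have "finite ?S"
    by (rule finite_subset[of _ "Pow K"]) (use finite_subgroup[OF K] in auto)
  ultimately have "Max (card ` ?S) \<in> card ` ?S" and le: "\<And>S. S \<in> ?S \<Longrightarrow> card S \<le> Max (card ` ?S)"
    by (blast intro: Max_in, intro Max_ge) auto
  then obtain R where "R \<in> ?S" "card R = Max (card ` ?S)"
    by fastforce
  then have R: "R \<in> ?S" "\<And>S. S \<in> ?S \<Longrightarrow> card S \<le> card R"
    using le by simp_all
  have "S \<subseteq> R" if S: "S \<in> ?S" for S
  proof -
    have RS: "subgroup R G" "subgroup S G" "normalises R S"
      using R S normalises_subset by auto
    have "subgroup (R <#> S) G"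
      using RS by (rule subgroup_setmult)
    moreover have "R <#> S \<subseteq> K"
      using R S K by (intro setmult_subset) auto
    moreover have "normalises K (R <#> S)"
      using R S KG by (intro normalises_setmult) auto
    moreover have "card (R <#> S) dvd card R * card S"
      by (metis RS(1,2) card_setmult dvd_triv_left)
    then have "pi_number \<pi> (card (R <#> S))"
      using R S pi_number_dvd pi_number_mult by blast
    ultimately have "R <#> S \<in> ?S"
      by simp
    then have "R = R <#> S"
      using R RS by (intro subgroup_eqI) (auto simp: subset_setmult_left)
    then show ?thesis
      using RS subset_setmult_right by metis
  qed
  then have "Opi \<pi> K = R"
    unfolding Opi_def using R(1) by blast
  then show ?thesis
    using R(1) by simp
qed

lemmas subgroup_Opi [simp] = Opi_greatest[THEN conjunct1]
lemmas Opi_subset = Opi_greatest[THEN conjunct2, THEN conjunct1]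
lemmas normalises_Opi = Opi_greatest[THEN conjunct2, THEN conjunct2, THEN conjunct1]
lemmas pi_number_Opi = Opi_greatest[THEN conjunct2, THEN conjunct2, THEN conjunct2]

lemma Opi_mono: "subgroup K G \<Longrightarrow> \<pi> \<subseteq> \<sigma> \<Longrightarrow> Opi \<pi> K \<subseteq> Opi \<sigma> K"
  by (meson Opi_max Opi_subset normalises_Opi pi_number_Opi pi_number_mono subgroup_Opi)

text \<open>\<open>Opi \<pi> C\<close> is characteristic in \<open>C\<close>: its conjugate by g in
  \<open>K\<close> is again a normal subgroup of \<open>C\<close> of the right order, so maximality
  puts it back into \<open>Opi \<pi> C\<close>.\<close>

lemma Opi_normal_subgroup:
  assumes C: "subgroup C G" and K: "subgroup K G" and "C \<subseteq> K" and n: "normalises K C"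
  shows "Opi \<pi> C \<subseteq> Opi \<pi> K"
proof (rule Opi_max)
  note O = subgroup_Opi[OF C, of \<pi>] Opi_subset[OF C, of \<pi>] normalises_Opi[OF C, of \<pi>]
  have CG: "C \<subseteq> carrier G" and KG: "K \<subseteq> carrier G"
    using C K subgroup.subset by auto
  show "subgroup (Opi \<pi> C) G" "pi_number \<pi> (card (Opi \<pi> C))"
    using O pi_number_Opi[OF C] by auto
  show "Opi \<pi> C \<subseteq> K"
    using O assms by auto
  show "normalises K (Opi \<pi> C)"
    unfolding normalises_def
  proof (intro ballI)
    fix g x assume g: "g \<in> K" and x: "x \<in> Opi \<pi> C"
    let ?R = "(\<lambda>h. g \<otimes> h \<otimes> inv g) ` Opi \<pi> C"
    have gG: "g \<in> carrier G"
      using g KG by auto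
    have "?R \<subseteq> Opi \<pi> C"
    proof (rule Opi_max)
      show "subgroup ?R G"
        using O gG subgroup_conj by blast
      show "?R \<subseteq> C"
        using O g n by (auto intro: normalisesD)
      show "pi_number \<pi> (card ?R)"
        using pi_number_Opi[OF C] card_conj[OF gG, of "Opi \<pi> C"] O CG by auto
      show "normalises C ?R"
        unfolding normalises_def
      proof (intro ballI)
        fix c r assume c: "c \<in> C" and "r \<in> ?R"
        then obtain h where h: "h \<in> Opi \<pi> C" "r = g \<otimes> h \<otimes> inv g"
          by auto
        then have G: "c \<in> carrier G" "h \<in> carrier G"
          using c O CG by auto
        have "(inv g \<otimes> c \<otimes> g) \<otimes> h \<otimes> inv (inv g \<otimes> c \<otimes> g) \<in> Opi \<pi> C"
          using normalisesD[OF O(3) normalisesD_inv[OF K n g c] h(1)] .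
        moreover have "c \<otimes> r \<otimes> inv c = g \<otimes> ((inv g \<otimes> c \<otimes> g) \<otimes> h \<otimes> inv (inv g \<otimes> c \<otimes> g)) \<otimes> inv g"
          using G gG by (simp add: h word_simps)
        ultimately show "c \<otimes> r \<otimes> inv c \<in> ?R"
          by blast
      qed
    qed
    then show "g \<otimes> x \<otimes> inv g \<in> Opi \<pi> C"
      using x by blast
  qed
qed

text \<open>The orbit of the coset \<open>H\<close> under \<open>gOg\<inverse>\<close> misses the fixed point \<open>gH\<close>, so it has fewer
  than \<open>r \<le> n\<close> elements, while its length has no prime factor below \<open>n\<close>.\<close>

lemma conj_in_small_index:
  assumes H: "subgroup H G" and K: "subgroup K G" and R: "subgroup R G" and L: "subgroup L G"
    and "H \<subseteq> K" "R \<subseteq> H" "L \<subseteq> R" and KL: "normalises K L"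
    and r: "card K = r * card H" "r \<le> n"
    and i: "card R = i * card L" "pi_number {n..} i"
    and g: "g \<in> K" and x: "x \<in> R"
  shows "g \<otimes> x \<otimes> inv g \<in> H"
proof (cases "g \<in> H")
  case True
  then show ?thesis
    using H assms(6) x by (auto intro!: subgroup.m_closed subgroup.m_inv_closed)
next
  case False
  let ?c = "\<lambda>h. g \<otimes> h \<otimes> inv g"
  let ?R = "?c ` R"
  have gG: "g \<in> carrier G"
    using g K subgroup_carrier by blast
  have sR: "subgroup ?R G"
    using R gG by (rule subgroup_conj)
  have RK: "?R \<subseteq> K"
    using g assms(5,6) K by (auto intro!: subgroup.m_closed subgroup.m_inv_closed)
  have "?R <#> H \<subseteq> K"
    using RK K assms(5) by (intro setmult_subset) auto
  moreover have "(\<lambda>h. g \<otimes> h) ` H \<subseteq> K"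
    using g K assms(5) by (auto intro: subgroup.m_closed)
  \<comment> \<open>This is where g outside \<open>H\<close> enters: a common element of the two
    sets would express g as h' h^-1 y, a product of elements of \<open>H\<close>.\<close>
  moreover have "(?R <#> H) \<inter> (\<lambda>h. g \<otimes> h) ` H = {}"
  proof (rule ccontr)
    assume "(?R <#> H) \<inter> (\<lambda>h. g \<otimes> h) ` H \<noteq> {}"
    then obtain y h h' where *: "y \<in> R" "h \<in> H" "h' \<in> H" "?c y \<otimes> h' = g \<otimes> h"
      by (fastforce simp: setmult_iff)
    then have G: "y \<in> carrier G" "h \<in> carrier G" "h' \<in> carrier G"
      using R H subgroup_carrier by auto
    have "y \<otimes> inv g \<otimes> h' = h"
      using *(4) G gG by (simp add: word_simps)
    then have "g = h' \<otimes> inv h \<otimes> y"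
      using G gG by (auto simp: word_simps)
    then show False
      using False * H assms(6) by (auto simp: subgroup.m_closed subgroup.m_inv_closed)
  qed
  ultimately have "card (?R <#> H) + card ((\<lambda>h. g \<otimes> h) ` H) \<le> card K"
    using finite_subgroup[OF K] by (metis (no_types, lifting) Un_subset_iff card_Un_disjoint card_mono finite_subset)
  moreover have "card ((\<lambda>h. g \<otimes> h) ` H) = card H"
    using gG H subgroup_carrier by (intro card_image inj_onI) auto
  ultimately have le: "card (?R <#> H) + card H \<le> r * card H"
    using r by simp
  have sI: "subgroup (?R \<inter> H) G"
    using sR H by (rule subgroup_Int)
  obtain m where m: "card ?R = card (?R \<inter> H) * m"
    using card_subgroup_dvd[OF sI sR] by blast
  \<comment> \<open>\<open>L\<close> is normal in \<open>K\<close>, so it survives in the conjugate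
    and in the intersection. The orbit length \<open>m\<close> therefore divides the relative order
    \<open>i\<close>.\<close>
  have "L \<subseteq> ?R \<inter> H"
  proof
    fix l assume l: "l \<in> L"
    then have "inv g \<otimes> l \<otimes> g \<in> R"
      using normalisesD_inv[OF K KL g] assms(7) by blast
    moreover have "l = ?c (inv g \<otimes> l \<otimes> g)"
      using l L gG subgroup_carrier by (simp add: word_simps)
    ultimately show "l \<in> ?R \<inter> H"
      using l assms(6,7) by blast
  qed
  then obtain k where k: "card (?R \<inter> H) = card L * k"
    using card_subgroup_dvd[OF L sI] by blast
  have cR: "card ?R = card R"
    using card_conj gG R subgroup.subset by blast
  have "card L * (k * m) = card L * i"
    using m k cR i by auto
  then have km: "k * m = i"
    using card_pos[OF L] by simp
  have "card (?R <#> H) = m * card H"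
    using card_setmult[OF sR H] m card_pos[OF sI] by (simp add: ac_simps)
  then have "m * card H + card H \<le> r * card H"
    using le by simp
  then have "(m + 1) * card H \<le> r * card H"
    by simp
  then have "m + 1 \<le> r"
    using card_pos[OF H] mult_le_cancel2 by blast
  then have "m < n"
    using r by simp
  have "m > 0"
    using m card_pos[OF sR] by (metis mult_0_right neq0_conv)
  have "m = 1"
  proof (rule ccontr)
    assume "m \<noteq> 1"
    then obtain p where p: "prime p" "p dvd m"
      using prime_factor_nat by blast
    then have "p \<in> {n..}"
      using i km by (metis dvd_mult pi_number_def)
    then show False
      using p \<open>m < n\<close> \<open>m > 0\<close> by (auto dest: dvd_imp_le)
  qed
  then have "?R \<inter> H = ?R"
    using m by (intro subgroup_eqI[OF sR]) auto
  then show ?thesis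
    using x by blast
qed

text \<open>By \<open>conj_in_small_index\<close> with trivial \<open>L\<close>, all
  \<open>K\<close>-conjugates of \<open>Opi {n..} H\<close> stay in \<open>H\<close>. Hence it lies
  in the normal core \<open>C\<close> of \<open>H\<close> in \<open>K\<close>, thus in
  \<open>Opi {n..} C\<close>, which is normal in \<open>K\<close>.\<close>

lemma Opi_small_index:
  assumes H: "subgroup H G" and K: "subgroup K G" and "H \<subseteq> K"
    and r: "card K = r * card H" "r \<le> n"
  shows "Opi {n..} H \<subseteq> Opi {n..} K"
proof -
  let ?R = "Opi {n..} H"
  define C where "C = {x \<in> H. \<forall>g\<in>K. g \<otimes> x \<otimes> inv g \<in> H}"
  have HG: "H \<subseteq> carrier G" and KG: "K \<subseteq> carrier G"
    using H K subgroup.subset by auto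
  have "?R \<subseteq> C"
  proof
    fix x assume x: "x \<in> ?R"
    have "g \<otimes> x \<otimes> inv g \<in> H" if "g \<in> K" for g
      by (rule conj_in_small_index[where L = "{\<one>}" and R = ?R and i = "card ?R"])
        (use assms x that KG in \<open>auto simp: triv_subgroup normalises_one Opi_subset pi_number_Opi
          subgroup.one_closed\<close>)
    then show "x \<in> C"
      using x Opi_subset[OF H] by (auto simp: C_def)
  qed
  have C: "subgroup C G"
  proof (rule finite_group_subgroupI)
    show "C \<subseteq> carrier G"
      using HG by (auto simp: C_def)
    show "\<one> \<in> C"
      using H KG by (auto simp: C_def subgroup.one_closed)
    fix x y assume xy: "x \<in> C" "y \<in> C"
    have "g \<otimes> (x \<otimes> y) \<otimes> inv g \<in> H" if g: "g \<in> K" for g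
    proof -
      have "g \<otimes> (x \<otimes> y) \<otimes> inv g = (g \<otimes> x \<otimes> inv g) \<otimes> (g \<otimes> y \<otimes> inv g)"
        using g xy HG KG by (auto simp: C_def word_simps subset_iff)
      then show ?thesis
        using xy g H by (auto simp: C_def intro: subgroup.m_closed)
    qed
    then show "x \<otimes> y \<in> C"
      using xy H by (auto simp: C_def intro: subgroup.m_closed)
  qed
  have KC: "normalises K C"
    unfolding normalises_def
  proof (intro ballI)
    fix g x assume g: "g \<in> K" and x: "x \<in> C"
    have "h \<otimes> (g \<otimes> x \<otimes> inv g) \<otimes> inv h \<in> H" if h: "h \<in> K" for h
    proof -
      have "h \<otimes> (g \<otimes> x \<otimes> inv g) \<otimes> inv h = (h \<otimes> g) \<otimes> x \<otimes> inv (h \<otimes> g)"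
        using g h x HG KG by (auto simp: C_def word_simps subset_iff)
      then show ?thesis
        using x g h K by (auto simp: C_def intro: subgroup.m_closed)
    qed
    then show "g \<otimes> x \<otimes> inv g \<in> C"
      using x g by (auto simp: C_def)
  qed
  have CH: "C \<subseteq> H"
    by (auto simp: C_def)
  have "?R \<subseteq> Opi {n..} C"
    using \<open>?R \<subseteq> C\<close> normalises_subset[OF normalises_Opi[OF H] CH] H
    by (intro Opi_max) (auto simp: pi_number_Opi)
  also have "\<dots> \<subseteq> Opi {n..} K"
    using C K KC CH assms(3) by (intro Opi_normal_subgroup) auto
  finally show ?thesis .
qed

lemma Opi_chain: "chain X {..n} H K \<Longrightarrow> Opi {n..} H \<subseteq> Opi {n..} K"
proof (induction rule: chain.induct)
  case (step H K L r)
  then have "Opi {n..} K \<subseteq> Opi {n..} L"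
    using chainD(2)[OF step.hyps(1)] by (intro Opi_small_index) auto
  then show ?case
    using step by blast
qed simp

text \<open>The fact that a subgroup of index p in a p-group is normal, for K/L without forming the
  quotient: \<open>conj_in_small_index\<close> with \<open>R = H\<close> and r = n = p.\<close>

lemma index_p_normalises:
  assumes H: "subgroup H G" and K: "subgroup K G" and L: "subgroup L G"
    and "H \<subseteq> K" "L \<subseteq> H" and "normalises K L" and p: "prime p" "card K = p * card H"
    and j: "card H = p ^ j * card L"
  shows "normalises K H"
  unfolding normalises_def
proof (intro ballI)
  fix g h assume "g \<in> K" "h \<in> H"
  then show "g \<otimes> h \<otimes> inv g \<in> H"
    by (intro conj_in_small_index[OF H K H L assms(4) subset_refl assms(5,6) p(2) order_refl j])
      (auto intro: pi_number_prime_power p)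
qed

text \<open>Every orbit has length p^i with i > 0; orbits are peeled off by induction on the size of
  \<open>E\<close>. The action is an arbitrary function \<open>f\<close>, so that it can be
  translation of cosets as well as conjugation.\<close>

lemma no_fixpoint_dvd:
  assumes P: "subgroup P G" "card P = p ^ k" "prime p"
    and "finite E" "\<And>x e. x \<in> P \<Longrightarrow> e \<in> E \<Longrightarrow> f x e \<in> E" "\<And>e. e \<in> E \<Longrightarrow> f \<one> e = e"
    and "\<And>x y e. x \<in> P \<Longrightarrow> y \<in> P \<Longrightarrow> e \<in> E \<Longrightarrow> f (x \<otimes> y) e = f x (f y e)"
    and "\<And>e. e \<in> E \<Longrightarrow> \<exists>x\<in>P. f x e \<noteq> e"
  shows "p dvd card E"
  using assms(4-)
proof (induction "card E" arbitrary: E rule: less_induct)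
  case less
  show ?case
  proof (cases "E = {}")
    case False
    then obtain e where e: "e \<in> E"
      by blast
    define B where "B = (\<lambda>x. f x e) ` P"
    define S where "S = {x \<in> P. f x e = e}"
    have PG: "x \<in> P \<Longrightarrow> x \<in> carrier G" for x
      using P(1) subgroup_carrier by blast
    have BE: "B \<subseteq> E"
      using less.prems(2) e by (auto simp: B_def)
    \<comment> \<open>Orbit and stabiliser by counting: each fibre of the orbit map is a left
      translate of the stabiliser \<open>S\<close>.\<close>
    have fib: "card {x \<in> P. f x e = f y e} = card S" if y: "y \<in> P" for y
    proof -
      have yi: "inv y \<in> P"
        using P(1) y by (rule subgroup.m_inv_closed)
      have "bij_betw (\<lambda>s. y \<otimes> s) S {x \<in> P. f x e = f y e}"
      proof (rule bij_betwI[where g = "\<lambda>x. inv y \<otimes> x"])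
        show "(\<lambda>s. y \<otimes> s) \<in> S \<rightarrow> {x \<in> P. f x e = f y e}"
          using less.prems(4)[OF y _ e] P(1) y by (auto simp: S_def subgroup.m_closed)
        show "(\<lambda>x. inv y \<otimes> x) \<in> {x \<in> P. f x e = f y e} \<rightarrow> S"
          using less.prems(4)[OF yi _ e] less.prems(4)[OF yi y e] less.prems(3)[OF e] P(1) y yi
          by (auto simp: S_def subgroup.m_closed PG)
      qed (use y in \<open>auto simp: S_def PG\<close>)
      then show ?thesis
        by (simp add: bij_betw_same_card)
    qed
    have "card P = (\<Sum>b\<in>B. card {x \<in> P. f x e = b})"
      using sum.image_gen[of P "\<lambda>_. 1 :: nat" "\<lambda>x. f x e"] finite_subgroup[OF P(1)]
      by (simp add: B_def)
    also have "\<dots> = (\<Sum>b\<in>B. card S)"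
      using fib by (intro sum.cong) (auto simp: B_def)
    finally have cP: "card P = card B * card S"
      by simp
    then have "card B dvd p ^ k"
      using P(2) by (metis dvd_triv_left)
    then obtain i where i: "card B = p ^ i"
      using dvd_prime_powerE P(3) by blast
    have "i \<noteq> 0"
    proof
      assume "i = 0"
      then obtain b where "B = {b}"
        using i card_1_singletonE by auto
      then have "f x e = f \<one> e" if "x \<in> P" for x
        using that subgroup.one_closed[OF P(1)] unfolding B_def
        by (metis (no_types, lifting) imageI singletonD)
      then show False
        using less.prems(3,5)[OF e] by auto
    qed
    then have "p dvd card B"
      using i by simp
    moreover have "p dvd card (E - B)"
    proof (rule less.hyps)
      have "e \<in> B"
        using less.prems(3)[OF e] subgroup.one_closed[OF P(1)] unfolding B_def by force
      then show "card (E - B) < card E"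
        using e less.prems(1) by (intro psubset_card_mono) auto
      fix x e' assume x: "x \<in> P" and e': "e' \<in> E - B"
      have "f x e' \<notin> B"
      proof
        assume "f x e' \<in> B"
        then obtain y where y: "y \<in> P" "f x e' = f y e"
          by (auto simp: B_def)
        have xi: "inv x \<in> P"
          using P(1) x by (rule subgroup.m_inv_closed)
        have "e' = f (inv x) (f x e')"
          using less.prems(4)[OF xi x, of e'] less.prems(3) e' x PG by simp
        also have "\<dots> = f (inv x \<otimes> y) e"
          using less.prems(4)[OF xi y(1) e] y by simp
        finally have "e' \<in> B"
          using P(1) xi y by (auto simp: B_def subgroup.m_closed)
        then show False
          using e' by simp
      qed
      then show "f x e' \<in> E - B"
        using less.prems(2) x e' by blast
    qed (use less.prems in auto)
    ultimately have "p dvd card B + card (E - B)"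
      by simp
    also have "card B + card (E - B) = card E"
      using card_Diff_subset[OF finite_subset[OF BE less.prems(1)] BE] card_mono[OF less.prems(1) BE]
      by simp
    finally show ?thesis .
  qed simp
qed

end

section \<open>Sylow subgroups and the Sylow tower\<close>

context fin_group
begin

abbreviation conj_set :: "'a \<Rightarrow> 'a set \<Rightarrow> 'a set" where
  "conj_set g H \<equiv> (\<lambda>h. g \<otimes> h \<otimes> inv g) ` H"

lemma conj_set_subset: "subgroup D G \<Longrightarrow> g \<in> D \<Longrightarrow> H \<subseteq> D \<Longrightarrow> conj_set g H \<subseteq> D"
  by (auto intro!: subgroup.m_closed subgroup.m_inv_closed)

lemma conj_set_mult:
  "g \<in> carrier G \<Longrightarrow> h \<in> carrier G \<Longrightarrow> H \<subseteq> carrier G \<Longrightarrow> conj_set g (conj_set h H) = conj_set (g \<otimes> h) H"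
  unfolding image_image by (rule image_cong) (auto simp: word_simps subset_iff)

lemma conj_set_one: "H \<subseteq> carrier G \<Longrightarrow> conj_set \<one> H = H"
  by (auto simp: subset_iff image_iff)

lemma conj_set_cancel:
  "g \<in> carrier G \<Longrightarrow> H \<subseteq> carrier G \<Longrightarrow> (\<lambda>x. inv g \<otimes> x \<otimes> g) ` conj_set g H = H"
  using conj_set_mult[of "inv g" g H] conj_set_one[of H] by simp

lemma conj_set_self:
  assumes "subgroup D G" "g \<in> D"
  shows "conj_set g D = D"
  using assms card_conj[of g D] subgroup.subset[OF assms(1)]
  by (intro subgroup_eqI conj_set_subset) auto

lemma chain_conj:
  assumes "chain {} \<pi> H K" "g \<in> carrier G"
  shows "chain {} \<pi> (conj_set g H) (conj_set g K)"
  using assms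
proof (induction rule: chain.induct)
  case (refl H)
  then show ?case
    by (intro chain.refl) (simp_all add: subgroup_conj normalises_def)
next
  case (step H K L r)
  have "subgroup K G"
    using chainD(2)[OF step.hyps(1)] .
  then have "K \<subseteq> carrier G" "L \<subseteq> carrier G"
    using step.hyps(2) subgroup.subset by auto
  then have c: "card (conj_set g L) = r * card (conj_set g K)"
    using step.hyps(5) card_conj[OF step.prems] by simp
  show ?case
    by (rule chain.step[OF step.IH[OF step.prems] subgroup_conj[OF step.hyps(2) step.prems] _
          image_mono[OF step.hyps(4)] c step.hyps(6,7)])
      (simp add: normalises_def)
qed

lemma sylowD:
  assumes "is_sylow q Q D"
  shows "prime q" "subgroup Q G" "Q \<subseteq> D" "card Q = q ^ multiplicity q (card D)"
  using assms by (auto simp: is_sylow_def)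

lemma sylow_index:
  assumes "is_sylow q Q D" "subgroup D G"
  obtains m where "card D = m * card Q" "\<not> q dvd m"
proof -
  have "card D \<noteq> 0" "\<not> is_unit q"
    using card_pos[OF assms(2)] sylowD(1)[OF assms(1)] not_prime_unit by blast+
  then obtain m where "card D = q ^ multiplicity q (card D) * m" "\<not> q dvd m"
    using multiplicity_decompose' by metis
  then show thesis
    using that sylowD(4)[OF assms(1)] by (simp add: mult.commute)
qed

lemma sylow_exists:
  assumes "prime q" "subgroup D G"
  shows "\<exists>Q. is_sylow q Q D"
proof -
  interpret D: group "G\<lparr>carrier := D\<rparr>"
    using assms(2) subgroup_imp_group by blast
  have "q ^ multiplicity q (card D) dvd card D"
    by (rule multiplicity_dvd)
  then obtain m where "order (G\<lparr>carrier := D\<rparr>) = q ^ multiplicity q (card D) * m"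
    by (auto simp: order_def)
  then obtain Q where Q: "subgroup Q (G\<lparr>carrier := D\<rparr>)" "card Q = q ^ multiplicity q (card D)"
    using sylow_thm[OF assms(1) D.is_group] finite_subgroup[OF assms(2)] by auto
  then have "subgroup Q G" "Q \<subseteq> D"
    using incl_subgroup[OF assms(2)] subgroup.subset[of Q "G\<lparr>carrier := D\<rparr>"] by auto
  then show ?thesis
    using Q assms by (auto simp: is_sylow_def)
qed

text \<open>\<open>P\<close> acts on the cosets of \<open>Q\<close> in \<open>D\<close> by right
  multiplication with inverses. Their number is prime to q, so some coset \<open>Q #> d\<close> is
  fixed, and this says that d P d^-1 lies in \<open>Q\<close>.\<close>

lemma sylow_contains:
  assumes Q: "is_sylow q Q D" and D: "subgroup D G" and P: "subgroup P G" "P \<subseteq> D" "card P = q ^ k"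
  shows "\<exists>d\<in>D. conj_set d P \<subseteq> Q"
proof -
  let ?D = "G\<lparr>carrier := D\<rparr>"
  interpret D: group ?D
    using D subgroup_imp_group by blast
  obtain m where m: "card D = m * card Q" "\<not> q dvd m"
    using sylow_index[OF Q D] .
  have sQ: "subgroup Q G" "Q \<subseteq> D" "prime q"
    using sylowD[OF Q] by auto
  have DG: "x \<in> D \<Longrightarrow> x \<in> carrier G" for x
    using D subgroup_carrier by blast
  have QG: "Q \<subseteq> carrier G"
    using sQ subgroup.subset by blast
  define E where "E = (\<lambda>d. Q #> d) ` D"
  have "E = rcosets\<^bsub>?D\<^esub> Q"
    by (auto simp: E_def RCOSETS_def)
  then have "card E * card Q = card D"
    using D.lagrange[OF subgroup_incl[OF sQ(1) D sQ(2)]] by (simp add: order_def)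
  then have E: "card E = m"
    using m card_pos[OF sQ(1)] by simp
  have finE: "finite E"
    using finite_subgroup[OF D] by (simp add: E_def)
  have "\<exists>e\<in>E. \<forall>x\<in>P. e #> inv x = e"
  proof (rule ccontr)
    assume no: "\<not> (\<exists>e\<in>E. \<forall>x\<in>P. e #> inv x = e)"
    have ec: "e \<subseteq> carrier G" if "e \<in> E" for e
      using that QG DG r_coset_subset_G unfolding E_def by blast
    have "q dvd card E"
    proof (rule no_fixpoint_dvd[OF P(1,3) sQ(3) finE, where f = "\<lambda>x e. e #> inv x"])
      fix x e assume x: "x \<in> P" and "e \<in> E"
      then obtain d where d: "d \<in> D" "e = Q #> d"
        by (auto simp: E_def)
      then have "e #> inv x = Q #> (d \<otimes> inv x)"
        using x P(2) QG DG by (simp add: coset_mult_assoc subset_iff)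
      moreover have "d \<otimes> inv x \<in> D"
        using d x P(2) D by (auto intro: subgroup.m_closed subgroup.m_inv_closed)
      ultimately show "e #> inv x \<in> E"
        by (simp add: E_def)
    next
      fix e assume "e \<in> E"
      then show "e #> inv \<one> = e"
        using ec by simp
    next
      fix x y e assume "x \<in> P" "y \<in> P" "e \<in> E"
      then show "e #> inv (x \<otimes> y) = e #> inv y #> inv x"
        using ec P(2) DG by (simp add: inv_mult_group coset_mult_assoc subset_iff)
    next
      fix e assume "e \<in> E"
      then show "\<exists>x\<in>P. e #> inv x \<noteq> e"
        using no by blast
    qed
    then show False
      using m E by simp
  qed
  then obtain d where d: "d \<in> D" "\<And>x. x \<in> P \<Longrightarrow> Q #> d #> inv x = Q #> d"
    by (auto simp: E_def)
  have "d \<otimes> x \<otimes> inv d \<in> Q" if x: "x \<in> P" for x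
  proof -
    have xi: "inv x \<in> P"
      using P(1) x by (rule subgroup.m_inv_closed)
    have G: "x \<in> carrier G" "d \<in> carrier G"
      using x d P(2) DG by auto
    have "Q #> (d \<otimes> x) = Q #> d"
      using d(2)[OF xi] G QG by (simp add: coset_mult_assoc)
    then have "d \<otimes> x \<in> Q #> d"
      using rcos_self[OF _ sQ(1), of "d \<otimes> x"] G by auto
    then obtain h where h: "h \<in> Q" "d \<otimes> x = h \<otimes> d"
      by (auto simp: r_coset_def)
    then have "d \<otimes> x \<otimes> inv d = h"
      using G QG by (simp add: m_assoc subset_iff)
    then show ?thesis
      using h by simp
  qed
  then show ?thesis
    using d(1) by blast
qed

lemma sylow_conj:
  assumes "is_sylow q Q D" "subgroup D G" "d \<in> D"
  shows "is_sylow q (conj_set d Q) D"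
proof -
  have "d \<in> carrier G"
    using assms subgroup_carrier by blast
  then show ?thesis
    using assms conj_set_subset[of D d Q] subgroup_conj[of Q d] card_conj[of d Q]
    by (auto simp: is_sylow_def subgroup.subset)
qed

lemma sylow_maximal:
  assumes "is_sylow q Q D" "subgroup D G" "subgroup P G" "P \<subseteq> D" "card P = q ^ k" "Q \<subseteq> P"
  shows "P = Q"
proof -
  have "card P dvd card D"
    using assms card_subgroup_dvd by blast
  moreover have "card D \<noteq> 0" "\<not> is_unit q"
    using card_pos[OF assms(2)] sylowD(1)[OF assms(1)] not_prime_unit by blast+
  ultimately have "k \<le> multiplicity q (card D)"
    using assms(5) power_dvd_iff_le_multiplicity[of "card D" q k] by simp
  then have "card P \<le> card Q"
    using assms(5) sylowD(4)[OF assms(1)] prime_ge_1_nat[OF sylowD(1)[OF assms(1)]]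
    by (simp add: power_increasing)
  then show ?thesis
    using assms subgroup_eqI by blast
qed

lemma sylow_conjugate:
  assumes "is_sylow q Q D" "is_sylow q P D" "subgroup D G"
  shows "\<exists>d\<in>D. P = conj_set d Q"
proof -
  obtain d where d: "d \<in> D" "conj_set d Q \<subseteq> P"
    using sylow_contains[OF assms(2,3) sylowD(2,3,4)[OF assms(1)]] by blast
  then have "P = conj_set d Q"
    using sylow_maximal[OF sylow_conj[OF assms(1,3) d(1)] assms(3) sylowD(2-4)[OF assms(2)]] by blast
  then show ?thesis
    using d by blast
qed

lemma sylow_contains_conj:
  assumes Q: "is_sylow q Q D" and D: "subgroup D G" and P: "subgroup P G" "P \<subseteq> D" "card P = q ^ k"
  shows "\<exists>R. is_sylow q R D \<and> P \<subseteq> R"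
proof -
  obtain d where d: "d \<in> D" "conj_set d P \<subseteq> Q"
    using sylow_contains assms by blast
  have G: "d \<in> carrier G" "P \<subseteq> carrier G"
    using d D P subgroup_carrier subgroup.subset by auto
  have di: "inv d \<in> D"
    using D d by (simp add: subgroup.m_inv_closed)
  have "P = conj_set (inv d) (conj_set d P)"
    using G conj_set_cancel[of d P] by simp
  also have "\<dots> \<subseteq> conj_set (inv d) Q"
    using d(2) by (rule image_mono)
  finally show ?thesis
    using sylow_conj[OF Q D di] by blast
qed

lemma psub_all_sylow:
  assumes "is_sylow q Q D" "subgroup D G" "psub Q D" "is_sylow q P D"
  shows "psub P D"
proof -
  obtain d where d: "d \<in> D" "P = conj_set d Q"
    using sylow_conjugate[OF assms(1,4,2)] by blast
  then show ?thesis
    using chain_conj[OF assms(3), of d] conj_set_self assms(2) subgroup_carrier by simp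
qed

lemma prime_power_subgroup:
  assumes "subgroup P G" "subgroup Q G" "P \<subseteq> Q" "card Q = q ^ k" "prime q"
  shows "\<exists>i. card P = q ^ i"
  using card_subgroup_dvd[OF assms(1-3)] assms(4,5) by (metis dvd_prime_powerE)

text \<open>Put Sylow subgroups of \<open>A\<close> and \<open>B\<close> into Sylow subgroups
  \<open>Q1\<close> and \<open>Q2\<close> of \<open>D\<close>, with \<open>Q1\<close> the conjugate
  of \<open>Q2\<close> by g = a b. Splitting g between the factors, a^-1 Q1 a = b Q2 b^-1 contains
  Sylow subgroups of both \<open>A\<close> and \<open>B\<close>.\<close>

lemma sylow_factorisation:
  assumes A: "subgroup A G" and B: "subgroup B G" and D: "subgroup D G" and AB: "D = A <#> B"
    and q: "prime q"
  shows "\<exists>Q. is_sylow q Q D \<and> is_sylow q (Q \<inter> A) A \<and> is_sylow q (Q \<inter> B) B \<and> Q = (Q \<inter> A) <#> (Q \<inter> B)"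
proof -
  have sub: "A \<subseteq> D" "B \<subseteq> D"
    using A B by (simp_all add: AB subset_setmult_left subset_setmult_right)
  have DG: "D \<subseteq> carrier G"
    using D by (rule subgroup.subset)
  obtain Q0 where Q0: "is_sylow q Q0 D"
    using sylow_exists D q by blast
  obtain A0 where A0: "is_sylow q A0 A"
    using sylow_exists A q by blast
  obtain B0 where B0: "is_sylow q B0 B"
    using sylow_exists B q by blast
  obtain Q1 where Q1: "is_sylow q Q1 D" "A0 \<subseteq> Q1"
    using sylow_contains_conj[OF Q0 D sylowD(2)[OF A0] _ sylowD(4)[OF A0]] sylowD(3)[OF A0] sub by blast
  obtain Q2 where Q2: "is_sylow q Q2 D" "B0 \<subseteq> Q2"
    using sylow_contains_conj[OF Q0 D sylowD(2)[OF B0] _ sylowD(4)[OF B0]] sylowD(3)[OF B0] sub by blast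
  obtain g where g: "g \<in> D" "Q1 = conj_set g Q2"
    using sylow_conjugate[OF Q2(1) Q1(1) D] by blast
  obtain a b where ab: "a \<in> A" "b \<in> B" "g = a \<otimes> b"
    using g(1) by (auto simp: AB setmult_iff)
  have G: "a \<in> carrier G" "b \<in> carrier G" "Q2 \<subseteq> carrier G" "inv a \<in> A"
    using ab A B subgroup_carrier subgroup.subset sylowD(2)[OF Q2(1)] subgroup.m_inv_closed by auto
  define Q where "Q = conj_set b Q2"
  have Q: "is_sylow q Q D"
    unfolding Q_def using Q2(1) D ab sub by (blast intro: sylow_conj)
  have "Q = conj_set (inv a) Q1"
    using conj_set_mult[of "inv a" "a \<otimes> b" Q2] G by (simp add: Q_def g(2) ab(3))
  then have A1: "conj_set (inv a) A0 \<subseteq> Q \<inter> A" "is_sylow q (conj_set (inv a) A0) A"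
    using Q1(2) sylow_conj[OF A0 A G(4)] sylowD(3) by (auto dest: sylowD(3))
  have B1: "conj_set b B0 \<subseteq> Q \<inter> B" "is_sylow q (conj_set b B0) B"
    using Q2(2) sylow_conj[OF B0 B ab(2)] sylowD(3) by (auto simp: Q_def dest: sylowD(3))
  have sQ: "subgroup Q G" "subgroup (Q \<inter> A) G" "subgroup (Q \<inter> B) G"
    using sylowD(2)[OF Q] A B subgroup_Int by auto
  obtain i where i: "card (Q \<inter> A) = q ^ i"
    using prime_power_subgroup[OF sQ(2,1) _ sylowD(4)[OF Q] q] by blast
  obtain j where j: "card (Q \<inter> B) = q ^ j"
    using prime_power_subgroup[OF sQ(3,1) _ sylowD(4)[OF Q] q] by blast
  have SA: "is_sylow q (Q \<inter> A) A"
    using sylow_maximal[OF A1(2) A sQ(2) _ i A1(1)] A1(2) by simp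
  have SB: "is_sylow q (Q \<inter> B) B"
    using sylow_maximal[OF B1(2) B sQ(3) _ j B1(1)] B1(2) by simp
  let ?I = "(Q \<inter> A) \<inter> (Q \<inter> B)"
  have sI: "subgroup ?I G" "subgroup (A \<inter> B) G"
    using sQ A B subgroup_Int by auto
  obtain l where l: "card ?I = q ^ l"
    using prime_power_subgroup[OF sI(1) sQ(1) _ sylowD(4)[OF Q] q] by blast
  have nz: "card A \<noteq> 0" "card B \<noteq> 0" "card D \<noteq> 0" "card (A \<inter> B) \<noteq> 0"
    using card_pos A B D sI by (metis less_numeral_extra(3))+
  have "q ^ l dvd card (A \<inter> B)"
    using card_subgroup_dvd[OF sI] l by auto
  then have lle: "l \<le> multiplicity q (card (A \<inter> B))"
    using nz q power_dvd_iff_le_multiplicity not_prime_unit by blast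
  have "multiplicity q (card D * card (A \<inter> B)) = multiplicity q (card A * card B)"
    using card_setmult[OF A B] AB by simp
  then have mult: "multiplicity q (card D) + multiplicity q (card (A \<inter> B))
      = multiplicity q (card A) + multiplicity q (card B)"
    using nz q by (simp add: prime_elem_multiplicity_mult_distrib)
  \<comment> \<open>Compare with |A| |B| = |D| |A \<inter> B|: the two parts meet in order
    \<open>q ^ l\<close>, at most the q-part of |A \<inter> B|, so their product is at least as
    large as \<open>Q\<close>.\<close>
  have "card ((Q \<inter> A) <#> (Q \<inter> B)) * q ^ l = q ^ (multiplicity q (card A) + multiplicity q (card B))"
    using card_setmult[OF sQ(2,3)] l sylowD(4)[OF SA] sylowD(4)[OF SB] by (simp add: power_add)
  also have "\<dots> = card Q * q ^ multiplicity q (card (A \<inter> B))"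
    using sylowD(4)[OF Q] by (simp add: power_add flip: mult)
  also have "\<dots> \<ge> card Q * q ^ l"
    by (intro mult_le_mono2 power_increasing prime_ge_1_nat q lle)
  finally have "card Q \<le> card ((Q \<inter> A) <#> (Q \<inter> B))"
    using q by (simp add: prime_gt_0_nat)
  moreover have "(Q \<inter> A) <#> (Q \<inter> B) \<subseteq> Q"
    using sQ by (intro setmult_subset) auto
  ultimately have "(Q \<inter> A) <#> (Q \<inter> B) = Q"
    using subgroup_eqI[OF sQ(1)] by blast
  then show ?thesis
    using Q SA SB by metis
qed

text \<open>The index of \<open>R\<close> in \<open>P <#> R\<close> is a power of q and divides
  \<open>m\<close>, so it is 1.\<close>

lemma prime_power_subset_normal:
  assumes P: "subgroup P G" "card P = q ^ k" "prime q" and R: "subgroup R G" and D: "subgroup D G"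
    and "P \<subseteq> D" "R \<subseteq> D" "normalises D R" and m: "card D = m * card R" "\<not> q dvd m"
  shows "P \<subseteq> R"
proof -
  have sPR: "subgroup (P <#> R) G"
    using assms by (meson normalises_subset subgroup_setmult)
  have sub: "P \<subseteq> P <#> R" "R \<subseteq> P <#> R" "P <#> R \<subseteq> D"
    using P R D assms(6,7) by (simp_all add: subset_setmult_left subset_setmult_right setmult_subset)
  obtain t where t: "card (P <#> R) = card R * t"
    using card_subgroup_dvd[OF R sPR sub(2)] by blast
  obtain s where s: "card D = card (P <#> R) * s"
    using card_subgroup_dvd[OF sPR D sub(3)] by blast
  have "card R * (t * card (P \<inter> R)) = card R * q ^ k"
    using card_setmult[OF P(1) R] t P(2) by (auto simp: ac_simps)
  then have "t * card (P \<inter> R) = q ^ k"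
    using card_pos[OF R] by simp
  then have "t dvd q ^ k"
    by (metis dvd_triv_left)
  then obtain i where i: "t = q ^ i"
    using dvd_prime_powerE P(3) by blast
  have "card R * (t * s) = card R * m"
    using s t m by auto
  then have "t * s = m"
    using card_pos[OF R] by simp
  then have "i = 0"
    using i m(2) by (cases i) auto
  then have "R = P <#> R"
    using t i by (intro subgroup_eqI[OF sPR sub(2)]) simp
  then show ?thesis
    using sub by simp
qed

section \<open>The Sylow tower forced by P-subnormal Sylow factors\<close>

definition wsup :: "'a set \<Rightarrow> bool" where
  "wsup D \<longleftrightarrow> (\<forall>q Q. is_sylow q Q D \<longrightarrow> psub Q D)"

text \<open>The terms of the Sylow tower of supersoluble type, when \<open>G\<close> has one.\<close>

abbreviation Oge :: "nat \<Rightarrow> 'a set" where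
  "Oge n \<equiv> Opi {n..} (carrier G)"

definition dispersive :: bool where
  "dispersive \<longleftrightarrow> (\<forall>n. \<exists>m. card (carrier G) = m * card (Oge n) \<and> pi_number {..<n} m)"

lemma Oge_mono: "m \<le> n \<Longrightarrow> Oge n \<subseteq> Oge m"
  by (intro Opi_mono subgroup_self) auto

lemma subgroup_Oge [simp]: "subgroup (Oge n) G"
  by (simp add: subgroup_self)

lemma normalises_Oge: "normalises (carrier G) (Oge n)"
  by (intro normalises_Opi subgroup_self)

text \<open>\<open>X <#> Oge (Suc p)\<close> has only primes \<ge> p in its order and only primes
  \<le> p in its index. It is thus its own \<open>Opi {p..}\<close>, and \<open>Opi_chain\<close>
  carries that into \<open>Oge p\<close>.\<close>

lemma psub_subset_Oge:
  assumes X: "psub X (carrier G)" "card X = p ^ k" "prime p"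
    and m: "card (carrier G) = m * card (Oge (Suc p))" "pi_number {..<Suc p} m"
  shows "X \<subseteq> Oge p"
proof -
  let ?Oge = "Oge (Suc p)"
  have sX: "subgroup X G"
    using X chainD by blast
  have "chain {} UNIV (X <#> ?Oge) (carrier G <#> ?Oge)"
    using X by (intro chain_setmult_normal) (auto simp: normalises_Oge)
  moreover have "carrier G <#> ?Oge = carrier G"
    using setmult_subset[OF subgroup_self subset_refl, of ?Oge] subset_setmult_left[OF subgroup_self subgroup_Oge]
      subgroup.subset[OF subgroup_Oge] by blast
  ultimately have c: "chain {} UNIV (X <#> ?Oge) (carrier G)"
    by simp
  have sXT: "subgroup (X <#> ?Oge) G"
    using c chainD by blast
  obtain l where l: "card (carrier G) = l * card (X <#> ?Oge)"
    using chain_card[OF c] by blast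
  obtain t where t: "card (X <#> ?Oge) = card ?Oge * t"
    using card_subgroup_dvd[OF subgroup_Oge sXT subset_setmult_right] sX by auto
  have "m = l * t"
    using l t m card_pos[OF subgroup_Oge, of "Suc p"] by simp
  then have "pi_number {..p} l"
    using m(2) pi_number_dvd by (auto simp: lessThan_Suc_atMost)
  then have "chain {} (UNIV \<inter> {..p}) (X <#> ?Oge) (carrier G)"
    using chain_restrict c l by blast
  then have "Opi {p..} (X <#> ?Oge) \<subseteq> Oge p"
    using Opi_chain by simp
  moreover have "card (X <#> ?Oge) dvd card X * card ?Oge"
    using card_setmult[OF sX subgroup_Oge] by (metis dvd_triv_left)
  then have "pi_number {p..} (card (X <#> ?Oge))"
    unfolding X(2)
    by (rule pi_number_dvd[OF pi_number_mult[OF pi_number_prime_power[OF X(3)]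
            pi_number_mono[OF pi_number_Opi[OF subgroup_self]]], rotated 2]) auto
  then have "X <#> ?Oge \<subseteq> Opi {p..} (X <#> ?Oge)"
    using sXT by (intro Opi_max) (auto intro: normalises_self)
  moreover have "X \<subseteq> X <#> ?Oge"
    using sX by (simp add: subset_setmult_left)
  ultimately show ?thesis
    by blast
qed

text \<open>Downward induction from beyond the group order. The step only has to remove the prime n
  from the index of \<open>Oge n\<close>, and both factors of a Sylow n-subgroup lie in
  \<open>Oge n\<close>. A factorised Sylow subgroup is allowed because in a product AB only the
  factors are known to be P-subnormal.\<close>

lemma dispersive_if_sylow_factors:
  assumes "\<And>q. prime q \<Longrightarrow> \<exists>Q X Y. is_sylow q Q (carrier G) \<and> Q = X <#> Y \<and> X \<subseteq> Q \<and> Y \<subseteq> Q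
      \<and> psub X (carrier G) \<and> psub Y (carrier G)"
  shows dispersive
proof -
  let ?P = "\<lambda>n. \<exists>m. card (carrier G) = m * card (Oge n) \<and> pi_number {..<n} m"
  have step: "?P n" if IH: "?P (Suc n)" for n
  proof -
    obtain m where m: "card (carrier G) = m * card (Oge (Suc n))" "pi_number {..<Suc n} m"
      using IH by blast
    obtain l where l: "card (Oge n) = card (Oge (Suc n)) * l"
      using card_subgroup_dvd[OF subgroup_Oge subgroup_Oge Oge_mono, of n "Suc n"] by auto
    obtain t where t: "card (carrier G) = card (Oge n) * t"
      using card_subgroup_dvd[OF subgroup_Oge subgroup_self subgroup.subset[OF subgroup_Oge], of n]
      unfolding dvd_def by blast
    have "m = l * t"
      using l t m card_pos[OF subgroup_Oge, of "Suc n"] by simp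
    then have t1: "pi_number {..<Suc n} t"
      using m(2) pi_number_dvd by auto
    have "\<not> n dvd t" if n: "prime n"
    proof -
      obtain Q X Y where Q: "is_sylow n Q (carrier G)" "Q = X <#> Y" "X \<subseteq> Q" "Y \<subseteq> Q"
          "psub X (carrier G)" "psub Y (carrier G)"
        using assms[OF n] by blast
      obtain i j where "card X = n ^ i" "card Y = n ^ j"
        using Q prime_power_subgroup[OF _ sylowD(2)[OF Q(1)] _ sylowD(4)[OF Q(1)] n] chainD(1) by meson
      then have "X \<subseteq> Oge n" "Y \<subseteq> Oge n"
        using psub_subset_Oge Q n m by blast+
      then have "Q \<subseteq> Oge n"
        unfolding Q(2) by (intro setmult_subset) auto
      then obtain s where s: "card (Oge n) = card Q * s"
        using card_subgroup_dvd[OF sylowD(2)[OF Q(1)] subgroup_Oge] by blast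
      obtain u where u: "card (carrier G) = u * card Q" "\<not> n dvd u"
        using sylow_index[OF Q(1) subgroup_self] .
      have "u = s * t"
        using s u t card_pos[OF sylowD(2)[OF Q(1)]] by simp
      then show ?thesis
        using u(2) by auto
    qed
    then have "pi_number {..<n} t"
      using t1 by (auto simp: pi_number_def less_Suc_eq)
    then show ?thesis
      using t by (auto simp: mult.commute)
  qed
  have big: "?P n" if n: "n > card (carrier G)" for n
  proof -
    obtain t where t: "card (carrier G) = card (Oge n) * t"
      using card_subgroup_dvd[OF subgroup_Oge subgroup_self subgroup.subset[OF subgroup_Oge], of n]
      unfolding dvd_def by blast
    have "pi_number {..<n} t"
      unfolding pi_number_def
    proof (intro allI impI)
      fix p assume "p dvd t"
      then have "p dvd card (carrier G)"
        using t by simp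
      then show "p \<in> {..<n}"
        using n card_pos[OF subgroup_self] by (auto dest: dvd_imp_le)
    qed
    then show ?thesis
      using t by (auto simp: mult.commute)
  qed
  have "?P n" for n
  proof (induction "Suc (card (carrier G)) - n" arbitrary: n)
    case 0
    then show ?case
      using big by simp
  next
    case (Suc k)
    then have "?P (Suc n)"
      by auto
    then show ?case
      by (rule step)
  qed
  then show ?thesis
    by (simp add: dispersive_def)
qed

end

section \<open>Factor groups and power actions\<close>

context group
begin

lemma coprime_pow_eq_one:
  assumes "z \<in> carrier G" "z [^] (m::nat) = \<one>" "z [^] (n::nat) = \<one>" "coprime m n"
  shows "z = \<one>"
proof -
  have "ord z dvd m" "ord z dvd n"
    using assms pow_eq_id by blast+
  then have "ord z = 1"
    using assms(4) coprime_common_divisor_nat by blast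
  then show ?thesis
    using ord_eq_1[OF assms(1)] by blast
qed

text \<open>Each conjugation by \<open>c\<close> contributes one factor \<open>z\<close>, since
  \<open>c\<close> fixes \<open>z\<close>. When the power of \<open>c\<close> is trivial this gives
  z^n = 1, which is how coprime orders act on commutators later.\<close>

lemma conj_pow_commuting:
  assumes "c \<in> carrier G" "u \<in> carrier G" "z \<in> carrier G"
    and "c \<otimes> u \<otimes> inv c = u \<otimes> z" "c \<otimes> z = z \<otimes> c"
  shows "c [^] (n::nat) \<otimes> u \<otimes> inv (c [^] n) = u \<otimes> z [^] n"
proof (induction n)
  case (Suc n)
  have cn: "c \<otimes> z [^] n = z [^] n \<otimes> c"
    using assms(1,3,5) by (metis pow_mult_distrib[symmetric] group_commutes_pow)
  have "c [^] Suc n \<otimes> u \<otimes> inv (c [^] Suc n) = c \<otimes> (c [^] n \<otimes> u \<otimes> inv (c [^] n)) \<otimes> inv c"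
    using assms(1,2) nat_pow_Suc2[OF assms(1), of n] by (simp add: word_simps del: nat_pow_Suc)
  also have "\<dots> = c \<otimes> u \<otimes> (z [^] n) \<otimes> inv c"
    using assms by (simp add: Suc m_assoc)
  also have "\<dots> = (c \<otimes> u \<otimes> inv c) \<otimes> (c \<otimes> z [^] n \<otimes> inv c)"
    using assms(1-3) by (simp add: word_simps)
  also have "\<dots> = u \<otimes> z \<otimes> z [^] n"
    using assms by (simp add: cn m_assoc)
  also have "\<dots> = u \<otimes> z [^] Suc n"
    using assms(1-3) nat_pow_Suc2[OF assms(3), of n] by (simp add: m_assoc del: nat_pow_Suc)
  finally show ?case .
qed (use assms in simp)

lemma conj_pow:
  "x \<in> carrier G \<Longrightarrow> w \<in> carrier G \<Longrightarrow> x \<otimes> w [^] (n::nat) \<otimes> inv x = (x \<otimes> w \<otimes> inv x) [^] n"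
proof (induction n)
  case (Suc n)
  have "x \<otimes> w [^] Suc n \<otimes> inv x = (x \<otimes> w [^] n \<otimes> inv x) \<otimes> (x \<otimes> w \<otimes> inv x)"
    using Suc.prems by (simp add: word_simps)
  also have "\<dots> = (x \<otimes> w \<otimes> inv x) [^] Suc n"
    using Suc by simp
  finally show ?case .
qed simp

lemma pow_in_subgroup: "subgroup H G \<Longrightarrow> x \<in> H \<Longrightarrow> x [^] (n::nat) \<in> H"
  by (induction n) (auto intro: subgroup.one_closed subgroup.m_closed)

end

text \<open>Presents the factor group S/L by any group \<open>Q\<close> and a map that is meaningful
  on \<open>S\<close> only. \<open>L\<close> is normal in \<open>S\<close>, not necessarily in
  \<open>G\<close>, and cosets stay out of the computations.\<close>

locale factor_map = fin_group G + Q: fin_group Q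
  for G :: "('a, 'b) monoid_scheme" (structure) and Q :: "'c monoid" +
  fixes S L :: "'a set" and \<phi> :: "'a \<Rightarrow> 'c"
  assumes S: "subgroup S G" and L: "subgroup L G" and LS: "L \<subseteq> S" and SL: "normalises S L"
    and onto: "\<phi> ` S = carrier Q"
    and hom: "x \<in> S \<Longrightarrow> y \<in> S \<Longrightarrow> \<phi> (x \<otimes> y) = \<phi> x \<otimes>\<^bsub>Q\<^esub> \<phi> y"
    and ker: "x \<in> S \<Longrightarrow> \<phi> x = \<one>\<^bsub>Q\<^esub> \<longleftrightarrow> x \<in> L"
    and card_quotient: "card (carrier Q) * card L = card S"
begin

lemma closed [simp]: "x \<in> S \<Longrightarrow> \<phi> x \<in> carrier Q"
  using onto by blast

lemma S_closed [simp]: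
  "x \<in> S \<Longrightarrow> x \<in> carrier G" "x \<in> S \<Longrightarrow> y \<in> S \<Longrightarrow> x \<otimes> y \<in> S" "x \<in> S \<Longrightarrow> inv x \<in> S" "\<one> \<in> S"
  "x \<in> S \<Longrightarrow> x [^] (n::nat) \<in> S" "x \<in> L \<Longrightarrow> x \<in> S"
  using S LS by (auto intro: subgroup_carrier subgroup.m_closed subgroup.m_inv_closed
      subgroup.one_closed pow_in_subgroup)

lemma map_one [simp]: "\<phi> \<one> = \<one>\<^bsub>Q\<^esub>"
  using ker[of \<one>] L by (simp add: subgroup.one_closed)

lemma map_L: "x \<in> L \<Longrightarrow> \<phi> x = \<one>\<^bsub>Q\<^esub>"
  by (simp add: ker)

lemma map_inv: "x \<in> S \<Longrightarrow> \<phi> (inv x) = inv\<^bsub>Q\<^esub> \<phi> x"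
  using hom[of "inv x" x] by (simp add: Q.inv_equality)

lemma map_pow: "x \<in> S \<Longrightarrow> \<phi> (x [^] (n::nat)) = \<phi> x [^]\<^bsub>Q\<^esub> n"
  by (induction n) (simp_all add: hom)

lemma map_eq_iff: "x \<in> S \<Longrightarrow> y \<in> S \<Longrightarrow> \<phi> x = \<phi> y \<longleftrightarrow> inv x \<otimes> y \<in> L"
  using ker[of "inv x \<otimes> y"]
  by (simp add: hom map_inv) (metis Q.inv_closed Q.inv_equality Q.inv_inv Q.l_inv closed)

lemma comm_iff: "x \<in> S \<Longrightarrow> y \<in> S \<Longrightarrow> comm x y \<in> L \<longleftrightarrow> \<phi> x \<otimes>\<^bsub>Q\<^esub> \<phi> y = \<phi> y \<otimes>\<^bsub>Q\<^esub> \<phi> x"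
proof -
  assume xy: "x \<in> S" "y \<in> S"
  have "comm x y = inv (inv (x \<otimes> y)) \<otimes> inv (y \<otimes> x)"
    using xy by (simp add: comm_def word_simps)
  then have "comm x y \<in> L \<longleftrightarrow> \<phi> (inv (x \<otimes> y)) = \<phi> (inv (y \<otimes> x))"
    using xy by (simp add: map_eq_iff)
  also have "\<dots> \<longleftrightarrow> \<phi> (x \<otimes> y) = \<phi> (y \<otimes> x)"
    using xy by (metis Q.inv_inv S_closed(2) closed map_inv)
  finally show ?thesis
    using xy by (simp add: hom)
qed

lemma pow_card_in_L: "card S = n * card L \<Longrightarrow> x \<in> S \<Longrightarrow> x [^] n \<in> L"
proof -
  assume n: "card S = n * card L" and x: "x \<in> S"
  have "order Q = n"
    using card_quotient n card_pos[OF L] by (simp add: order_def)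
  then have "\<phi> (x [^] n) = \<one>\<^bsub>Q\<^esub>"
    using x Q.pow_order_eq_1[of "\<phi> x"] by (simp add: map_pow)
  then show ?thesis
    using x ker by simp
qed

end

context fin_group
begin

lemma factor_map_Mod:
  assumes S: "subgroup S G" and L: "subgroup L G" and LS: "L \<subseteq> S" and SL: "normalises S L"
  shows "factor_map G (G\<lparr>carrier := S\<rparr> Mod L) S L (\<lambda>x. L #> x)"
proof -
  let ?S = "G\<lparr>carrier := S\<rparr>"
  interpret S: group ?S
    using S subgroup_imp_group by blast
  have SG: "x \<in> S \<Longrightarrow> x \<in> carrier G" for x
    using S subgroup_carrier by blast
  have sL: "subgroup L ?S"
    using subgroup_incl L S LS by blast
  have "L \<lhd> ?S"
    unfolding S.normal_inv_iff using sL SL S by (auto simp: normalises_def)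
  then interpret N: normal L ?S .
  have fS: "finite S"
    using finite_subgroup S by blast
  interpret Q: group "?S Mod L"
    by (rule N.factorgroup_is_group)
  have car: "carrier (?S Mod L) = (\<lambda>x. L #> x) ` S"
    by (simp add: carrier_FactGroup)
  show ?thesis
  proof unfold_locales
    show "finite (carrier (?S Mod L))"
      using fS by (simp add: car)
    show "(\<lambda>x. L #> x) ` S = carrier (?S Mod L)"
      by (simp add: car)
    fix x y assume xy: "x \<in> S" "y \<in> S"
    show "L #> (x \<otimes> y) = (L #> x) \<otimes>\<^bsub>?S Mod L\<^esub> (L #> y)"
      using N.rcos_sum[of x y] xy by simp
  next
    fix x assume x: "x \<in> S"
    show "(L #> x = \<one>\<^bsub>?S Mod L\<^esub>) = (x \<in> L)"
      using x SG L by (metis coset_join1 coset_join2 one_FactGroup subgroup.subset)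
  next
    show "card (carrier (?S Mod L)) * card L = card S"
      using S.lagrange[OF sL] by (simp add: FactGroup_def order_def)
  qed (use S L LS SL in \<open>simp_all add: subgroup.subset subgroup.m_closed subgroup.one_closed
      subgroup.m_inv_closed\<close>)
qed

lemma factor_mapE:
  assumes "subgroup S G" "subgroup L G" "L \<subseteq> S" "normalises S L"
  obtains Q :: "'a set monoid" and \<phi> where "factor_map G Q S L \<phi>"
  using factor_map_Mod[OF assms] by blast

lemma pow_card_subgroup:
  assumes "subgroup H G" "x \<in> H"
  shows "x [^] card H = \<one>"
proof -
  have "{\<one>} \<subseteq> H" "normalises H {\<one>}"
    using assms(1) by (simp_all add: subgroup.one_closed subgroup.subset normalises_one)
  then obtain V :: "'a set monoid" and f where "factor_map G V H {\<one>} f"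
    using factor_mapE[OF assms(1) triv_subgroup] by blast
  then interpret F: factor_map G V H "{\<one>}" f .
  show ?thesis
    using F.pow_card_in_L[of "card H" x] assms(2) by simp
qed

text \<open>Otherwise conjugation has no fixed point among the nontrivial elements, and p divides
  both |G| and |G| - 1.\<close>

lemma p_group_centre:
  assumes "card (carrier G) = p ^ k" "prime p" "k > 0"
  shows "\<exists>z\<in>carrier G. z \<noteq> \<one> \<and> (\<forall>x\<in>carrier G. x \<otimes> z = z \<otimes> x)"
proof (rule ccontr)
  assume no: "\<not> ?thesis"
  let ?E = "carrier G - {\<one>}"
  have "p dvd card ?E"
  proof (rule no_fixpoint_dvd[OF subgroup_self assms(1,2), where f = "\<lambda>x e. x \<otimes> e \<otimes> inv x"])
    fix x e assume x: "x \<in> carrier G" and e: "e \<in> ?E"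
    have "x \<otimes> e \<otimes> inv x = \<one> \<Longrightarrow> e = \<one>"
    proof -
      assume a: "x \<otimes> e \<otimes> inv x = \<one>"
      have "e = inv x \<otimes> (x \<otimes> e \<otimes> inv x) \<otimes> x"
        using x e by (simp add: word_simps)
      then show "e = \<one>"
        unfolding a using x by simp
    qed
    then show "x \<otimes> e \<otimes> inv x \<in> ?E"
      using x e by auto
  next
    fix e assume e: "e \<in> ?E"
    then obtain x where x: "x \<in> carrier G" "x \<otimes> e \<noteq> e \<otimes> x"
      using no by blast
    have "x \<otimes> e \<otimes> inv x \<noteq> e"
    proof
      assume a: "x \<otimes> e \<otimes> inv x = e"
      have "x \<otimes> e = (x \<otimes> e \<otimes> inv x) \<otimes> x"
        using x e by (simp add: word_simps)
      then show False
        unfolding a using x by simp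
    qed
    then show "\<exists>x\<in>carrier G. x \<otimes> e \<otimes> inv x \<noteq> e"
      using x by blast
  qed (simp_all add: word_simps)
  moreover have "card (carrier G) = Suc (card ?E)"
    by (rule card.remove) simp_all
  moreover have "p dvd card (carrier G)"
    using assms by simp
  ultimately have "p dvd 1"
    by (metis Suc_eq_plus1 dvd_add_right_iff)
  then show False
    using assms(2) by simp
qed

text \<open>One exponent serves all w: \<open>x\<close> acts on S/M like a scalar on a vector space,
  with natural numbers in place of field elements.\<close>

definition power_action :: "'a \<Rightarrow> nat \<Rightarrow> 'a set \<Rightarrow> 'a set \<Rightarrow> bool" where
  "power_action x c S M \<longleftrightarrow> (\<forall>w\<in>S. \<exists>m\<in>M. x \<otimes> w \<otimes> inv x = w [^] c \<otimes> m)"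

end

context factor_map
begin

lemma power_action_iff:
  assumes "x \<in> carrier G" "\<And>w. w \<in> S \<Longrightarrow> x \<otimes> w \<otimes> inv x \<in> S"
  shows "power_action x c S L \<longleftrightarrow> (\<forall>w\<in>S. \<phi> (x \<otimes> w \<otimes> inv x) = \<phi> w [^]\<^bsub>Q\<^esub> c)"
proof -
  have "(\<exists>m\<in>L. x \<otimes> w \<otimes> inv x = w [^] c \<otimes> m) \<longleftrightarrow> \<phi> (x \<otimes> w \<otimes> inv x) = \<phi> w [^]\<^bsub>Q\<^esub> c"
    if w: "w \<in> S" for w
  proof
    assume "\<exists>m\<in>L. x \<otimes> w \<otimes> inv x = w [^] c \<otimes> m"
    then show "\<phi> (x \<otimes> w \<otimes> inv x) = \<phi> w [^]\<^bsub>Q\<^esub> c"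
      using w by (auto simp: hom map_pow map_L)
  next
    assume "\<phi> (x \<otimes> w \<otimes> inv x) = \<phi> w [^]\<^bsub>Q\<^esub> c"
    then have "inv (w [^] c) \<otimes> (x \<otimes> w \<otimes> inv x) \<in> L"
      using w assms(2)[OF w] map_eq_iff[of "w [^] c" "x \<otimes> w \<otimes> inv x"] by (simp add: map_pow)
    moreover have "x \<otimes> w \<otimes> inv x = w [^] c \<otimes> (inv (w [^] c) \<otimes> (x \<otimes> w \<otimes> inv x))"
      using w assms(1) by simp
    ultimately show "\<exists>m\<in>L. x \<otimes> w \<otimes> inv x = w [^] c \<otimes> m"
      by blast
  qed
  then show ?thesis
    by (simp add: power_action_def)
qed

lemma power_action_mult:
  assumes x: "x \<in> carrier G" "\<And>w. w \<in> S \<Longrightarrow> x \<otimes> w \<otimes> inv x \<in> S"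
    and y: "y \<in> carrier G" "\<And>w. w \<in> S \<Longrightarrow> y \<otimes> w \<otimes> inv y \<in> S"
    and "power_action x c S L" "power_action y d S L"
  shows "power_action (x \<otimes> y) (d * c) S L"
proof -
  have conj: "(x \<otimes> y) \<otimes> w \<otimes> inv (x \<otimes> y) = x \<otimes> (y \<otimes> w \<otimes> inv y) \<otimes> inv x" if "w \<in> S" for w
    using x y that by (simp add: word_simps)
  have "\<phi> (x \<otimes> (y \<otimes> w \<otimes> inv y) \<otimes> inv x) = \<phi> w [^]\<^bsub>Q\<^esub> (d * c)" if w: "w \<in> S" for w
  proof -
    have "\<phi> (x \<otimes> (y \<otimes> w \<otimes> inv y) \<otimes> inv x) = \<phi> (y \<otimes> w \<otimes> inv y) [^]\<^bsub>Q\<^esub> c"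
      using assms(5) y(2)[OF w] power_action_iff[OF x] by blast
    also have "\<phi> (y \<otimes> w \<otimes> inv y) = \<phi> w [^]\<^bsub>Q\<^esub> d"
      using assms(6) w power_action_iff[OF y] by blast
    finally show ?thesis
      using w by (simp add: Q.nat_pow_pow)
  qed
  then show ?thesis
    using x y conj by (subst power_action_iff) auto
qed

text \<open>The products x y and y x act with the same exponent c d. Both are applied to
  \<open>w'\<close>, the element that y x sends to w.\<close>

lemma power_action_comm:
  assumes x: "x \<in> carrier G" "\<And>w. w \<in> S \<Longrightarrow> x \<otimes> w \<otimes> inv x \<in> S" "\<And>w. w \<in> S \<Longrightarrow> inv x \<otimes> w \<otimes> x \<in> S"
    and y: "y \<in> carrier G" "\<And>w. w \<in> S \<Longrightarrow> y \<otimes> w \<otimes> inv y \<in> S" "\<And>w. w \<in> S \<Longrightarrow> inv y \<otimes> w \<otimes> y \<in> S"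
    and "power_action x c S L" "power_action y d S L" and w: "w \<in> S"
  shows "inv w \<otimes> (comm x y \<otimes> w \<otimes> inv (comm x y)) \<in> L"
proof -
  define w' where "w' = inv x \<otimes> (inv y \<otimes> w \<otimes> y) \<otimes> x"
  have w': "w' \<in> S"
    using x(3) y(3) w by (simp add: w'_def)
  have e1: "(y \<otimes> x) \<otimes> w' \<otimes> inv (y \<otimes> x) = w"
    using x y w by (simp add: w'_def word_simps)
  have e2: "(x \<otimes> y) \<otimes> w' \<otimes> inv (x \<otimes> y) = comm x y \<otimes> w \<otimes> inv (comm x y)"
    using x y w by (simp add: w'_def comm_def word_simps)
  have s: "(x \<otimes> y) \<otimes> v \<otimes> inv (x \<otimes> y) \<in> S" "(y \<otimes> x) \<otimes> v \<otimes> inv (y \<otimes> x) \<in> S" if v: "v \<in> S" for v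
  proof -
    have "(x \<otimes> y) \<otimes> v \<otimes> inv (x \<otimes> y) = x \<otimes> (y \<otimes> v \<otimes> inv y) \<otimes> inv x"
         "(y \<otimes> x) \<otimes> v \<otimes> inv (y \<otimes> x) = y \<otimes> (x \<otimes> v \<otimes> inv x) \<otimes> inv y"
      using x y v by (simp_all add: word_simps)
    then show "(x \<otimes> y) \<otimes> v \<otimes> inv (x \<otimes> y) \<in> S" "(y \<otimes> x) \<otimes> v \<otimes> inv (y \<otimes> x) \<in> S"
      using x(2) y(2) v by simp_all
  qed
  have p: "power_action (x \<otimes> y) (d * c) S L" "power_action (y \<otimes> x) (c * d) S L"
    using power_action_mult assms by blast+
  have "\<phi> ((x \<otimes> y) \<otimes> w' \<otimes> inv (x \<otimes> y)) = \<phi> w' [^]\<^bsub>Q\<^esub> (d * c)"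
    using power_action_iff[OF m_closed[OF x(1) y(1)] s(1)] p(1) w' by blast
  also have "\<dots> = \<phi> ((y \<otimes> x) \<otimes> w' \<otimes> inv (y \<otimes> x))"
    using power_action_iff[OF m_closed[OF y(1) x(1)] s(2)] p(2) w' by (simp add: mult.commute)
  finally have "\<phi> (comm x y \<otimes> w \<otimes> inv (comm x y)) = \<phi> w"
    by (simp add: e1 e2)
  moreover have "comm x y \<otimes> w \<otimes> inv (comm x y) \<in> S"
    using s(1)[OF w'] e2 by simp
  ultimately show ?thesis
    using w map_eq_iff by metis
qed

text \<open>The elements of \<open>S\<close> that are powers of v modulo \<open>L\<close> form a
  subgroup properly above \<open>L\<close>, and a prime index leaves only \<open>S\<close>.\<close>

lemma prime_index_cyclic:
  assumes "card S = p * card L" "prime p" "v \<in> S" "v \<notin> L" "w \<in> S"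
  shows "\<exists>i::nat. \<phi> w = \<phi> v [^]\<^bsub>Q\<^esub> i"
proof -
  define W where "W = {w \<in> S. \<exists>i::nat. \<phi> w = \<phi> v [^]\<^bsub>Q\<^esub> i}"
  have "subgroup W G"
  proof (rule finite_group_subgroupI)
    show "W \<subseteq> carrier G"
      by (auto simp: W_def)
    show "\<one> \<in> W"
      by (auto simp: W_def intro!: exI[of _ 0])
    fix x y assume "x \<in> W" "y \<in> W"
    then obtain i j :: nat where "x \<in> S" "y \<in> S" "\<phi> x = \<phi> v [^]\<^bsub>Q\<^esub> i" "\<phi> y = \<phi> v [^]\<^bsub>Q\<^esub> j"
      by (auto simp: W_def)
    then have "x \<otimes> y \<in> S" "\<phi> (x \<otimes> y) = \<phi> v [^]\<^bsub>Q\<^esub> (i + j)"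
      using assms(3) by (simp_all add: hom Q.nat_pow_mult)
    then show "x \<otimes> y \<in> W"
      by (auto simp: W_def)
  qed
  moreover have "L \<subseteq> W"
    by (auto simp: W_def map_L intro!: exI[of _ 0])
  moreover have "v \<in> W"
    using assms(3) by (auto simp: W_def intro!: exI[of _ 1])
  ultimately have "W = S"
    using subgroup_between_prime_index[OF L _ S, of W p] assms by (auto simp: W_def)
  then show ?thesis
    using assms(5) by (auto simp: W_def)
qed

text \<open>Every endomorphism of a cyclic group is a power map; the exponent is read off at a
  generator v.\<close>

lemma prime_index_power_action:
  assumes "card S = p * card L" "prime p"
    and x: "x \<in> carrier G" "\<And>w. w \<in> S \<Longrightarrow> x \<otimes> w \<otimes> inv x \<in> S" "\<And>w. w \<in> L \<Longrightarrow> x \<otimes> w \<otimes> inv x \<in> L"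
  shows "\<exists>c. power_action x c S L"
proof -
  have "\<not> S \<subseteq> L"
  proof
    assume "S \<subseteq> L"
    then have "card S = card L"
      using LS by (simp add: subset_antisym)
    then show False
      using assms(1,2) card_pos[OF L] by simp
  qed
  then obtain v where v: "v \<in> S" "v \<notin> L"
    by blast
  obtain c :: nat where c: "\<phi> (x \<otimes> v \<otimes> inv x) = \<phi> v [^]\<^bsub>Q\<^esub> c"
    using prime_index_cyclic[OF assms(1,2) v x(2)[OF v(1)]] by blast
  have "\<phi> (x \<otimes> w \<otimes> inv x) = \<phi> w [^]\<^bsub>Q\<^esub> c" if w: "w \<in> S" for w
  proof -
    obtain i :: nat where i: "\<phi> w = \<phi> v [^]\<^bsub>Q\<^esub> i"
      using prime_index_cyclic[OF assms(1,2) v w] by blast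
    define l where "l = inv (v [^] i) \<otimes> w"
    have l: "l \<in> L"
      using map_eq_iff[of "v [^] i" w] v w i by (simp add: l_def map_pow)
    have "w = v [^] i \<otimes> l"
      using v w by (simp add: l_def)
    then have "x \<otimes> w \<otimes> inv x = (x \<otimes> v [^] i \<otimes> inv x) \<otimes> (x \<otimes> l \<otimes> inv x)"
      using x(1) v l by (simp add: word_simps)
    also have "\<dots> = (x \<otimes> v \<otimes> inv x) [^] i \<otimes> (x \<otimes> l \<otimes> inv x)"
      using x(1) v by (simp add: conj_pow)
    finally have "\<phi> (x \<otimes> w \<otimes> inv x) = \<phi> (x \<otimes> v \<otimes> inv x) [^]\<^bsub>Q\<^esub> i"
      using x v l by (simp add: hom map_pow map_L)
    also have "\<dots> = \<phi> w [^]\<^bsub>Q\<^esub> c"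
      using v by (simp add: c i Q.nat_pow_pow mult.commute)
    finally show ?thesis .
  qed
  then show ?thesis
    using power_action_iff x by blast
qed

end

section \<open>Invariant chains in \<open>p\<close>-sections\<close>

context fin_group
begin

lemma chain_prime: "chain X {p} L U \<Longrightarrow> L = U \<or> prime p"
  by (induction rule: chain.induct) auto

lemma chain_p_card:
  assumes "chain X {p} L U"
  shows "\<exists>k. card U = p ^ k * card L"
proof (cases "L = U")
  case True
  then show ?thesis
    by (intro exI[of _ 0]) simp
next
  case False
  then have p: "prime p"
    using chain_prime assms by blast
  obtain m where m: "card U = m * card L" "pi_number {p} m"
    using chain_card assms by blast
  have "card U > 0"
    using card_pos chainD(2)[OF assms] by blast
  then show ?thesis
    using m p pi_number_singleton[of p m] by auto
qed

text \<open>An index \<open>p\<close> step is a cyclic section on which a group acts through commuting power maps, so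
  commutators act trivially on it; coprimality lifts this from the steps to the whole chain.\<close>

lemma chain_commutator_centralises:
  assumes "chain X {p} L U" and X: "subgroup X G" and nL: "normalises (carrier G) L"
    and ab: "a \<in> X" "b \<in> X" and c: "c = comm a b" "c [^] (m::nat) = \<one>" "\<not> p dvd m" and "u \<in> U"
  shows "comm c u \<in> L"
  using assms(1) nL \<open>u \<in> U\<close>
proof (induction arbitrary: u rule: chain.induct)
  case (refl L)
  have cX: "c \<in> X"
    unfolding c(1) using X ab by (rule comm_in_subgroup)
  have "c \<otimes> u \<otimes> inv c \<in> L"
    using refl cX normalisesD by blast
  then show ?case
    using refl by (simp add: comm_def subgroup.m_closed subgroup.m_inv_closed)
next
  case (step L K U r)
  have K: "subgroup L G" "subgroup K G" "normalises X K" "L \<subseteq> K"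
    using chainD[OF step.hyps(1)] by auto
  have p: "prime p" "r = p"
    using step by auto
  obtain j where j: "card K = p ^ j * card L"
    using chain_p_card step.hyps(1) by blast
  have UG: "U \<subseteq> carrier G" and XG: "X \<subseteq> carrier G"
    using step.hyps(2) X subgroup.subset by auto
  have UL: "normalises U L"
    using step.prems(1) UG normalises_subset by blast
  have UK: "normalises U K"
    using index_p_normalises[OF K(2) step.hyps(2) K(1) step.hyps(4) K(4) UL p(1) _ j] step.hyps(5) p
    by simp
  interpret F: factor_map G "G\<lparr>carrier := U\<rparr> Mod K" U K "\<lambda>x. K #> x"
    using factor_map_Mod step.hyps K UK by blast
  have LG: "L \<subseteq> carrier G"
    using K(1) subgroup.subset by blast
  obtain Q :: "'a set monoid" and f where "factor_map G Q (carrier G) L f"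
    using factor_mapE[OF subgroup_self K(1) LG step.prems(1)] .
  then interpret N: factor_map G Q "carrier G" L f .
  interpret KL: factor_map G "G\<lparr>carrier := K\<rparr> Mod L" K L "\<lambda>x. L #> x"
    using factor_map_Mod[OF K(2,1,4) normalises_subset[OF UL step.hyps(4)]] .
  have act: "\<exists>d. power_action x d U K" if x: "x \<in> X" for x
    using F.prime_index_power_action[of r x] step.hyps K(3) x XG
    by (auto intro: normalisesD)
  obtain d e where de: "power_action a d U K" "power_action b e U K"
    using act ab by meson
  \<comment> \<open>The displacement of u under c. As a commutator of power maps, c is trivial on
    U/K, so z lies in \<open>K\<close>, where the induction hypothesis applies.\<close>
  define z where "z = inv u \<otimes> (c \<otimes> u \<otimes> inv c)"
  have zK: "z \<in> K"
    unfolding z_def c(1) using de ab XG step.prems(2) step.hyps(3) X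
    by (intro F.power_action_comm[where c = d and d = e]) (auto intro: normalisesD normalisesD_inv)
  have cX: "c \<in> X"
    unfolding c(1) using X ab by (rule comm_in_subgroup)
  then have G: "c \<in> carrier G" "u \<in> carrier G" "z \<in> carrier G"
    using XG UG step.prems zK step.hyps(4) by auto
  have cz: "comm c z \<in> L"
    using step.IH step.prems zK by blast
  have "c \<otimes> u \<otimes> inv c = u \<otimes> z"
    using G by (simp add: z_def)
  then have 1: "f c \<otimes>\<^bsub>Q\<^esub> f u \<otimes>\<^bsub>Q\<^esub> inv\<^bsub>Q\<^esub> f c = f u \<otimes>\<^bsub>Q\<^esub> f z"
    using G by (metis N.hom N.map_inv inv_closed m_closed)
  have 2: "f c \<otimes>\<^bsub>Q\<^esub> f z = f z \<otimes>\<^bsub>Q\<^esub> f c"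
    using N.comm_iff G cz by blast
  have C: "f c \<in> carrier Q" "f u \<in> carrier Q" "f z \<in> carrier Q"
    using G N.closed by blast+
  have cm: "f c [^]\<^bsub>Q\<^esub> m = \<one>\<^bsub>Q\<^esub>"
    using N.map_pow[OF G(1), of m] c(2) N.map_one by simp
  have "f u \<otimes>\<^bsub>Q\<^esub> f z [^]\<^bsub>Q\<^esub> m = f u"
    using N.Q.conj_pow_commuting[OF C 1 2, of m] C cm by simp
  then have zm: "f z [^]\<^bsub>Q\<^esub> m = \<one>\<^bsub>Q\<^esub>"
    using C by simp
  \<comment> \<open>The order of z modulo \<open>L\<close> divides m through c and
    \<open>p ^ j\<close> through K/L.\<close>
  have "z [^] (p ^ j) \<in> L"
    using KL.pow_card_in_L[OF j zK] .
  then have "f z [^]\<^bsub>Q\<^esub> (p ^ j) = \<one>\<^bsub>Q\<^esub>"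
    using N.map_pow[OF G(3), of "p ^ j"] N.map_L by simp
  moreover have "coprime m (p ^ j)"
    using c(3) p prime_imp_coprime by (metis coprime_commute coprime_power_right_iff)
  ultimately have "f z = \<one>\<^bsub>Q\<^esub>"
    using N.Q.coprime_pow_eq_one C(3) zm by blast
  then have "f c \<otimes>\<^bsub>Q\<^esub> f u \<otimes>\<^bsub>Q\<^esub> inv\<^bsub>Q\<^esub> f c = f u"
    using 1 C by simp
  then have "f c \<otimes>\<^bsub>Q\<^esub> f u = f u \<otimes>\<^bsub>Q\<^esub> f c"
    using C by (metis N.Q.inv_solve_right N.Q.m_closed)
  then show ?case
    using N.comm_iff G by blast
qed

text \<open>Consider the first member of the chain that is not inside \<open>M\<close>. Its
  predecessor is inside \<open>M\<close>, and \<open>X\<close> acts on the step between them, of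
  order p, by power maps. So any element of that member outside \<open>M\<close> is an eigenvector
  for all of \<open>X\<close> at once.\<close>

lemma chain_eigenvector:
  assumes "chain X {p} L K" "normalises (carrier G) L" "X \<subseteq> carrier G" "subgroup M G" "L \<subseteq> M" "\<not> K \<subseteq> M"
  shows "\<exists>v\<in>K - M. \<forall>x\<in>X. \<exists>c::nat. \<exists>m\<in>M. x \<otimes> v \<otimes> inv x = v [^] c \<otimes> m"
  using assms
proof (induction rule: chain.induct)
  case (step L K U r)
  have K: "subgroup L G" "subgroup K G" "normalises X K" "L \<subseteq> K"
    using chainD[OF step.hyps(1)] by auto
  have p: "prime p" "r = p"
    using step by auto
  obtain j where j: "card K = p ^ j * card L"
    using chain_p_card step.hyps(1) by blast
  have UG: "U \<subseteq> carrier G"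
    using step.hyps(2) subgroup.subset by auto
  have UK: "normalises U K"
    using index_p_normalises[OF K(2) step.hyps(2) K(1) step.hyps(4) K(4)
        normalises_subset[OF step.prems(1) UG] p(1) _ j] step.hyps(5) p
    by simp
  show ?case
  proof (cases "K \<subseteq> M")
    case False
    then show ?thesis
      using step by blast
  next
    case True
    obtain v where v: "v \<in> U" "v \<notin> M"
      using step.prems by blast
    interpret F: factor_map G "G\<lparr>carrier := U\<rparr> Mod K" U K "\<lambda>x. K #> x"
      using factor_map_Mod step.hyps K UK by blast
    have "\<exists>c::nat. \<exists>m\<in>M. x \<otimes> v \<otimes> inv x = v [^] c \<otimes> m" if x: "x \<in> X" for x
    proof -
      obtain c where "power_action x c U K"
        using F.prime_index_power_action[of r x] step.hyps K(3) x step.prems(2)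
        by (auto intro: normalisesD)
      then show ?thesis
        using v(1) True unfolding power_action_def by blast
    qed
    then show ?thesis
      using v by blast
  qed
qed simp

text \<open>The section below a maximal \<open>Q\<close>-invariant normal subgroup \<open>M\<close> of \<open>S\<close> is abelian. The elements
  on which a factor \<open>X\<close> of \<open>Q\<close> acts with the eigenvalues of one eigenvector form a \<open>Q\<close>-invariant
  subgroup, because the commutators of \<open>Q\<close> act trivially; hence all of \<open>Q\<close> acts by power maps.\<close>

lemma chain_setmult_commuting:
  assumes cX: "chain X {p} L U" and cY: "chain Y {p} L U" and Q: "subgroup Q G"
    and XQ: "X \<subseteq> Q" and YQ: "Y \<subseteq> Q" and QXY: "Q \<subseteq> X <#> Y"
    and nL: "normalises (carrier G) L" and QU: "normalises Q U"
    and cQ: "\<And>a b u. a \<in> Q \<Longrightarrow> b \<in> Q \<Longrightarrow> u \<in> U \<Longrightarrow> comm (comm a b) u \<in> L"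
  shows "chain Q {p} L U"
proof -
  have L: "subgroup L G" and U: "subgroup U G" and LU: "L \<subseteq> U"
    using chainD[OF cX] by auto
  have QG: "Q \<subseteq> carrier G"
    using Q subgroup.subset by blast
  have QL: "normalises Q L"
    using nL QG normalises_subset by blast
  obtain k where k: "card U = p ^ k * card L"
    using chain_p_card cX by blast
  \<comment> \<open>Every \<open>Q\<close>-invariant \<open>S\<close> of the section is reached, by
    induction on its order: split off a top factor S/M and show that it has order p.\<close>
  have "chain Q {p} L S" if "subgroup S G" "L \<subseteq> S" "S \<subseteq> U" "normalises Q S" for S
    using that
  proof (induction "card S" arbitrary: S rule: less_induct)
    case less
    note S = less.prems(1)
    show ?case
    proof (cases "S = L")
      case True
      then show ?thesis
        using less.prems by (auto intro: chain.refl)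
    next
      case False
      then have p: "prime p"
        using less.prems(2,3) chain_prime[OF cX] by blast
      have SG: "S \<subseteq> carrier G"
        using S subgroup.subset by blast
      have dS: "\<exists>i. card S = p ^ i * m" if m: "card M = m" "subgroup M G" "L \<subseteq> M" "M \<subseteq> S" for M m
      proof -
        obtain s where s: "card S = card M * s"
          using card_subgroup_dvd m S by blast
        obtain t where t: "card U = card S * t"
          using card_subgroup_dvd S U less.prems by blast
        obtain l where l: "card M = card L * l"
          using card_subgroup_dvd m L by blast
        have "card L * (s * (l * t)) = card L * p ^ k"
          using s t l k by (auto simp: ac_simps)
        then have "s * (l * t) = p ^ k"
          using card_pos[OF L] by simp
        then have "s dvd p ^ k"
          by (metis dvd_triv_left)
        then show ?thesis
          using dvd_prime_powerE[OF p] s m by (metis mult.commute)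
      qed
      \<comment> \<open>A maximal member \<open>M\<close> makes S/M irreducible under the joint
        action of \<open>Q\<close> and \<open>S\<close>.\<close>
      define F where "F = {M. subgroup M G \<and> L \<subseteq> M \<and> M \<subset> S \<and> normalises Q M \<and> normalises S M}"
      have "L \<in> F"
        using L less.prems False QL nL SG normalises_subset by (auto simp: F_def)
      moreover have "finite F"
        by (rule finite_subset[of _ "Pow S"]) (use finite_subgroup[OF S] in \<open>auto simp: F_def\<close>)
      ultimately obtain M where M: "M \<in> F" "\<And>V. V \<in> F \<Longrightarrow> M \<subseteq> V \<Longrightarrow> V = M"
        using finite_has_maximal[of F] by blast
      then have M': "subgroup M G" "L \<subseteq> M" "M \<subseteq> S" "M \<noteq> S" "normalises Q M" "normalises S M"
        by (auto simp: F_def)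
      have max: "V = S" if "subgroup V G" "M \<subseteq> V" "V \<subseteq> S" "V \<noteq> M" "normalises Q V" "normalises S V" for V
        using M(2)[of V] that M' by (auto simp: F_def)
      have MG: "M \<subseteq> carrier G"
        using M' subgroup.subset by blast
      obtain V :: "'a set monoid" and f where "factor_map G V S M f"
        using factor_mapE[OF S M'(1,3,6)] .
      then interpret F: factor_map G V S M f .
      obtain i where i: "card S = p ^ i * card M"
        using dS M' by blast
      have cV: "card (carrier V) = p ^ i"
        using F.card_quotient i card_pos[OF M'(1)] by simp
      have "i > 0"
      proof (rule ccontr)
        assume "\<not> i > 0"
        then have "M = S"
          using i M' S by (intro subgroup_eqI) auto
        then show False
          using M' by simp
      qed
      have comm: "f w \<otimes>\<^bsub>V\<^esub> f u = f u \<otimes>\<^bsub>V\<^esub> f w" if wu: "w \<in> S" "u \<in> S" for w u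
      proof -
        \<comment> \<open>The preimage of the centre of S/M. It is larger than \<open>M\<close>,
          since S/M is a nontrivial p-group, and by maximality it is all of
          \<open>S\<close>.\<close>
        define Z where "Z = {w \<in> S. \<forall>u\<in>S. comm w u \<in> M}"
        have Z: "w \<in> Z \<longleftrightarrow> w \<in> S \<and> (\<forall>u\<in>S. f w \<otimes>\<^bsub>V\<^esub> f u = f u \<otimes>\<^bsub>V\<^esub> f w)" for w
          using F.comm_iff by (auto simp: Z_def)
        have inv: "normalises R Z" if R: "subgroup R G" "normalises R S" "normalises R M" for R
          unfolding normalises_def
        proof (intro ballI)
          fix x w assume x: "x \<in> R" and w: "w \<in> Z"
          have "comm (x \<otimes> w \<otimes> inv x) u \<in> M" if u: "u \<in> S" for u
          proof -
            have G: "x \<in> carrier G" "w \<in> carrier G" "u \<in> carrier G"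
              using x R w u subgroup_carrier by (auto simp: Z_def)
            have "inv x \<otimes> u \<otimes> x \<in> S"
              using normalisesD_inv R x u by blast
            then have "x \<otimes> comm w (inv x \<otimes> u \<otimes> x) \<otimes> inv x \<in> M"
              using w R x normalisesD by (auto simp: Z_def)
            moreover have "x \<otimes> comm w (inv x \<otimes> u \<otimes> x) \<otimes> inv x = comm (x \<otimes> w \<otimes> inv x) u"
              using G by (simp add: comm_def word_simps)
            ultimately show ?thesis
              by simp
          qed
          moreover have "x \<otimes> w \<otimes> inv x \<in> S"
            using w R x normalisesD by (auto simp: Z_def)
          ultimately show "x \<otimes> w \<otimes> inv x \<in> Z"
            by (simp add: Z_def)
        qed
        have "subgroup Z G"
        proof (rule finite_group_subgroupI)
          show "Z \<subseteq> carrier G"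
            using SG by (auto simp: Z_def)
          show "\<one> \<in> Z"
            by (simp add: Z)
          fix x y assume "x \<in> Z" "y \<in> Z"
          then have xy: "x \<in> S" "y \<in> S" and c: "\<And>u. u \<in> S \<Longrightarrow> f x \<otimes>\<^bsub>V\<^esub> f u = f u \<otimes>\<^bsub>V\<^esub> f x"
              "\<And>u. u \<in> S \<Longrightarrow> f y \<otimes>\<^bsub>V\<^esub> f u = f u \<otimes>\<^bsub>V\<^esub> f y"
            by (auto simp: Z)
          have "f (x \<otimes> y) \<otimes>\<^bsub>V\<^esub> f u = f u \<otimes>\<^bsub>V\<^esub> f (x \<otimes> y)" if u: "u \<in> S" for u
            using F.Q.commute_mult[OF _ _ _ c(1)[OF u] c(2)[OF u]] xy u by (simp add: F.hom)
          then show "x \<otimes> y \<in> Z"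
            using xy by (simp add: Z)
        qed
        moreover have "M \<subseteq> Z"
          by (auto simp: Z F.map_L)
        moreover have "Z \<noteq> M"
        proof -
          obtain z where z: "z \<in> carrier V" "z \<noteq> \<one>\<^bsub>V\<^esub>" "\<And>x. x \<in> carrier V \<Longrightarrow> x \<otimes>\<^bsub>V\<^esub> z = z \<otimes>\<^bsub>V\<^esub> x"
            using F.Q.p_group_centre[OF cV p \<open>i > 0\<close>] by blast
          obtain w where w: "w \<in> S" "f w = z"
            using z(1)[folded F.onto] by blast
          have "w \<in> Z"
            unfolding Z using w(1) z(3)[OF F.closed] by (simp add: w(2))
          moreover have "w \<notin> M"
            using z(2) F.ker[OF w(1)] by (simp add: w(2))
          ultimately
          show ?thesis
            by blast
        qed
        moreover have "Z \<subseteq> S"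
          by (auto simp: Z_def)
        moreover have "normalises Q Z" "normalises S Z"
          using inv Q S M' less.prems(4) normalises_self[OF S subset_refl] by blast+
        ultimately have "Z = S"
          using max by blast
        then show ?thesis
          using wu Z by blast
      qed
      \<comment> \<open>Now that S/M is abelian, intermediate subgroups are normal in
        \<open>S\<close>, so that S/M is irreducible under \<open>Q\<close> alone.\<close>
      have max': "W = S" if "subgroup W G" "M \<subseteq> W" "W \<subseteq> S" "W \<noteq> M" "normalises Q W" for W
      proof (rule max[OF that])
        show "normalises S W"
          unfolding normalises_def
        proof (intro ballI)
          fix s w assume s: "s \<in> S" and w: "w \<in> W"
          then have "comm s w \<in> M"
            using comm that F.comm_iff by blast
          then have "comm s w \<otimes> w \<in> W"
            using subgroup.m_closed[OF that(1)] that(2) w by blast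
          moreover have "comm s w \<otimes> w = s \<otimes> w \<otimes> inv s"
            using s w that(3) SG by (simp add: comm_def word_simps subset_iff)
          ultimately show "s \<otimes> w \<otimes> inv s \<in> W"
            by simp
        qed
      qed
      have cj: "x \<otimes> w \<otimes> inv x \<in> S" if "x \<in> Q" "w \<in> S" for x w
        using that less.prems(4) normalisesD by blast
      have eig: "\<forall>x\<in>X. \<exists>c. power_action x c S M" if cX: "chain X {p} L U" and XQ: "X \<subseteq> Q" for X
      proof -
        have XG: "X \<subseteq> carrier G"
          using XQ QG by blast
        have USL: "U \<inter> S = S" "L \<inter> S = L"
          using less.prems by auto
        obtain j where "card S = p ^ j * card L"
          using dS[of L] L less.prems by blast
        then have "chain X {p} (L \<inter> S) (U \<inter> S)"
          using chain_Int[OF cX S normalises_subset[OF less.prems(4) XQ] subset_refl U, of j] USL by simp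
        then have "chain X {p} L S"
          by (simp add: USL)
        then obtain v where v: "v \<in> S" "v \<notin> M" "\<forall>x\<in>X. \<exists>c::nat. \<exists>m\<in>M. x \<otimes> v \<otimes> inv x = v [^] c \<otimes> m"
          using chain_eigenvector[OF _ nL XG M'(1,2)] M' by blast
        then obtain c :: "'a \<Rightarrow> nat" where c: "\<And>x. x \<in> X \<Longrightarrow> \<exists>m\<in>M. x \<otimes> v \<otimes> inv x = v [^] c x \<otimes> m"
          by metis
        \<comment> \<open>The joint eigenspace of \<open>X\<close> for the exponents found at v. It
          is closed under products because S/M is abelian.\<close>
        define W where "W = {w \<in> S. \<forall>x\<in>X. f (x \<otimes> w \<otimes> inv x) = f w [^]\<^bsub>V\<^esub> c x}"
        have "subgroup W G"
        proof (rule finite_group_subgroupI)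
          show "W \<subseteq> carrier G"
            using SG by (auto simp: W_def)
          show "\<one> \<in> W"
            using XG by (auto simp: W_def subset_iff)
          fix w u assume "w \<in> W" "u \<in> W"
          then have wu: "w \<in> S" "u \<in> S" and e: "\<And>x. x \<in> X \<Longrightarrow> f (x \<otimes> w \<otimes> inv x) = f w [^]\<^bsub>V\<^esub> c x"
              "\<And>x. x \<in> X \<Longrightarrow> f (x \<otimes> u \<otimes> inv x) = f u [^]\<^bsub>V\<^esub> c x"
            by (auto simp: W_def)
          have "f (x \<otimes> (w \<otimes> u) \<otimes> inv x) = f (w \<otimes> u) [^]\<^bsub>V\<^esub> c x" if x: "x \<in> X" for x
          proof -
            have "x \<otimes> (w \<otimes> u) \<otimes> inv x = (x \<otimes> w \<otimes> inv x) \<otimes> (x \<otimes> u \<otimes> inv x)"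
              using x wu XG by (auto simp: word_simps subset_iff)
            then have "f (x \<otimes> (w \<otimes> u) \<otimes> inv x) = f w [^]\<^bsub>V\<^esub> c x \<otimes>\<^bsub>V\<^esub> f u [^]\<^bsub>V\<^esub> c x"
              using F.hom[OF cj cj] x wu XQ e by auto
            also have "\<dots> = (f w \<otimes>\<^bsub>V\<^esub> f u) [^]\<^bsub>V\<^esub> c x"
              using wu by (simp add: F.Q.pow_mult_distrib[OF comm[OF wu]])
            finally show ?thesis
              using wu by (simp add: F.hom)
          qed
          then show "w \<otimes> u \<in> W"
            using wu by (simp add: W_def)
        qed
        moreover have "M \<subseteq> W"
        proof
          fix m assume m: "m \<in> M"
          then have "x \<otimes> m \<otimes> inv x \<in> M" if "x \<in> X" for x
            using M'(5) XQ that normalisesD by blast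
          then show "m \<in> W"
            using m by (auto simp: W_def F.map_L)
        qed
        moreover have "W \<subseteq> S"
          by (auto simp: W_def)
        moreover have "v \<in> W"
        proof -
          have "f (x \<otimes> v \<otimes> inv x) = f v [^]\<^bsub>V\<^esub> c x" if x: "x \<in> X" for x
            using c[OF x] v(1) by (auto simp: F.hom F.map_pow F.map_L)
          then show ?thesis
            using v(1) by (simp add: W_def)
        qed
        moreover have "normalises Q W"
          unfolding normalises_def
        proof (intro ballI)
          fix y w assume y: "y \<in> Q" and "w \<in> W"
          then have w: "w \<in> S" and e: "\<And>x. x \<in> X \<Longrightarrow> f (x \<otimes> w \<otimes> inv x) = f w [^]\<^bsub>V\<^esub> c x"
            by (auto simp: W_def)
          have "f (x \<otimes> (y \<otimes> w \<otimes> inv y) \<otimes> inv x) = f (y \<otimes> w \<otimes> inv y) [^]\<^bsub>V\<^esub> c x" if x: "x \<in> X" for x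
          proof -
            \<comment> \<open>x y acts as d y x, and d moves t only by an element of
              \<open>L\<close>. So x and y may be exchanged modulo \<open>M\<close>.\<close>
            define d t where "d = comm x y" and "t = y \<otimes> (x \<otimes> w \<otimes> inv x) \<otimes> inv y"
            have xQ: "x \<in> Q"
              using x XQ by blast
            have G: "x \<in> carrier G" "y \<in> carrier G" "w \<in> carrier G"
              using xQ y w QG SG by auto
            have t: "t \<in> S"
              using cj y xQ w by (simp add: t_def)
            then have tG: "t \<in> carrier G"
              using SG by blast
            have dt: "comm d t \<in> M"
              using cQ[OF xQ y, of t] t less.prems(3) M'(2) by (auto simp: d_def)
            have "x \<otimes> (y \<otimes> w \<otimes> inv y) \<otimes> inv x = comm d t \<otimes> t"
              using G by (simp add: d_def t_def comm_def word_simps)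
            then have *: "f (x \<otimes> (y \<otimes> w \<otimes> inv y) \<otimes> inv x) = f t"
              using dt t by (simp add: F.hom F.map_L)
            define m where "m = inv (w [^] c x) \<otimes> (x \<otimes> w \<otimes> inv x)"
            have m: "m \<in> M"
              using e[OF x] F.map_eq_iff[of "w [^] c x" "x \<otimes> w \<otimes> inv x"] w cj[OF xQ w]
              by (simp add: m_def F.map_pow)
            then have mG: "m \<in> carrier G"
              using MG by blast
            have "x \<otimes> w \<otimes> inv x = w [^] c x \<otimes> m"
              using G by (simp add: m_def)
            then have "t = (y \<otimes> w [^] c x \<otimes> inv y) \<otimes> (y \<otimes> m \<otimes> inv y)"
              using G mG by (simp add: t_def word_simps)
            also have "\<dots> = (y \<otimes> w \<otimes> inv y) [^] c x \<otimes> (y \<otimes> m \<otimes> inv y)"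
              using G by (simp add: conj_pow)
            finally have "t = (y \<otimes> w \<otimes> inv y) [^] c x \<otimes> (y \<otimes> m \<otimes> inv y)" .
            moreover have "y \<otimes> m \<otimes> inv y \<in> M"
              using M'(5) y m normalisesD by blast
            ultimately show ?thesis
              using cj[OF y w] by (simp add: * F.hom F.map_pow F.map_L)
          qed
          then show "y \<otimes> w \<otimes> inv y \<in> W"
            using cj[OF y w] by (simp add: W_def)
        qed
        ultimately have "W = S"
          using max' v(2) by blast
        then have "f (x \<otimes> w \<otimes> inv x) = f w [^]\<^bsub>V\<^esub> c x" if "x \<in> X" "w \<in> S" for x w
          using that unfolding W_def by blast
        then have "power_action x (c x) S M" if "x \<in> X" for x
          using that XG XQ cj by (subst F.power_action_iff) (simp_all add: subset_iff)
        then show ?thesis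
          by blast
      qed
      have eigQ: "\<exists>c. power_action g c S M" if g: "g \<in> Q" for g
      proof -
        obtain x y where xy: "x \<in> X" "y \<in> Y" "g = x \<otimes> y"
          using subsetD[OF QXY g] by (auto simp: setmult_iff)
        obtain c d where "power_action x c S M" "power_action y d S M"
          using eig[OF cX XQ] eig[OF cY YQ] xy by meson
        then show ?thesis
          using F.power_action_mult[of x y c d] xy XQ YQ QG cj by blast
      qed
      obtain v0 where v0: "v0 \<in> S" "v0 \<notin> M"
        using M' by blast
      have "v0 [^] (p ^ i) \<in> M"
        using F.pow_card_in_L[OF i v0(1)] .
      \<comment> \<open>The last power of v0 before the sequence of p-th powers enters
        \<open>M\<close> has order p modulo \<open>M\<close>.\<close>
      define l where "l = (LEAST l. v0 [^] (p ^ l) \<in> M)"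
      have l: "v0 [^] (p ^ l) \<in> M"
        unfolding l_def by (rule LeastI) fact
      have "l \<noteq> 0"
        using l v0 SG by (cases "l = 0") auto
      then obtain l' where l': "l = Suc l'"
        using not0_implies_Suc by blast
      define v where "v = v0 [^] (p ^ l')"
      have v: "v \<in> S" "v \<notin> M"
        using v0 not_less_Least[of l' "\<lambda>l. v0 [^] (p ^ l) \<in> M"] l' by (auto simp: v_def l_def)
      have "v [^] p \<in> M"
        using l v0(1) by (simp add: v_def l' nat_pow_pow mult.commute)
      then have vp: "f v [^]\<^bsub>V\<^esub> p = \<one>\<^bsub>V\<^esub>"
        using F.map_L F.map_pow v(1) by metis
      \<comment> \<open>The group generated by v modulo \<open>M\<close> is invariant under the
        power maps of \<open>Q\<close>. Irreducibility makes it all of S/M, which then has at most p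
        elements.\<close>
      define W where "W = {w \<in> S. \<exists>j::nat. f w = f v [^]\<^bsub>V\<^esub> j}"
      have "subgroup W G"
      proof (rule finite_group_subgroupI)
        show "W \<subseteq> carrier G"
          using SG by (auto simp: W_def)
        show "\<one> \<in> W"
          by (auto simp: W_def intro!: exI[of _ 0])
        fix x y assume "x \<in> W" "y \<in> W"
        then obtain a b :: nat where "x \<in> S" "y \<in> S" "f x = f v [^]\<^bsub>V\<^esub> a" "f y = f v [^]\<^bsub>V\<^esub> b"
          by (auto simp: W_def)
        then have "x \<otimes> y \<in> S" "f (x \<otimes> y) = f v [^]\<^bsub>V\<^esub> (a + b)"
          using v by (simp_all add: F.hom F.Q.nat_pow_mult)
        then show "x \<otimes> y \<in> W"
          by (auto simp: W_def)
      qed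
      moreover have "M \<subseteq> W"
        by (auto simp: W_def F.map_L intro!: exI[of _ 0])
      moreover have "v \<in> W"
        using v by (auto simp: W_def intro!: exI[of _ 1])
      moreover have "W \<subseteq> S"
        by (auto simp: W_def)
      moreover have "normalises Q W"
        unfolding normalises_def
      proof (intro ballI)
        fix g w assume g: "g \<in> Q" and "w \<in> W"
        then obtain a :: nat where a: "w \<in> S" "f w = f v [^]\<^bsub>V\<^esub> a"
          by (auto simp: W_def)
        obtain c where "power_action g c S M"
          using eigQ g by blast
        then have "f (g \<otimes> w \<otimes> inv g) = f v [^]\<^bsub>V\<^esub> (a * c)"
          using F.power_action_iff[of g c] g QG cj a v by (auto simp: F.Q.nat_pow_pow)
        then show "g \<otimes> w \<otimes> inv g \<in> W"
          using cj[OF g a(1)] by (auto simp: W_def)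
      qed
      ultimately have WS: "W = S"
        using max' v(2) by blast
      have "carrier V \<subseteq> (\<lambda>j. f v [^]\<^bsub>V\<^esub> j) ` {..<p}"
      proof
        fix z assume "z \<in> carrier V"
        then obtain w where "w \<in> S" "z = f w"
          unfolding F.onto[symmetric] by blast
        then obtain j :: nat where j: "z = f v [^]\<^bsub>V\<^esub> j"
          using WS by (auto simp: W_def)
        have "j = p * (j div p) + j mod p"
          by simp
        then have "z = f v [^]\<^bsub>V\<^esub> (p * (j div p)) \<otimes>\<^bsub>V\<^esub> f v [^]\<^bsub>V\<^esub> (j mod p)"
          using v(1) by (metis F.Q.nat_pow_mult F.closed j)
        also have "f v [^]\<^bsub>V\<^esub> (p * (j div p)) = \<one>\<^bsub>V\<^esub>"
          using v(1) vp by (simp flip: F.Q.nat_pow_pow)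
        finally show "z \<in> (\<lambda>j. f v [^]\<^bsub>V\<^esub> j) ` {..<p}"
          using p prime_gt_0_nat v(1) by auto
      qed
      then have "card (carrier V) \<le> p"
        using surj_card_le[of "{..<p}" "carrier V"] by auto
      then have "p ^ i \<le> p ^ 1"
        using cV by simp
      then have "i = 1"
        using \<open>i > 0\<close> p by (metis One_nat_def Suc_leI le_antisym power_le_imp_le_exp prime_gt_1_nat)
      then have SM: "card S = p * card M"
        using i by simp
      have "card M < card S"
        using M' finite_subgroup[OF S] by (intro psubset_card_mono) auto
      then have "chain Q {p} L M"
        using less.hyps M' less.prems(3) by blast
      then show ?thesis
        using chain.step[OF _ S less.prems(4) M'(3) SM p] by blast
    qed
  qed
  then show ?thesis
    using U LU QU by blast
qed

end

section \<open>Nilpotency modulo a normal subgroup\<close>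

context group
begin

text \<open>For normal \<open>N\<close> this says that \<open>K/N\<close> is nilpotent; in this elementwise form it passes at once to
  intersections of such \<open>N\<close>, hence to the residual.\<close>

definition nilp_mod :: "'a set \<Rightarrow> 'a set \<Rightarrow> bool" where
  "nilp_mod N K \<longleftrightarrow> (\<forall>p q x y. \<forall>k l::nat. prime p \<longrightarrow> prime (q::nat) \<longrightarrow> p \<noteq> q \<longrightarrow> x \<in> K \<longrightarrow> y \<in> K \<longrightarrow>
     x [^] (p ^ k) \<in> N \<longrightarrow> y [^] (q ^ l) \<in> N \<longrightarrow> comm x y \<in> N)"

lemma nilp_modD:
  "nilp_mod N K \<Longrightarrow> prime (p::nat) \<Longrightarrow> prime (q::nat) \<Longrightarrow> p \<noteq> q \<Longrightarrow> x \<in> K \<Longrightarrow> y \<in> K \<Longrightarrow>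
     x [^] (p ^ k) \<in> N \<Longrightarrow> y [^] (q ^ l) \<in> N \<Longrightarrow> comm x y \<in> N"
  unfolding nilp_mod_def by blast

end

context factor_map
begin

lemma card_image_subgroup:
  assumes K: "subgroup K G" "K \<subseteq> S"
  shows "card (\<phi> ` K) * card (K \<inter> L) = card K"
proof -
  have "card {x \<in> K. \<phi> x = \<phi> y} = card (K \<inter> L)" if y: "y \<in> K" for y
  proof -
    have KG: "x \<in> K \<Longrightarrow> x \<in> carrier G" "x \<in> K \<Longrightarrow> x \<in> S" for x
      using K by auto
    have yi: "inv y \<in> K"
      using K(1) y by (rule subgroup.m_inv_closed)
    have "bij_betw (\<lambda>s. y \<otimes> s) (K \<inter> L) {x \<in> K. \<phi> x = \<phi> y}"
    proof (rule bij_betwI[where g = "\<lambda>x. inv y \<otimes> x"])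
      show "(\<lambda>s. y \<otimes> s) \<in> K \<inter> L \<rightarrow> {x \<in> K. \<phi> x = \<phi> y}"
        using K(1) y KG by (auto simp: subgroup.m_closed hom map_L)
      show "(\<lambda>x. inv y \<otimes> x) \<in> {x \<in> K. \<phi> x = \<phi> y} \<rightarrow> K \<inter> L"
        using K(1) y yi KG by (auto simp: subgroup.m_closed simp flip: map_eq_iff)
    qed (use y KG in auto)
    then show ?thesis
      by (simp add: bij_betw_same_card)
  qed
  then have "(\<Sum>b\<in>\<phi> ` K. card {x \<in> K. \<phi> x = b}) = (\<Sum>b\<in>\<phi> ` K. card (K \<inter> L))"
    by (intro sum.cong) auto
  moreover have "card K = (\<Sum>b\<in>\<phi> ` K. card {x \<in> K. \<phi> x = b})"
    using sum.image_gen[of K "\<lambda>_. 1 :: nat" \<phi>] finite_subgroup[OF K(1)] by simp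
  ultimately show ?thesis
    by simp
qed

lemma subgroup_image: "subgroup K G \<Longrightarrow> K \<subseteq> S \<Longrightarrow> subgroup (\<phi> ` K) Q"
proof (rule Q.finite_group_subgroupI)
  assume K: "subgroup K G" "K \<subseteq> S"
  show "\<phi> ` K \<subseteq> carrier Q"
    using K by auto
  show "\<one>\<^bsub>Q\<^esub> \<in> \<phi> ` K"
    using subgroup.one_closed[OF K(1)] map_one by (metis imageI)
  fix x y assume "x \<in> \<phi> ` K" "y \<in> \<phi> ` K"
  then obtain a b where "a \<in> K" "b \<in> K" "x = \<phi> a" "y = \<phi> b"
    by blast
  then have "x \<otimes>\<^bsub>Q\<^esub> y = \<phi> (a \<otimes> b)" "a \<otimes> b \<in> K"
    using K by (auto simp: hom subset_iff subgroup.m_closed)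
  then show "x \<otimes>\<^bsub>Q\<^esub> y \<in> \<phi> ` K"
    by blast
qed

lemma preimage:
  assumes H: "subgroup H Q"
  defines "K \<equiv> {x \<in> S. \<phi> x \<in> H}"
  shows "subgroup K G" "K \<subseteq> S" "L \<subseteq> K" "\<phi> ` K = H" "card K = card H * card L"
proof -
  have HQ: "h \<in> H \<Longrightarrow> h \<in> carrier Q" for h
    using H by (rule Q.subgroup_carrier)
  show K: "subgroup K G"
  proof (rule finite_group_subgroupI)
    show "K \<subseteq> carrier G"
      by (auto simp: K_def)
    show "\<one> \<in> K"
      using subgroup.one_closed[OF H] by (simp add: K_def)
    show "x \<otimes> y \<in> K" if "x \<in> K" "y \<in> K" for x y
      using that H by (simp add: K_def hom subgroup.m_closed)
  qed
  show KS: "K \<subseteq> S"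
    by (auto simp: K_def)
  show LK: "L \<subseteq> K"
    using subgroup.one_closed[OF H] by (auto simp: K_def map_L)
  show im: "\<phi> ` K = H"
  proof
    show "H \<subseteq> \<phi> ` K"
    proof
      fix h assume h: "h \<in> H"
      then have "h \<in> \<phi> ` S"
        using HQ onto by simp
      then show "h \<in> \<phi> ` K"
        using h by (auto simp: K_def)
    qed
  qed (auto simp: K_def)
  have "K \<inter> L = L"
    using LK by blast
  then show "card K = card H * card L"
    using card_image_subgroup[OF K KS] im by simp
qed

end

context fin_group
begin

text \<open>(U \<inter> D)/(L \<inter> D) is identified with (U \<inter> D)L/L inside U/L.\<close>

lemma section_Int:
  assumes L: "subgroup L G" and U: "subgroup U G" and D: "subgroup D G" and "L \<subseteq> U" "normalises (U \<inter> D) L"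
    and "card U = p ^ k * card L" "prime p"
  shows "\<exists>j\<le>k. card (U \<inter> D) = p ^ j * card (L \<inter> D)"
proof -
  have UD: "subgroup (U \<inter> D) G"
    using U D by (rule subgroup_Int)
  have s: "subgroup ((U \<inter> D) <#> L) G"
    using subgroup_setmult[OF UD L] assms by blast
  have sub: "(U \<inter> D) <#> L \<subseteq> U" "L \<subseteq> (U \<inter> D) <#> L"
    using setmult_subset[OF U, of "U \<inter> D" L] UD L \<open>L \<subseteq> U\<close> by (simp_all add: subset_setmult_right)
  obtain t where t: "card ((U \<inter> D) <#> L) = card L * t"
    using card_subgroup_dvd[OF L s sub(2)] by blast
  obtain r where r: "card U = card ((U \<inter> D) <#> L) * r"
    using card_subgroup_dvd[OF s U sub(1)] by blast
  have "card L * (t * r) = card L * p ^ k"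
    using t r assms by auto
  then have "t * r = p ^ k"
    using card_pos[OF L] by simp
  then obtain j where j: "t = p ^ j" "j \<le> k"
    using dvd_prime_powerE[OF \<open>prime p\<close>] by (metis dvd_triv_left)
  have "(U \<inter> D) \<inter> L = L \<inter> D"
    using assms by blast
  then have "card L * (t * card (L \<inter> D)) = card L * card (U \<inter> D)"
    using card_setmult[OF UD L] t by (auto simp: ac_simps)
  then have "card (U \<inter> D) = p ^ j * card (L \<inter> D)"
    using card_pos[OF L] j by simp
  then show ?thesis
    using j by blast
qed

text \<open>The new index is |U : L| divided by |U \<inter> N : L \<inter> N|, hence a power of
  p.\<close>

lemma section_setmult:
  assumes L: "subgroup L G" and U: "subgroup U G" and N: "subgroup N G" and "L \<subseteq> U" "normalises U L"
    and "card U = p ^ k * card L" "prime p" "subgroup (L <#> N) G" "subgroup (U <#> N) G"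
  shows "\<exists>j. card (U <#> N) = p ^ j * card (L <#> N)"
proof -
  obtain j where j: "j \<le> k" "card (U \<inter> N) = p ^ j * card (L \<inter> N)"
    using section_Int[OF L U N] assms normalises_subset by blast
  obtain t where t: "card (U <#> N) = card (L <#> N) * t"
    using card_subgroup_dvd[OF assms(8,9)] setmult_mono[OF \<open>L \<subseteq> U\<close> subset_refl] by blast
  have pos: "card (L \<inter> N) > 0" "card (L <#> N) > 0"
    using card_pos subgroup_Int L N assms by blast+
  have "card (U <#> N) * card (U \<inter> N) = p ^ k * (card (L <#> N) * card (L \<inter> N))"
    using card_setmult[OF U N] card_setmult[OF L N] assms by simp
  then have "(card (L <#> N) * card (L \<inter> N)) * (t * p ^ j) = (card (L <#> N) * card (L \<inter> N)) * p ^ k"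
    using t j by (simp add: ac_simps)
  then have "t * p ^ j = p ^ k"
    using pos by simp
  then obtain i where "t = p ^ i"
    using dvd_prime_powerE[OF \<open>prime p\<close>] by (metis dvd_triv_left)
  then show ?thesis
    using t by (auto simp: mult.commute)
qed

text \<open>A subgroup of order p^k in U/L, which has order p^(k+1), pulls back to the last member
  before \<open>U\<close>.\<close>

lemma section_chain:
  assumes "subgroup L G" "subgroup U G" "L \<subseteq> U" "normalises U L" "card U = p ^ k * card L" "prime p"
  shows "chain {} {p} L U"
  using assms
proof (induction k arbitrary: U)
  case 0
  then have "L = U"
    by (intro subgroup_eqI) auto
  then show ?case
    using 0 by (auto intro: chain.refl simp: normalises_def)
next
  case (Suc k)
  obtain V :: "'a set monoid" and f where "factor_map G V U L f"
    using factor_mapE Suc.prems by metis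
  then interpret F: factor_map G V U L f .
  \<comment> \<open>\<open>sylow_thm\<close> yields a subgroup for any prime power that divides the
    order, so the cofactor may be p itself.\<close>
  have "order V = p ^ k * p"
    using F.card_quotient Suc.prems(5) card_pos[OF Suc.prems(1)] by (simp add: order_def mult.commute)
  then obtain H where H: "subgroup H V" "card H = p ^ k"
    using sylow_thm[OF Suc.prems(6) F.Q.is_group _ F.Q.fin] by blast
  note M = F.preimage[OF H(1)]
  have c: "card {x \<in> U. f x \<in> H} = p ^ k * card L"
    using M(5) H by simp
  have "chain {} {p} L {x \<in> U. f x \<in> H}"
    using Suc.IH[OF Suc.prems(1) M(1,3) _ c] Suc.prems M(2) normalises_subset by blast
  moreover have "card U = p * card {x \<in> U. f x \<in> H}"
    using c Suc.prems by simp
  ultimately show ?case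
    using chain.step[OF _ Suc.prems(2) _ M(2) _ Suc.prems(6)] by (auto simp: normalises_def)
qed

text \<open>The exponent is t = b s, with b the part of |G| prime to p and b s equal to 1 modulo
  p^k. The factor b makes the power a p-element of \<open>G\<close>, the congruence keeps its class
  modulo \<open>L\<close>.\<close>

lemma pi_element_lift:
  assumes x: "x \<in> carrier G" and L: "subgroup L G" and p: "prime (p::nat)" "x [^] (p ^ k) \<in> L"
  obtains t a :: nat where "inv x \<otimes> x [^] t \<in> L" "(x [^] t) [^] (p ^ a) = \<one>"
proof -
  have "order G \<noteq> 0" "\<not> is_unit p"
    using order_gt_0_iff_finite p not_prime_unit by auto
  then obtain b where b: "order G = p ^ multiplicity p (order G) * b" "\<not> p dvd b"
    using multiplicity_decompose' by metis
  have cop: "gcd b (p ^ k) = 1"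
    using b(2) p(1) by (metis coprime_commute coprime_iff_gcd_eq_1 coprime_power_right_iff prime_imp_coprime)
  have "b \<noteq> 0"
    using b by (metis dvd_0_right)
  then obtain s y where "b * s = p ^ k * y + 1"
    using bezout_nat[of b "p ^ k"] cop by auto
  then have "x [^] (b * s) = (x [^] (p ^ k)) [^] y \<otimes> x"
    using x by (simp add: nat_pow_pow)
  then have "inv x \<otimes> x [^] (b * s) = (x [^] (p ^ k)) [^] y"
    using x by (metis inv_solve_left' group_commutes_pow m_closed nat_pow_closed nat_pow_comm nat_pow_pow nat_pow_eone inv_cancel_left(2))
  then have 1: "inv x \<otimes> x [^] (b * s) \<in> L"
    using pow_in_subgroup L p by simp
  have "(x [^] (b * s)) [^] (p ^ multiplicity p (order G)) = (x [^] order G) [^] s"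
    using x by (subst b(1)) (simp add: nat_pow_pow ac_simps)
  also have "\<dots> = \<one>"
    using x pow_order_eq_1 by simp
  finally show thesis
    using that 1 by blast
qed

text \<open>Put z = c^-1 u c u^-1. It lies in \<open>K\<close> and in \<open>U\<close>, so it is a
  p-element modulo \<open>L\<close> and commutes there with the q-element c. Now c z is the
  conjugate u c u^-1, of the same order as c, so z^(q^j) is trivial modulo \<open>L\<close>;
  coprimality leaves only z in \<open>L\<close>.\<close>

lemma nilp_mod_centralises:
  assumes nil: "nilp_mod N K"
    and K: "subgroup K G" "normalises (carrier G) K" and U: "subgroup U G" "normalises (carrier G) U"
    and L: "subgroup L G" "normalises (carrier G) L" and "N \<subseteq> L" "\<one> \<in> N" "L \<subseteq> U"
    and k: "card U = p ^ k * card L" and pq: "prime p" "prime q" "p \<noteq> q"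
    and c: "c \<in> K" "c [^] (q ^ j) = \<one>" and u: "u \<in> U"
  shows "comm c u \<in> L"
proof -
  have G: "c \<in> carrier G" "u \<in> carrier G"
    using c u K U subgroup_carrier by auto
  define z where "z = inv c \<otimes> (u \<otimes> c \<otimes> inv u)"
  have zK: "z \<in> K"
    unfolding z_def using c K G normalisesD subgroup.m_closed subgroup.m_inv_closed by metis
  have "z = (inv c \<otimes> u \<otimes> c) \<otimes> inv u"
    using G by (simp add: z_def m_assoc)
  then have zU: "z \<in> U"
    using u U G normalisesD_inv[OF subgroup_self U(2) G(1) u] subgroup.m_closed subgroup.m_inv_closed by metis
  then have zG: "z \<in> carrier G"
    using U subgroup_carrier by blast
  have LG: "L \<subseteq> carrier G" and UG: "U \<subseteq> carrier G"
    using L U subgroup.subset by auto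
  obtain V :: "'a set monoid" and f where "factor_map G V (carrier G) L f"
    using factor_mapE[OF subgroup_self L(1) LG L(2)] .
  then interpret F: factor_map G V "carrier G" L f .
  obtain V' :: "'a set monoid" and f' where "factor_map G V' U L f'"
    using factor_mapE[OF U(1) L(1) assms(10) normalises_subset[OF L(2) UG]] .
  then interpret F': factor_map G V' U L f' .
  have zp: "z [^] (p ^ k) \<in> L"
    using F'.pow_card_in_L[OF k zU] .
  \<comment> \<open>\<open>nilp_mod\<close> wants elements of prime power order modulo
    \<open>N\<close>, whereas z is known to be one modulo the larger \<open>L\<close>. A power of z
    that is a p-element of \<open>G\<close> satisfies both.\<close>
  obtain t a :: nat where t: "inv z \<otimes> z [^] t \<in> L" "(z [^] t) [^] (p ^ a) = \<one>"
    using pi_element_lift[OF zG L(1) pq(1) zp] .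
  have "comm c (z [^] t) \<in> N"
    using nilp_modD[OF nil pq(2,1) pq(3)[symmetric] c(1) pow_in_subgroup[OF K(1) zK], of j t a]
      c(2) t(2) \<open>\<one> \<in> N\<close> by simp
  then have "f c \<otimes>\<^bsub>V\<^esub> f (z [^] t) = f (z [^] t) \<otimes>\<^bsub>V\<^esub> f c"
    using F.comm_iff[OF G(1) nat_pow_closed[OF zG]] \<open>N \<subseteq> L\<close> by blast
  moreover have "f (z [^] t) = f z"
    using F.map_eq_iff[OF zG nat_pow_closed[OF zG]] t(1) by metis
  ultimately have cz: "f c \<otimes>\<^bsub>V\<^esub> f z = f z \<otimes>\<^bsub>V\<^esub> f c"
    by simp
  have e: "u \<otimes> c \<otimes> inv u = c \<otimes> z"
    using G by (simp add: z_def)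
  have "(u \<otimes> c \<otimes> inv u) [^] (q ^ j) = u \<otimes> c [^] (q ^ j) \<otimes> inv u"
    using G by (simp add: conj_pow)
  also have "\<dots> = \<one>"
    using c G by simp
  finally have "f ((c \<otimes> z) [^] (q ^ j)) = \<one>\<^bsub>V\<^esub>"
    using F.map_one e by simp
  then have "f c [^]\<^bsub>V\<^esub> (q ^ j) \<otimes>\<^bsub>V\<^esub> f z [^]\<^bsub>V\<^esub> (q ^ j) = \<one>\<^bsub>V\<^esub>"
    using G zG cz F.Q.pow_mult_distrib[OF cz, of "q ^ j"] by (simp add: F.map_pow F.hom)
  moreover have "f c [^]\<^bsub>V\<^esub> (q ^ j) = \<one>\<^bsub>V\<^esub>"
    using F.map_pow[OF G(1), of "q ^ j"] c F.map_one by simp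
  ultimately have "f z [^]\<^bsub>V\<^esub> (q ^ j) = \<one>\<^bsub>V\<^esub>"
    using zG by simp
  moreover have "f z [^]\<^bsub>V\<^esub> (p ^ k) = \<one>\<^bsub>V\<^esub>"
    using zp zG F.map_L F.map_pow by metis
  moreover have "coprime (q ^ j) (p ^ k)"
    using pq by (simp add: primes_coprime)
  ultimately have "f z = \<one>\<^bsub>V\<^esub>"
    using F.Q.coprime_pow_eq_one zG by simp
  then have "f u \<otimes>\<^bsub>V\<^esub> f c = f c \<otimes>\<^bsub>V\<^esub> f u"
  proof -
    have "u \<otimes> c = c \<otimes> z \<otimes> u"
      using G zG by (simp add: z_def m_assoc)
    then show ?thesis
      using G zG \<open>f z = \<one>\<^bsub>V\<^esub>\<close> by (metis F.Q.r_one F.closed F.hom m_closed)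
  qed
  then show ?thesis
    using F.comm_iff[OF G] by simp
qed

section \<open>The sections of the Sylow tower\<close>

lemma card_Oge_dvd: "\<exists>t. card (Oge n) = t * card (Oge (Suc n))"
  using card_subgroup_dvd[OF subgroup_Oge subgroup_Oge Oge_mono, of n "Suc n"]
  by (auto simp: mult.commute elim!: dvdE)

lemma Oge_section_index:
  assumes dispersive "card (Oge n) = t * card (Oge (Suc n))"
  shows "pi_number {n} t"
proof -
  obtain m where m: "card (carrier G) = m * card (Oge (Suc n))" "pi_number {..<Suc n} m"
    using assms by (auto simp: dispersive_def)
  obtain s where s: "card (carrier G) = card (Oge n) * s"
    using card_subgroup_dvd[OF subgroup_Oge subgroup_self subgroup.subset[OF subgroup_Oge], of n]
    unfolding dvd_def by blast
  have "m = s * t"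
    using m s assms(2) card_pos[OF subgroup_Oge, of "Suc n"] by (simp add: mult.commute)
  then have "pi_number {..<Suc n} t"
    using m(2) pi_number_dvd by simp
  moreover have "pi_number {n..} t"
    using pi_number_Opi[OF subgroup_self, of "{n..}"] assms(2) pi_number_dvd by simp
  ultimately show ?thesis
    by (auto simp: pi_number_def less_Suc_eq_le intro!: le_antisym)
qed

lemma Oge_section_prime:
  assumes dispersive "prime p"
  shows "\<exists>k. card (Oge p) = p ^ k * card (Oge (Suc p))"
proof -
  obtain t where t: "card (Oge p) = t * card (Oge (Suc p))"
    using card_Oge_dvd by blast
  moreover have "t > 0"
    using t card_pos[OF subgroup_Oge, of p] by (metis mult_0 neq0_conv)
  ultimately show ?thesis
    using pi_number_singleton[OF assms(2) _ Oge_section_index[OF assms(1) t]] by auto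
qed

lemma Oge_section_nonprime:
  assumes dispersive "\<not> prime n"
  shows "Oge n = Oge (Suc n)"
proof -
  obtain t where t: "card (Oge n) = t * card (Oge (Suc n))"
    using card_Oge_dvd by blast
  have "pi_number {} t"
    using Oge_section_index[OF assms(1) t] assms(2) by (auto simp: pi_number_def)
  then have "t = 1"
    by (intro pi_number_trivial[of "{}" _ "{}"]) auto
  then have "Oge (Suc n) = Oge n"
    using t by (intro subgroup_eqI[OF subgroup_Oge Oge_mono]) auto
  then show ?thesis
    by simp
qed

lemma Oge_zero: "Oge 0 = carrier G"
proof
  show "carrier G \<subseteq> Oge 0"
    by (intro Opi_max) (auto simp: subgroup_self normalises_self pi_number_def)
qed (rule subgroup.subset[OF subgroup_Oge])

lemma Oge_large:
  assumes "n > card (carrier G)"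
  shows "Oge n = {\<one>}"
proof -
  have "card (Oge n) = 1"
  proof (rule ccontr)
    assume "card (Oge n) \<noteq> 1"
    then obtain p where p: "prime p" "p dvd card (Oge n)"
      using prime_factor_nat by blast
    then have "n \<le> p"
      using pi_number_Opi[OF subgroup_self, of "{n..}"] by (auto simp: pi_number_def)
    moreover have "p dvd card (carrier G)"
      using p card_subgroup_dvd[OF subgroup_Oge subgroup_self subgroup.subset[OF subgroup_Oge], of n] dvd_trans
      by blast
    then have "p \<le> card (carrier G)"
      using card_pos[OF subgroup_self] dvd_imp_le by blast
    ultimately show False
      using assms by simp
  qed
  then have "{\<one>} = Oge n"
    by (intro subgroup_eqI) (auto simp: subgroup.one_closed)
  then show ?thesis
    by simp
qed

lemma pi_subgroups_Int:
  assumes "subgroup H G" "subgroup K G" "pi_number \<pi> (card H)" "pi_number \<sigma> (card K)" "\<pi> \<inter> \<sigma> = {}"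
  shows "H \<inter> K = {\<one>}"
proof -
  have s: "subgroup (H \<inter> K) G"
    using assms subgroup_Int by blast
  have "card (H \<inter> K) dvd card H" "card (H \<inter> K) dvd card K"
    using card_subgroup_dvd s assms by auto
  then have "card (H \<inter> K) = 1"
    using pi_number_trivial pi_number_dvd assms by meson
  then have "{\<one>} = H \<inter> K"
    using subgroup.one_closed[OF s] by (intro subgroup_eqI[OF s]) auto
  then show ?thesis
    by simp
qed

text \<open>\<open>psub_Int_section\<close> needs a subgroup that contains the bottom L =
  \<open>Oge (Suc p)\<close> of the section, hence the passage from \<open>X\<close> to X L. The
  resulting chain starts at X L \<inter> \<open>Oge p\<close>, which is L because the orders of
  \<open>X\<close> and \<open>Oge p\<close> are coprime.\<close>

lemma psub_chain_Oge:
  assumes dispersive "psub X (carrier G)" "card X = q ^ i" "prime q" "prime p" "q < p"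
  shows "chain X {p} (Oge (Suc p)) (Oge p)"
proof -
  let ?L = "Oge (Suc p)"
  have X: "subgroup X G"
    using assms chainD by blast
  have XG: "X \<subseteq> carrier G"
    using X subgroup.subset by blast
  obtain k where k: "card (Oge p) = p ^ k * card ?L"
    using Oge_section_prime assms by blast
  have "psub (X <#> ?L) (carrier G <#> ?L)"
    using assms(2) by (intro chain_setmult_normal) (auto simp: normalises_Oge)
  moreover have "carrier G <#> ?L = carrier G"
    by (meson order_antisym setmult_subset subgroup.subset subgroup_Oge subgroup_self subset_refl subset_setmult_left)
  ultimately have c: "psub (X <#> ?L) (carrier G)"
    by simp
  have "chain (X <#> ?L) {p} ((X <#> ?L) \<inter> Oge p) (carrier G \<inter> Oge p)"
    using psub_Int_section[OF c subgroup_Oge normalises_Oge subgroup_Oge _ Oge_mono k assms(5)] X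
    by (simp add: subset_setmult_right)
  moreover have "(X <#> ?L) \<inter> Oge p = ?L"
  proof
    show "?L \<subseteq> (X <#> ?L) \<inter> Oge p"
      using X by (simp add: subset_setmult_right Oge_mono)
    show "(X <#> ?L) \<inter> Oge p \<subseteq> ?L"
    proof
      fix y assume y: "y \<in> (X <#> ?L) \<inter> Oge p"
      then obtain x l where xl: "x \<in> X" "l \<in> ?L" "y = x \<otimes> l"
        by (auto simp: setmult_iff)
      then have "l \<in> Oge p" and G: "x \<in> carrier G" "l \<in> carrier G"
        using Oge_mono[of p "Suc p"] XG subgroup_carrier[OF subgroup_Oge] by auto
      then have "y \<otimes> inv l \<in> Oge p"
        using y subgroup.m_closed[OF subgroup_Oge _ subgroup.m_inv_closed[OF subgroup_Oge]] by blast
      then have "x \<in> X \<inter> Oge p"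
        using xl G by (simp add: m_assoc)
      moreover have "X \<inter> Oge p = {\<one>}"
      proof (rule pi_subgroups_Int[OF X subgroup_Oge])
        show "pi_number {q} (card X)"
          using assms by (simp add: pi_number_prime_power)
        show "pi_number {p..} (card (Oge p))"
          using pi_number_Opi[OF subgroup_self] .
      qed (use assms in auto)
      ultimately show "y \<in> ?L"
        using xl G by simp
    qed
  qed
  moreover have "carrier G \<inter> Oge p = Oge p"
    using subgroup.subset[OF subgroup_Oge] by blast
  ultimately have "chain (X <#> ?L) {p} ?L (Oge p)"
    by simp
  then show ?thesis
    by (rule chain_mono) (simp_all add: X subset_setmult_left)
qed

end

section \<open>Chains along the Sylow tower\<close>

context fin_group
begin

text \<open>Modulo the next term this is \<open>chain_commutator_centralises\<close>. To remove the
  modulus write c u c^-1 = u z with z in \<open>Oge (Suc n)\<close>. By induction c commutes with z,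
  so z has q-power order, while its order also divides that of \<open>Oge (Suc n)\<close>, which is
  prime to q.\<close>

lemma commutator_centralises_Oge:
  assumes d: dispersive and Q: "psub Q (carrier G)" "card Q = q ^ i" "prime q"
    and ab: "a \<in> Q" "b \<in> Q" and "q < n" "u \<in> Oge n"
  shows "comm a b \<otimes> u = u \<otimes> comm a b"
  using assms(7,8)
proof (induction "Suc (card (carrier G)) - n" arbitrary: n u)
  case 0
  then have "u = \<one>"
    using Oge_large[of n] by auto
  moreover have "subgroup Q G"
    using Q chainD by blast
  ultimately show ?case
    using ab by (simp add: subgroup_carrier)
next
  case (Suc l)
  have sQ: "subgroup Q G"
    using Q chainD by blast
  define c where "c = comm a b"
  have cQ: "c \<in> Q"
    unfolding c_def using sQ ab by (rule comm_in_subgroup)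
  have G: "c \<in> carrier G" "u \<in> carrier G"
    using cQ sQ Suc.prems subgroup_carrier subgroup_Oge by blast+
  have IH: "c \<otimes> v = v \<otimes> c" if "v \<in> Oge (Suc n)" for v
    using Suc.hyps(1)[of "Suc n" v] Suc.hyps(2) Suc.prems that by (simp add: c_def)
  show ?case
  proof (cases "prime n")
    case False
    then show ?thesis
      using IH Oge_section_nonprime d Suc.prems by (simp add: c_def)
  next
    case True
    have ch: "chain Q {n} (Oge (Suc n)) (Oge n)"
      using psub_chain_Oge d Q True Suc.prems by blast
    have cq: "c [^] (q ^ i) = \<one>"
      using pow_card_subgroup[OF sQ cQ] Q(2) by simp
    have "\<not> n dvd q ^ i"
      using True Q Suc.prems by (metis nat_neq_iff prime_dvd_power primes_dvd_imp_eq)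
    then have "comm c u \<in> Oge (Suc n)"
      using chain_commutator_centralises[OF ch sQ normalises_Oge ab c_def cq] Suc.prems by blast
    then have "inv u \<otimes> comm c u \<otimes> u \<in> Oge (Suc n)"
      using normalisesD_inv[OF subgroup_self normalises_Oge G(2)] by blast
    then obtain z where z: "z \<in> Oge (Suc n)" "z = inv u \<otimes> comm c u \<otimes> u"
      by blast
    then have zG: "z \<in> carrier G"
      using subgroup_carrier[OF subgroup_Oge] by blast
    have cu: "c \<otimes> u \<otimes> inv c = u \<otimes> z"
      using G by (simp add: z(2) comm_def word_simps)
    have "c [^] (q ^ i) \<otimes> u \<otimes> inv (c [^] (q ^ i)) = u \<otimes> z [^] (q ^ i)"
      using conj_pow_commuting[OF G zG cu IH[OF z(1)]] .
    then have 1: "z [^] (q ^ i) = \<one>"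
      using G zG by (simp add: cq)
    have 2: "z [^] card (Oge (Suc n)) = \<one>"
      using pow_card_subgroup[OF subgroup_Oge z(1)] .
    have "coprime (q ^ i) (card (Oge (Suc n)))"
    proof (rule pi_number_coprime)
      show "pi_number {q} (q ^ i)"
        using Q by (simp add: pi_number_prime_power)
      show "pi_number {Suc n..} (card (Oge (Suc n)))"
        using pi_number_Opi[OF subgroup_self] .
    qed (use Suc.prems in auto)
    then have "z = \<one>"
      using coprime_pow_eq_one[OF zG 1 2] by simp
    then have "c \<otimes> u \<otimes> inv c = u"
      using cu G by simp
    then show ?thesis
      using G by (metis c_def inv_solve_right m_closed)
  qed
qed

text \<open>Let Z be \<open>Oge (Suc q)\<close> and \<open>C\<close> its centraliser in
  \<open>Oge q\<close>. The index of Z \<inter> C in \<open>C\<close> is a power of q and Z \<inter>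
  C is central in \<open>C\<close>, so a Sylow q-subgroup \<open>S\<close> of \<open>C\<close> is a
  direct factor, hence normal, and lies in the q-core of \<open>G\<close>. The commutators of
  \<open>Q\<close> lie in Q \<inter> C, which is contained in \<open>S\<close>.\<close>

lemma sylow_commutator_in_Opi:
  assumes d: dispersive and Q: "is_sylow q Q (carrier G)" "psub Q (carrier G)" and ab: "a \<in> Q" "b \<in> Q"
  shows "comm a b \<in> Opi {q} (carrier G)"
proof -
  note Q' = sylowD[OF Q(1)]
  let ?Z = "Oge (Suc q)"
  define C where "C = {x \<in> Oge q. \<forall>u\<in>?Z. x \<otimes> u = u \<otimes> x}"
  have TG: "u \<in> Oge n \<Longrightarrow> u \<in> carrier G" for u n
    using subgroup_carrier[OF subgroup_Oge] by blast
  have CT: "C \<subseteq> Oge q"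
    by (auto simp: C_def)
  have C: "subgroup C G"
  proof (rule finite_group_subgroupI)
    show "C \<subseteq> carrier G"
      using TG by (auto simp: C_def)
    show "\<one> \<in> C"
      using TG by (auto simp: C_def subgroup.one_closed)
    fix x y assume "x \<in> C" "y \<in> C"
    then have xy: "x \<in> Oge q" "y \<in> Oge q" "\<And>u. u \<in> ?Z \<Longrightarrow> x \<otimes> u = u \<otimes> x" "\<And>u. u \<in> ?Z \<Longrightarrow> y \<otimes> u = u \<otimes> y"
      by (auto simp: C_def)
    have "x \<otimes> y \<otimes> u = u \<otimes> (x \<otimes> y)" if u: "u \<in> ?Z" for u
      using commute_mult[OF _ _ _ xy(3,4)[OF u]] xy(1,2) u TG by blast
    then show "x \<otimes> y \<in> C"
      using xy(1,2) by (simp add: C_def subgroup.m_closed)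
  qed
  have nC: "normalises (carrier G) C"
    unfolding normalises_def
  proof (intro ballI)
    fix g x assume g: "g \<in> carrier G" and x: "x \<in> C"
    have xT: "x \<in> Oge q" "\<And>u. u \<in> ?Z \<Longrightarrow> x \<otimes> u = u \<otimes> x"
      using x by (auto simp: C_def)
    have "g \<otimes> x \<otimes> inv g \<otimes> u = u \<otimes> (g \<otimes> x \<otimes> inv g)" if u: "u \<in> ?Z" for u
    proof -
      have G: "x \<in> carrier G" "u \<in> carrier G"
        using xT u TG by blast+
      have "g \<otimes> x \<otimes> inv g \<otimes> u = g \<otimes> (x \<otimes> (inv g \<otimes> u \<otimes> g)) \<otimes> inv g"
        using G g by (simp add: word_simps)
      also have "x \<otimes> (inv g \<otimes> u \<otimes> g) = (inv g \<otimes> u \<otimes> g) \<otimes> x"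
        using xT(2) normalisesD_inv[OF subgroup_self normalises_Oge g u] by blast
      also have "g \<otimes> ((inv g \<otimes> u \<otimes> g) \<otimes> x) \<otimes> inv g = u \<otimes> (g \<otimes> x \<otimes> inv g)"
        using G g by (simp add: word_simps)
      finally show ?thesis .
    qed
    then show "g \<otimes> x \<otimes> inv g \<in> C"
      using normalisesD[OF normalises_Oge g xT(1)] by (simp add: C_def)
  qed
  obtain S where S: "is_sylow q S C"
    using sylow_exists[OF Q'(1) C] by blast
  note S' = sylowD[OF S]
  obtain k where k: "card (Oge q) = q ^ k * card ?Z"
    using Oge_section_prime d Q'(1) by blast
  have nTC: "normalises (Oge q \<inter> C) ?Z"
    using normalises_Oge by (rule normalises_subset) (use TG in blast)
  obtain j where j: "card (Oge q \<inter> C) = q ^ j * card (?Z \<inter> C)"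
    using section_Int[OF subgroup_Oge subgroup_Oge C Oge_mono nTC k Q'(1)] by auto
  have cC: "card C = q ^ j * card (?Z \<inter> C)"
    using j CT by (simp add: Int_absorb1)
  have ZC: "subgroup (?Z \<inter> C) G"
    using C by (simp add: subgroup_Int)
  have "pi_number {Suc q..} (card (?Z \<inter> C))"
    using pi_number_dvd[OF pi_number_Opi[OF subgroup_self]] card_subgroup_dvd[OF ZC subgroup_Oge] by blast
  then have "\<not> q dvd card (?Z \<inter> C)"
    using Q'(1) by (auto simp: pi_number_def)
  then have "multiplicity q (card C) = j"
    unfolding cC using Q'(1) multiplicity_prime_power card_pos[OF ZC]
    by (simp add: prime_elem_multiplicity_mult_distrib not_dvd_imp_multiplicity_0)
  then have cS: "card S = q ^ j"
    using S'(4) by simp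
  have comS: "x \<otimes> z = z \<otimes> x" if "x \<in> C" "z \<in> ?Z" for x z
    using that by (simp add: C_def)
  have SZ: "normalises S (?Z \<inter> C)"
    using S' C normalises_Oge
    by (meson normalises_Int normalises_self normalises_subset subgroup.subset)
  have "card (S <#> (?Z \<inter> C)) * card (S \<inter> (?Z \<inter> C)) = card C"
    using card_setmult[OF S'(2) ZC] cS cC by simp
  moreover have "S \<inter> (?Z \<inter> C) = {\<one>}"
  proof (rule pi_subgroups_Int[OF S'(2) ZC])
    show "pi_number {q} (card S)"
      using cS Q' by (simp add: pi_number_prime_power)
  qed (fact, simp)
  ultimately have "card (S <#> (?Z \<inter> C)) = card C"
    by simp
  then have CSZ: "S <#> (?Z \<inter> C) = C"
    using S' C by (intro subgroup_eqI setmult_subset) auto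
  have "normalises (?Z \<inter> C) S"
    unfolding normalises_def
  proof (intro ballI)
    fix z s assume z: "z \<in> ?Z \<inter> C" and s: "s \<in> S"
    then have "z \<otimes> s = s \<otimes> z"
      using comS[of s z] S' by auto
    moreover have "z \<in> carrier G" "s \<in> carrier G"
      using z s S'(2) TG subgroup_carrier by blast+
    ultimately have "z \<otimes> s \<otimes> inv z = s"
      by (simp add: m_assoc)
    then show "z \<otimes> s \<otimes> inv z \<in> S"
      using s by simp
  qed
  then have "normalises (S <#> (?Z \<inter> C)) S"
    using S'(2) ZC by (intro normalises_by_setmult) (auto simp: normalises_self subgroup.subset dest: subgroup_carrier)
  then have nS: "normalises C S"
    by (simp add: CSZ)
  have "S \<subseteq> Opi {q} C"
    using S' nS cS by (intro Opi_max) (auto simp: pi_number_prime_power)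
  also have "\<dots> \<subseteq> Opi {q} (carrier G)"
    using C nC by (intro Opi_normal_subgroup) (auto simp: subgroup_self subgroup.subset dest: subgroup_carrier)
  finally have SO: "S \<subseteq> Opi {q} (carrier G)" .
  obtain m where m: "card (carrier G) = m * card ?Z" "pi_number {..<Suc q} m"
    using d by (auto simp: dispersive_def)
  have "Q \<subseteq> Oge q"
    by (rule psub_subset_Oge[OF Q(2) Q'(4,1) m])
  moreover have "comm a b \<in> Q"
    using comm_in_subgroup Q' ab by blast
  ultimately have "comm a b \<in> Q \<inter> C"
    using commutator_centralises_Oge[OF d Q(2) Q'(4,1) ab, of "Suc q"] by (auto simp: C_def)
  moreover have "Q \<inter> C \<subseteq> S"
  proof -
    have QC: "subgroup (Q \<inter> C) G"
      using Q' C subgroup_Int by blast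
    obtain i where i: "card (Q \<inter> C) = q ^ i"
      using prime_power_subgroup[OF QC Q'(2) _ Q'(4,1)] by blast
    obtain m where "card C = m * card S" "\<not> q dvd m"
      using sylow_index[OF S C] .
    then show ?thesis
      using prime_power_subset_normal[OF QC i Q'(1) S'(2) C _ S'(3) nS] by blast
  qed
  ultimately show ?thesis
    using SO by blast
qed

text \<open>The chain runs through the products \<open>Q <#> S n\<close>, starting from
  \<open>D\<close> at n = 0. Below q the group \<open>Q\<close> is absorbed by \<open>S n\<close>,
  and any chain of the section will do; at q nothing changes; above q the given chains are
  multiplied by \<open>Q\<close>. The series is left abstract because it will be the tower cut down
  to a subgroup in one place and the tower multiplied by a normal subgroup in another.\<close>

lemma psub_if_chains:
  assumes D: "subgroup D G" and Q: "is_sylow q Q D"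
    and S: "\<And>n. subgroup (S n) G" "\<And>n. normalises D (S n)" "S 0 = D"
    and mono: "\<And>n. S (Suc n) \<subseteq> S n"
    and pr: "\<And>n. prime n \<Longrightarrow> \<exists>k. card (S n) = n ^ k * card (S (Suc n))"
    and npr: "\<And>n. \<not> prime n \<Longrightarrow> S n = S (Suc n)"
    and ch: "\<And>p. prime p \<Longrightarrow> q < p \<Longrightarrow> chain Q {p} (S (Suc p)) (S p)"
  shows "psub (Q <#> S n) D"
proof -
  note Q' = sylowD[OF Q]
  have SD: "S n \<subseteq> D" for n
    by (induction n) (use S(3) mono in auto)
  have idx: "\<exists>m. card D = m * card (S n) \<and> pi_number {..<n} m" for n
  proof (induction n)
    case 0
    then show ?case
      using S(3) by (auto intro!: exI[of _ 1])
  next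
    case (Suc n)
    then obtain m where m: "card D = m * card (S n)" "pi_number {..<n} m"
      by blast
    then have m': "pi_number {..<Suc n} m"
      using pi_number_mono by fastforce
    show ?case
    proof (cases "prime n")
      case True
      then obtain k where "card (S n) = n ^ k * card (S (Suc n))"
        using pr by blast
      then have "card D = (m * n ^ k) * card (S (Suc n))"
        using m by simp
      then show ?thesis
        using m' True pi_number_mult pi_number_prime_power by blast
    next
      case False
      then show ?thesis
        using m m' npr by auto
    qed
  qed
  have QS: "subgroup (Q <#> S n) G" for n
    using subgroup_setmult[OF Q'(2) S(1)] normalises_subset[OF S(2) Q'(3)] by blast
  have QSD: "Q <#> S n \<subseteq> D" for n
    using D Q' SD by (intro setmult_subset) auto
  have QsubQS: "Q \<subseteq> Q <#> S n" for n
    using Q' S by (simp add: subset_setmult_left)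
  have absorb: "Q <#> S n = S n" if n: "n \<le> q" for n
  proof -
    obtain m where m: "card D = m * card (S n)" "pi_number {..<n} m"
      using idx by blast
    have "\<not> q dvd m"
      using m n Q' by (auto simp: pi_number_def)
    then have "Q \<subseteq> S n"
      using prime_power_subset_normal[OF Q'(2,4,1) S(1) D Q'(3) SD S(2) m(1)] by blast
    then show ?thesis
      using setmult_subset[OF S(1), of Q n "S n"] subset_setmult_right[OF Q'(2) S(1)] by blast
  qed
  have step: "psub (Q <#> S (Suc n)) (Q <#> S n)" for n
  proof (cases "prime n")
    case False
    then show ?thesis
      using npr QS by (auto intro!: chain.refl simp: normalises_def)
  next
    case n: True
    consider "q < n" | "n < q" | "n = q"
      by linarith
    then show ?thesis
    proof cases
      case 1
      then show ?thesis
        using psub_setmult_left[OF ch[OF n 1] Q'(2)] by blast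
    next
      case 2
      obtain k where k: "card (S n) = n ^ k * card (S (Suc n))"
        using pr n by blast
      have "chain {} {n} (S (Suc n)) (S n)"
        using section_chain[OF S(1) S(1) mono normalises_subset[OF S(2) SD] k n] .
      then show ?thesis
        using absorb[of n] absorb[of "Suc n"] 2 chain_psub by simp
    next
      \<comment> \<open>The index t is a power of q and divides |D : Q|, which is prime to
        q.\<close>
      case 3
      have sub: "Q <#> S (Suc n) \<subseteq> Q <#> S n"
        using mono by (intro setmult_mono) auto
      obtain t where t: "card (Q <#> S n) = card (Q <#> S (Suc n)) * t"
        using card_subgroup_dvd[OF QS QS sub] by blast
      obtain k where k: "card (S n) = n ^ k * card (S (Suc n))"
        using pr n by blast
      have pos: "card (Q <#> S (Suc n)) > 0"
        using card_pos QS by blast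
      have QI: "subgroup (Q \<inter> S l) G" for l
        using Q' S subgroup_Int by blast
      obtain i where i: "card (Q \<inter> S (Suc n)) = q ^ i"
        using prime_power_subgroup[OF QI Q'(2) _ Q'(4,1)] by blast
      have "card (Q <#> S n) * card (Q \<inter> S n) = n ^ k * (card (Q <#> S (Suc n)) * card (Q \<inter> S (Suc n)))"
        using card_setmult[OF Q'(2) S(1)] k by simp
      then have "card (Q <#> S (Suc n)) * (t * card (Q \<inter> S n)) = card (Q <#> S (Suc n)) * q ^ (k + i)"
        using t i 3 by (simp add: power_add ac_simps)
      then have "t * card (Q \<inter> S n) = q ^ (k + i)"
        using pos by simp
      then have "t dvd q ^ (k + i)"
        by (metis dvd_triv_left)
      then obtain l where l: "t = q ^ l"
        using dvd_prime_powerE Q'(1) by blast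
      obtain m where m: "card D = m * card Q" "\<not> q dvd m"
        using sylow_index[OF Q D] .
      obtain x where x: "card (Q <#> S (Suc n)) = card Q * x"
        using card_subgroup_dvd[OF Q'(2) QS QsubQS] by blast
      obtain y where y: "card D = card (Q <#> S n) * y"
        using card_subgroup_dvd[OF QS D QSD] by blast
      have "card Q * m = card Q * (x * t * y)"
        using m x y t by (auto simp: ac_simps)
      then have "m = x * t * y"
        using card_pos[OF Q'(2)] by simp
      then have "\<not> q dvd t"
        using m(2) by auto
      then have "t = 1"
        using l by (cases l) auto
      then have "Q <#> S (Suc n) = Q <#> S n"
        using t by (intro subgroup_eqI[OF QS sub]) simp
      then show ?thesis
        using QS by (auto intro!: chain.refl simp: normalises_def)
    qed
  qed
  show ?thesis
  proof (induction n)
    case 0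
    have "Q <#> S 0 = D"
      using QSD[of 0] subset_setmult_right[OF Q'(2) S(1), of 0] S(3) by blast
    then show ?case
      using D by (auto intro!: chain.refl simp: normalises_def)
  next
    case (Suc n)
    then show ?case
      using chain_trans step by blast
  qed
qed

end

section \<open>Structure of w-supersoluble groups\<close>

lemma multiplicity_pos:
  assumes "prime q" "q dvd n" "(n::nat) > 0"
  shows "multiplicity q n > 0"
  using assms power_dvd_iff_le_multiplicity[of n q 1] prime_gt_1_nat[of q] by auto

context fin_group
begin

lemma sylowI:
  assumes "prime q" "subgroup P G" "P \<subseteq> D" "card P = q ^ i" "card D = m * card P" "\<not> q dvd m"
  shows "is_sylow q P D"
proof -
  have "m \<noteq> 0"
    using assms(6) by (metis dvd_0_right)
  then have "multiplicity q (card D) = i"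
    using assms by (simp add: prime_elem_multiplicity_mult_distrib not_dvd_imp_multiplicity_0)
  then show ?thesis
    using assms by (simp add: is_sylow_def)
qed

text \<open>Uses the trivial factorisation Q = Q Q.\<close>

lemma wsup_dispersive:
  assumes "wsup (carrier G)"
  shows dispersive
proof (rule dispersive_if_sylow_factors)
  fix q :: nat assume "prime q"
  then obtain Q where Q: "is_sylow q Q (carrier G)"
    using sylow_exists subgroup_self by blast
  have "Q <#> Q = Q"
    using setmult_subset[of Q Q Q] subset_setmult_left[of Q Q] sylowD(2)[OF Q] by auto
  then show "\<exists>Q X Y. is_sylow q Q (carrier G) \<and> Q = X <#> Y \<and> X \<subseteq> Q \<and> Y \<subseteq> Q
      \<and> psub X (carrier G) \<and> psub Y (carrier G)"
    using Q assms unfolding wsup_def by (metis subset_refl)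
qed

lemma coprime_normal_commute:
  assumes "subgroup R G" "normalises (carrier G) R" "subgroup Y G" "normalises (carrier G) Y"
    and "R \<inter> Y = {\<one>}" "r \<in> R" "y \<in> Y"
  shows "r \<otimes> y = y \<otimes> r"
proof -
  have G: "r \<in> carrier G" "y \<in> carrier G"
    using assms subgroup_carrier by auto
  have "comm r y = r \<otimes> (y \<otimes> inv r \<otimes> inv y)"
    using G by (simp add: comm_def m_assoc)
  moreover have "y \<otimes> inv r \<otimes> inv y \<in> R"
    using normalisesD[OF assms(2) G(2) subgroup.m_inv_closed[OF assms(1,6)]] .
  ultimately have "comm r y \<in> R"
    using assms by (simp add: subgroup.m_closed)
  moreover have "comm r y = (r \<otimes> y \<otimes> inv r) \<otimes> inv y"
    by (simp add: comm_def)
  then have "comm r y \<in> Y"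
    using normalisesD[OF assms(4) G(1) assms(7)] assms
    by (simp add: subgroup.m_closed subgroup.m_inv_closed)
  ultimately have "comm r y = \<one>"
    using assms by blast
  then have "(r \<otimes> y) \<otimes> inv (y \<otimes> r) = \<one>"
    using G by (simp add: comm_def word_simps)
  then show ?thesis
    using G by (metis inv_inv inv_equality inv_closed m_closed)
qed

abbreviation Oq :: "nat \<Rightarrow> 'a set" where
  "Oq q \<equiv> Opi {q} (carrier G)"

abbreviation Oq' :: "nat \<Rightarrow> 'a set" where
  "Oq' q \<equiv> Opi (- {q}) (carrier G)"

lemma Oq_props [simp]:
  "subgroup (Opi \<pi> (carrier G)) G" "normalises (carrier G) (Opi \<pi> (carrier G))"
  "pi_number \<pi> (card (Opi \<pi> (carrier G)))"
  by (simp_all add: subgroup_self normalises_Opi pi_number_Opi)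

lemma Oq_Int: "Oq q \<inter> Oq' q = {\<one>}"
  by (rule pi_subgroups_Int[of _ _ "{q}" "- {q}"]) simp_all

text \<open>Write x = r y with commuting factors. Then y^(q^k) is inverse to r^(q^k), so it lies in
  both cores and is 1; since y has order prime to q, y = 1.\<close>

lemma q_element_in_Oq:
  assumes q: "prime q" and x: "x \<in> Oq q <#> Oq' q" "x [^] (q ^ k) = \<one>"
  shows "x \<in> Oq q"
proof -
  obtain r y where ry: "r \<in> Oq q" "y \<in> Oq' q" "x = r \<otimes> y"
    using x by (auto simp: setmult_iff)
  have G: "r \<in> carrier G" "y \<in> carrier G"
    using ry Oq_props(1) subgroup_carrier by blast+
  have "r \<otimes> y = y \<otimes> r"
    using coprime_normal_commute[OF _ _ _ _ Oq_Int ry(1,2)] by simp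
  then have e: "r [^] (q ^ k) \<otimes> y [^] (q ^ k) = \<one>"
    using x ry G pow_mult_distrib[of r y "q ^ k"] by simp
  have "y [^] (q ^ k) = inv (r [^] (q ^ k))"
    using e G by (metis inv_equality inv_comm nat_pow_closed)
  also have "\<dots> \<in> Oq q"
    using ry by (simp add: pow_in_subgroup subgroup.m_inv_closed)
  finally have "y [^] (q ^ k) = \<one>"
    using Oq_Int pow_in_subgroup[OF Oq_props(1) ry(2)] by blast
  moreover have "y [^] card (Oq' q) = \<one>"
    using pow_card_subgroup ry by simp
  moreover have "coprime (q ^ k) (card (Oq' q))"
    by (rule pi_number_coprime[of "{q}" _ "- {q}"]) (simp_all add: q pi_number_prime_power)
  ultimately have "y = \<one>"
    using coprime_pow_eq_one G by blast
  then show ?thesis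
    using ry G by simp
qed

lemma normal_Oq_product:
  assumes "subgroup D G" "normalises (carrier G) D"
  shows "subgroup (D <#> Oq' q) G" "normalises (carrier G) (D <#> Oq' q)"
proof -
  have "normalises D (Oq' q)"
    by (rule normalises_subset[OF Oq_props(2) subgroup.subset[OF assms(1)]])
  then show "subgroup (D <#> Oq' q) G" "normalises (carrier G) (D <#> Oq' q)"
    using assms by (simp_all add: subgroup_setmult normalises_setmult)
qed

lemma commutators_in_Oq_product:
  assumes "wsup (carrier G)" "is_sylow r Q (carrier G)" "a \<in> Q" "b \<in> Q"
  shows "comm a b \<in> Oq q <#> Oq' q" "r \<noteq> q \<Longrightarrow> comm a b \<in> Oq' q"
proof -
  have c: "comm a b \<in> Oq r"
    using sylow_commutator_in_Opi wsup_dispersive assms unfolding wsup_def by blast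
  show "comm a b \<in> Oq' q" if "r \<noteq> q"
    using c Opi_mono[OF subgroup_self, of "{r}" "- {q}"] that by blast
  then show "comm a b \<in> Oq q <#> Oq' q"
    using c subset_setmult_left[OF Oq_props(1) Oq_props(1)] subset_setmult_right[OF Oq_props(1) Oq_props(1)]
    by (cases "r = q") blast+
qed

text \<open>\<open>M\<close> is the Fitting subgroup. As an intersection it can be tested one prime
  at a time: a q-element of \<open>M\<close> is in \<open>Oq q\<close>, and cores for different
  primes commute elementwise. A commutator in the r-core passes each test, since that core is part
  of \<open>Oq' q\<close> for every q other than r.\<close>

lemma wsup_nilp_cover:
  assumes w: "wsup (carrier G)"
  shows "\<exists>M. subgroup M G \<and> normalises (carrier G) M \<and> nilp_mod {\<one>} M \<and>
    (\<forall>q Q. is_sylow q Q (carrier G) \<longrightarrow> (\<forall>a\<in>Q. \<forall>b\<in>Q. comm a b \<in> M))"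
proof -
  \<comment> \<open>For q not prime the condition is vacuous, because \<open>Oq' q\<close> is then
    the whole group.\<close>
  define M where "M = {x \<in> carrier G. \<forall>q. x \<in> Oq q <#> Oq' q}"
  have P: "subgroup (Oq q <#> Oq' q) G" "normalises (carrier G) (Oq q <#> Oq' q)" for q
    using normal_Oq_product by simp_all
  have "subgroup M G"
    by (rule finite_group_subgroupI)
      (auto simp: M_def intro: subgroup.m_closed[OF P(1)] subgroup.one_closed[OF P(1)])
  moreover have "normalises (carrier G) M"
    using P(2) by (auto simp: M_def normalises_def)
  moreover have "nilp_mod {\<one>} M"
    unfolding nilp_mod_def
  proof (intro allI impI)
    fix p q :: nat and x y and k l :: nat
    assume pq: "prime p" "prime q" "p \<noteq> q" and xy: "x \<in> M" "y \<in> M"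
      and e: "x [^] (p ^ k) \<in> {\<one>}" "y [^] (q ^ l) \<in> {\<one>}"
    have xp: "x \<in> Oq p"
      using q_element_in_Oq[of p x k] pq xy e by (simp add: M_def)
    have yq: "y \<in> Oq q"
      using q_element_in_Oq[of q y l] pq xy e by (simp add: M_def)
    have "Oq p \<inter> Oq q = {\<one>}"
      by (rule pi_subgroups_Int[of _ _ "{p}" "{q}"]) (use pq in simp_all)
    then have "x \<otimes> y = y \<otimes> x"
      by (rule coprime_normal_commute[OF Oq_props(1,2) Oq_props(1,2) _ xp yq])
    then show "comm x y \<in> {\<one>}"
      using xy by (simp add: comm_def M_def m_assoc flip: inv_mult_group)
  qed
  moreover have "\<forall>q Q. is_sylow q Q (carrier G) \<longrightarrow> (\<forall>a\<in>Q. \<forall>b\<in>Q. comm a b \<in> M)"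
  proof (intro allI impI ballI)
    fix q Q a b assume Q: "is_sylow q Q (carrier G)" "a \<in> Q" "b \<in> Q"
    then have "comm a b \<in> carrier G"
      using subgroup_carrier[OF sylowD(2)[OF Q(1)]] by (intro comm_closed)
    then show "comm a b \<in> M"
      using commutators_in_Oq_product(1)[OF w Q] by (simp add: M_def)
  qed
  ultimately show ?thesis
    by blast
qed

text \<open>A nontrivial p-group has a normal subgroup of index p; its quotient is cyclic, so it
  contains all commutators.\<close>

lemma p_group_derived_proper:
  assumes P: "subgroup P G" "card P = p ^ k" "prime p" and "derived G P = P"
  shows "P = {\<one>}"
proof (rule ccontr)
  assume ne: "P \<noteq> {\<one>}"
  have one: "{\<one>} \<subseteq> P" "normalises P {\<one>}"
    using P by (simp_all add: subgroup.one_closed subgroup.subset normalises_one)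
  have "chain {} {p} {\<one>} P"
    by (rule section_chain[OF triv_subgroup P(1) one]) (use P in simp_all)
  then obtain K where K: "chain {} {p} {\<one>} K" "K \<subseteq> P" "card P = p * card K"
    using ne by (cases rule: chain.cases) auto
  have sK: "subgroup K G" "{\<one>} \<subseteq> K"
    using chainD[OF K(1)] by auto
  obtain j where "card K = p ^ j * card {\<one>}"
    using chain_p_card[OF K(1)] by blast
  then have nK: "normalises P K"
    using index_p_normalises[OF sK(1) P(1) triv_subgroup K(2) sK(2) one(2) P(3) K(3)] by blast
  obtain V :: "'a set monoid" and f where "factor_map G V P K f"
    using factor_mapE[OF P(1) sK(1) K(2) nK] .
  then interpret F: factor_map G V P K f .
  have "K \<noteq> P"
    using K(3) P(3) card_pos[OF P(1)] by auto
  then obtain v where v: "v \<in> P" "v \<notin> K"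
    using K(2) by blast
  have "comm a b \<in> K" if ab: "a \<in> P" "b \<in> P" for a b
  proof -
    obtain i j :: nat where "f a = f v [^]\<^bsub>V\<^esub> i" "f b = f v [^]\<^bsub>V\<^esub> j"
      using F.prime_index_cyclic[OF K(3) P(3) v] ab by meson
    then show ?thesis
      using F.comm_iff[OF ab] v by (simp add: F.Q.nat_pow_mult add.commute)
  qed
  then have "derived_set G P \<subseteq> K"
    by (auto simp: comm_def)
  then have "derived G P \<subseteq> K"
    unfolding derived_def using generate_subgroup_incl sK(1) by blast
  then show False
    using assms(4) K(2) \<open>K \<noteq> P\<close> by blast
qed

text \<open>Suppose q does not divide the index of \<open>R\<close>. Any normal \<open>D\<close>
  inside the q-core with R \<subseteq> D \<open>Oq' q\<close> is then a Sylow q-subgroup. This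
  applies to the q-core, and once that is the only Sylow q-subgroup it applies to its derived
  subgroup too. A q-group equal to its derived subgroup is trivial, against the choice of q.\<close>

lemma wsup_prime_divides_index:
  assumes w: "wsup (carrier G)" and q: "prime q" "q dvd card (carrier G)"
    and R: "subgroup R G" "card (carrier G) = m * card R"
    and least: "\<And>X. subgroup X G \<Longrightarrow> normalises (carrier G) X \<Longrightarrow>
      (\<And>r Q a b. is_sylow r Q (carrier G) \<Longrightarrow> a \<in> Q \<Longrightarrow> b \<in> Q \<Longrightarrow> comm a b \<in> X) \<Longrightarrow> R \<subseteq> X"
  shows "q dvd m"
proof (rule ccontr)
  assume nq: "\<not> q dvd m"
  have full: "is_sylow q D (carrier G)"
    if D: "subgroup D G" "normalises (carrier G) D" "D \<subseteq> Oq q" "R \<subseteq> D <#> Oq' q" for D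
  proof -
    note X = normal_Oq_product[OF D(1,2), of q]
    obtain s where s: "card (carrier G) = card (D <#> Oq' q) * s"
      using card_subgroup_dvd[OF X(1) subgroup_self subgroup.subset[OF X(1)]] by blast
    obtain t where t: "card (D <#> Oq' q) = card R * t"
      using card_subgroup_dvd[OF R(1) X(1) D(4)] by blast
    have "m = t * s"
      using s t R(2) card_pos[OF R(1)] by simp
    then have qs: "\<not> q dvd s"
      using nq by (auto intro: dvd_mult)
    have pD: "pi_number {q} (card D)"
      using pi_number_dvd Oq_props(3) card_subgroup_dvd[OF D(1) Oq_props(1) D(3)] by blast
    then obtain i where i: "card D = q ^ i"
      using pi_number_singleton q(1) card_pos[OF D(1)] by blast
    have "D \<inter> Oq' q = {\<one>}"
      using pD D by (intro pi_subgroups_Int[of _ _ "{q}" "- {q}"]) simp_all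
    then have "card (D <#> Oq' q) = card D * card (Oq' q)"
      using card_setmult[OF D(1) Oq_props(1), of "- {q}"] by simp
    then have "card (carrier G) = (card (Oq' q) * s) * card D"
      using s by simp
    moreover have "\<not> q dvd card (Oq' q)"
      using Oq_props(3)[of "- {q}"] q(1) by (auto simp: pi_number_def)
    then have "\<not> q dvd card (Oq' q) * s"
      using qs q(1) by (simp add: prime_dvd_mult_iff)
    ultimately show ?thesis
      using sylowI[OF q(1) D(1) subgroup.subset[OF D(1)] i] by blast
  qed
  let ?O = "Oq q"
  have "R \<subseteq> ?O <#> Oq' q"
    using normal_Oq_product commutators_in_Oq_product(1)[OF w] by (intro least) auto
  then have O: "is_sylow q ?O (carrier G)"
    by (intro full) auto
  have OQ: "Q = ?O" if Q: "is_sylow q Q (carrier G)" for Q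
  proof -
    obtain d where d: "d \<in> carrier G" "Q = conj_set d ?O"
      using sylow_conjugate[OF O Q subgroup_self] by blast
    then have "Q \<subseteq> ?O"
      using Oq_props(2)[of "{q}"] by (auto simp: normalises_def)
    then show ?thesis
      using sylowD(4)[OF O] sylowD(4)[OF Q] by (intro subgroup_eqI) auto
  qed
  define D where "D = derived G ?O"
  have OG: "?O \<subseteq> carrier G"
    by (simp add: subgroup.subset)
  have D: "subgroup D G" "D \<subseteq> ?O"
    unfolding D_def using derived_is_subgroup[OF OG] derived_incl[OF subset_refl Oq_props(1)] by auto
  have "?O \<lhd> G"
    by (simp add: normal_iff_normalises)
  then have nD: "normalises (carrier G) D"
    unfolding D_def using derived_is_normal normal_iff_normalises by blast
  have cD: "comm a b \<in> D" if "a \<in> ?O" "b \<in> ?O" for a b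
  proof -
    have "comm a b \<in> derived_set G ?O"
      using that by (auto simp: comm_def)
    then show ?thesis
      unfolding D_def derived_def by (rule generate.incl)
  qed
  \<comment> \<open>Sylow q-subgroups coincide with the q-core, so their commutators are in
    \<open>D\<close>; those of the other Sylow subgroups are in \<open>Oq' q\<close>.\<close>
  have "R \<subseteq> D <#> Oq' q"
  proof (rule least)
    fix r Q a b assume Q: "is_sylow r Q (carrier G)" "a \<in> Q" "b \<in> Q"
    show "comm a b \<in> D <#> Oq' q"
    proof (cases "r = q")
      case True
      then have "comm a b \<in> D"
        using Q OQ cD by blast
      then show ?thesis
        using subset_setmult_left[OF D(1) Oq_props(1)] by blast
    next
      case False
      then have "comm a b \<in> Oq' q"
        using commutators_in_Oq_product(2)[OF w Q] by blast
      then show ?thesis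
        using subset_setmult_right[OF D(1) Oq_props(1)] by blast
    qed
  qed (use normal_Oq_product[OF D(1) nD] in auto)
  then have "D = ?O"
    using OQ full D nD by blast
  then have "?O = {\<one>}"
    using p_group_derived_proper[OF Oq_props(1) sylowD(4)[OF O] q(1)] by (simp add: D_def)
  then have "q ^ multiplicity q (card (carrier G)) = Suc 0"
    using sylowD(4)[OF O] by simp
  then have "multiplicity q (card (carrier G)) = 0"
    using nat_power_eq_Suc_0_iff prime_gt_1_nat[OF q(1)] by (metis One_nat_def less_irrefl)
  then show False
    using multiplicity_pos[OF q card_pos[OF subgroup_self]] by simp
qed

end

section \<open>Sylow subgroups, chains and nilpotency under factor maps\<close>

context factor_map
begin

lemma sylow_image:
  assumes P: "is_sylow q P S"
  shows "Q.is_sylow q (\<phi> ` P) (carrier Q)"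
proof -
  note P' = sylowD[OF P]
  have I: "subgroup (\<phi> ` P) Q"
    using subgroup_image P' by blast
  have "card (\<phi> ` P) dvd q ^ multiplicity q (card S)"
    using card_image_subgroup[OF P'(2,3)] P'(4) by (metis dvd_triv_left)
  then obtain i where i: "card (\<phi> ` P) = q ^ i"
    using dvd_prime_powerE P'(1) by blast
  obtain s where s: "card (carrier Q) = s * card (\<phi> ` P)"
    using Q.card_subgroup_dvd[OF I Q.subgroup_self subgroup.subset[OF I]] by (metis dvdE mult.commute)
  note W = preimage[OF I]
  have "P \<subseteq> {x \<in> S. \<phi> x \<in> \<phi> ` P}"
    using P' by blast
  then obtain x where x: "card {x \<in> S. \<phi> x \<in> \<phi> ` P} = card P * x"
    using card_subgroup_dvd[OF P'(2) W(1)] by blast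
  obtain m where m: "card S = m * card P" "\<not> q dvd m"
    using sylow_index[OF P S] .
  have "card S = s * (card P * x)"
    using card_quotient s W(5) x by (simp add: ac_simps)
  then have "m = s * x"
    using m(1) card_pos[OF P'(2)] by (simp add: ac_simps)
  then have "\<not> q dvd s"
    using m(2) by auto
  then show ?thesis
    using Q.sylowI[OF P'(1) I subgroup.subset[OF I] i s] by blast
qed

text \<open>\<open>R\<close> is a Sylow q-subgroup of the preimage of \<open>P\<close>. Its index in
  \<open>S\<close> is the product of two numbers prime to q, the index in the preimage and that of
  \<open>P\<close> in \<open>Q\<close>.\<close>

lemma sylow_lift:
  assumes P: "Q.is_sylow q P (carrier Q)"
  shows "\<exists>R. is_sylow q R S \<and> \<phi> ` R = P"
proof -
  note P' = Q.sylowD[OF P]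
  note W = preimage[OF P'(2)]
  let ?W = "{x \<in> S. \<phi> x \<in> P}"
  obtain R where R: "is_sylow q R ?W"
    using sylow_exists P'(1) W(1) by blast
  note R' = sylowD[OF R]
  obtain w where w: "card ?W = w * card R" "\<not> q dvd w"
    using sylow_index[OF R W(1)] .
  obtain u where u: "card (carrier Q) = u * card P" "\<not> q dvd u"
    using Q.sylow_index[OF P Q.subgroup_self] .
  have "card S = (u * card P) * card L"
    using card_quotient u by simp
  also have "\<dots> = u * card ?W"
    using W(5) by simp
  also have "\<dots> = (u * w) * card R"
    using w(1) by simp
  finally have "is_sylow q R S"
    using sylowI[OF P'(1) R'(2) _ R'(4), of S "u * w"] R'(3) w(2) u(2) P'(1)
    by (auto simp: prime_dvd_mult_iff)
  moreover have "\<phi> ` R = P"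
    using sylow_image[OF calculation] P' R'(3) Q.sylowD(4)
    by (intro Q.subgroup_eqI) auto
  ultimately show ?thesis
    by blast
qed

lemma psub_image:
  assumes "psub H K" "L \<subseteq> H" "K \<subseteq> S"
  shows "Q.psub (\<phi> ` H) (\<phi> ` K)"
  using assms
proof (induction rule: chain.induct)
  case (refl H)
  then show ?case
    by (auto intro!: Q.chain.refl subgroup_image simp: Q.normalises_def)
next
  case (step H K M r)
  have K: "subgroup K G" "H \<subseteq> K"
    using chainD[OF step.hyps(1)] by auto
  have KS: "K \<subseteq> S"
    using step by blast
  have "K \<inter> L = L" "M \<inter> L = L"
    using K step by blast+
  then have "card (\<phi> ` M) * card L = (r * card (\<phi> ` K)) * card L"
    using card_image_subgroup[OF K(1) KS] card_image_subgroup[OF step.hyps(2) step.prems(2)] step.hyps(5)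
    by simp
  then have c: "card (\<phi> ` M) = r * card (\<phi> ` K)"
    using card_pos[OF L] by simp
  have "Q.psub (\<phi> ` H) (\<phi> ` K)"
    using step KS by blast
  then show ?case
    using Q.chain.step[OF _ subgroup_image[OF step.hyps(2) step.prems(2)] _ image_mono[OF step.hyps(4)] c
        step.hyps(6)] by (simp add: Q.normalises_def)
qed

lemma nilp_mod_iff: "nilp_mod L S \<longleftrightarrow> Q.nilp_mod {\<one>\<^bsub>Q\<^esub>} (carrier Q)"
proof -
  have p: "x [^] n \<in> L \<longleftrightarrow> \<phi> x [^]\<^bsub>Q\<^esub> n \<in> {\<one>\<^bsub>Q\<^esub>}" if "x \<in> S" for x and n :: nat
    using ker[of "x [^] n"] that by (simp add: map_pow)
  have c: "comm x y \<in> L \<longleftrightarrow> Q.comm (\<phi> x) (\<phi> y) \<in> {\<one>\<^bsub>Q\<^esub>}" if "x \<in> S" "y \<in> S" for x y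
    using ker[of "comm x y"] that comm_in_subgroup[OF S that]
    by (simp add: comm_def Q.comm_def hom map_inv)
  show ?thesis
  proof
    assume nil: "nilp_mod L S"
    show "Q.nilp_mod {\<one>\<^bsub>Q\<^esub>} (carrier Q)"
      unfolding Q.nilp_mod_def
    proof (intro allI impI)
      fix r q :: nat and u v and k l :: nat
      assume rq: "prime r" "prime q" "r \<noteq> q" and uv: "u \<in> carrier Q" "v \<in> carrier Q"
        and e: "u [^]\<^bsub>Q\<^esub> (r ^ k) \<in> {\<one>\<^bsub>Q\<^esub>}" "v [^]\<^bsub>Q\<^esub> (q ^ l) \<in> {\<one>\<^bsub>Q\<^esub>}"
      obtain x where x: "x \<in> S" "u = \<phi> x"
        using uv(1) unfolding onto[symmetric] by blast
      obtain y where y: "y \<in> S" "v = \<phi> y"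
        using uv(2) unfolding onto[symmetric] by blast
      have "x [^] (r ^ k) \<in> L" "y [^] (q ^ l) \<in> L"
        using e p[OF x(1)] p[OF y(1)] unfolding x(2) y(2) by blast+
      then have "comm x y \<in> L"
        using nilp_modD[OF nil rq x(1) y(1)] by blast
      then show "Q.comm u v \<in> {\<one>\<^bsub>Q\<^esub>}"
        using c[OF x(1) y(1)] unfolding x(2) y(2) by blast
    qed
  next
    assume nil: "Q.nilp_mod {\<one>\<^bsub>Q\<^esub>} (carrier Q)"
    show "nilp_mod L S"
      unfolding nilp_mod_def
    proof (intro allI impI)
      fix r q :: nat and x y and k l :: nat
      assume rq: "prime r" "prime q" "r \<noteq> q" and xy: "x \<in> S" "y \<in> S"
        and e: "x [^] (r ^ k) \<in> L" "y [^] (q ^ l) \<in> L"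
      show "comm x y \<in> L"
        unfolding c[OF xy]
        by (rule Q.nilp_modD[OF nil rq closed[OF xy(1)] closed[OF xy(2)]])
          (use e in \<open>simp_all only: p[OF xy(1)] p[OF xy(2)]\<close>)
    qed
  qed
qed

end

context fin_group
begin

text \<open>Elements of prime power order modulo \<open>L\<close> are replaced by powers with the
  same image whose order in \<open>G\<close> itself is a prime power; to these the hypothesis
  applies.\<close>

lemma nilp_mod_quotient:
  assumes nil: "nilp_mod {\<one>} K" and K: "subgroup K G" and L: "subgroup L G" "L \<subseteq> K" "normalises K L"
  shows "nilp_mod L K"
  unfolding nilp_mod_def
proof (intro allI impI)
  fix p q :: nat and x y and k l :: nat
  assume pq: "prime p" "prime q" "p \<noteq> q" and xy: "x \<in> K" "y \<in> K" and e: "x [^] (p ^ k) \<in> L" "y [^] (q ^ l) \<in> L"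
  obtain V :: "'a set monoid" and f where "factor_map G V K L f"
    using factor_mapE[OF K L] .
  then interpret F: factor_map G V K L f .
  have G: "x \<in> carrier G" "y \<in> carrier G"
    using xy by auto
  obtain s a :: nat where s: "inv x \<otimes> x [^] s \<in> L" "(x [^] s) [^] (p ^ a) = \<one>"
    using pi_element_lift[OF G(1) L(1) pq(1) e(1)] .
  obtain t b :: nat where t: "inv y \<otimes> y [^] t \<in> L" "(y [^] t) [^] (q ^ b) = \<one>"
    using pi_element_lift[OF G(2) L(1) pq(2) e(2)] .
  have "comm (x [^] s) (y [^] t) \<in> {\<one>}"
    using nilp_modD[OF nil pq] xy s t by simp
  then have "comm (x [^] s) (y [^] t) \<in> L"
    using subgroup.one_closed[OF L(1)] by simp
  then have "f (x [^] s) \<otimes>\<^bsub>V\<^esub> f (y [^] t) = f (y [^] t) \<otimes>\<^bsub>V\<^esub> f (x [^] s)"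
    using F.comm_iff xy by simp
  moreover have "f (x [^] s) = f x" "f (y [^] t) = f y"
    using F.map_eq_iff xy s t by (metis F.S_closed(5))+
  ultimately show "comm x y \<in> L"
    using F.comm_iff xy by simp
qed

text \<open>Take z central in a Sylow p-subgroup. Sylow subgroups for other primes commute with z by
  hypothesis, so no prime divides the index of the centraliser of z.\<close>

lemma nilp_centre:
  assumes nil: "nilp_mod {\<one>} (carrier G)" and ne: "carrier G \<noteq> {\<one>}"
  shows "\<exists>z\<in>carrier G. z \<noteq> \<one> \<and> (\<forall>x\<in>carrier G. x \<otimes> z = z \<otimes> x)"
proof -
  have "card (carrier G) \<noteq> 1"
    using ne subgroup_eqI[OF subgroup_self, of "{\<one>}"] by auto
  then obtain p where p: "prime p" "p dvd card (carrier G)"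
    using prime_factor_nat by blast
  obtain P where P: "is_sylow p P (carrier G)"
    using sylow_exists[OF p(1) subgroup_self] by blast
  note P' = sylowD[OF P]
  have pos: "multiplicity p (card (carrier G)) > 0"
    by (rule multiplicity_pos[OF p card_pos[OF subgroup_self]])
  interpret P: group "G\<lparr>carrier := P\<rparr>"
    using P'(2) subgroup_imp_group by blast
  interpret P: fin_group "G\<lparr>carrier := P\<rparr>"
    by unfold_locales (simp add: finite_subgroup[OF P'(2)])
  obtain z where z: "z \<in> P" "z \<noteq> \<one>" "\<And>x. x \<in> P \<Longrightarrow> x \<otimes> z = z \<otimes> x"
    using P.p_group_centre[of p "multiplicity p (card (carrier G))"] P' pos by auto
  have zG: "z \<in> carrier G"
    using z P' by blast
  define C where "C = {x \<in> carrier G. x \<otimes> z = z \<otimes> x}"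
  have C: "subgroup C G"
  proof (rule finite_group_subgroupI)
    fix x y assume "x \<in> C" "y \<in> C"
    then have xy: "x \<in> carrier G" "y \<in> carrier G" "x \<otimes> z = z \<otimes> x" "y \<otimes> z = z \<otimes> y"
      by (auto simp: C_def)
    show "x \<otimes> y \<in> C"
      using commute_mult[OF xy(1,2) zG xy(3,4)] xy(1,2) by (simp add: C_def)
  qed (use zG in \<open>auto simp: C_def\<close>)
  obtain m where m: "card (carrier G) = card C * m"
    using card_subgroup_dvd[OF C subgroup_self subgroup.subset[OF C]] by blast
  have "m = 1"
  proof (rule ccontr)
    assume "m \<noteq> 1"
    then obtain r where r: "prime r" "r dvd m"
      using prime_factor_nat by blast
    \<comment> \<open>For r = p the choice has to be \<open>P\<close>, the Sylow p-subgroup in which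
      z is known to be central.\<close>
    obtain R where R: "is_sylow r R (carrier G)" "r = p \<longrightarrow> R = P"
      using sylow_exists[OF r(1) subgroup_self] P by (cases "r = p") blast+
    note R' = sylowD[OF R(1)]
    have "R \<subseteq> C"
    proof (cases "r = p")
      case True
      then show ?thesis
        using R(2) P' z(3) by (auto simp: C_def)
    next
      case False
      show ?thesis
      proof
        fix x assume x: "x \<in> R"
        then have xG: "x \<in> carrier G"
          using R' by blast
        have "x [^] (r ^ multiplicity r (card (carrier G))) = \<one>"
          using pow_card_subgroup[OF R'(2) x] R'(4) by simp
        moreover have "z [^] (p ^ multiplicity p (card (carrier G))) = \<one>"
          using pow_card_subgroup[OF P'(2) z(1)] P'(4) by simp
        ultimately have "comm x z \<in> {\<one>}"
          using nilp_modD[OF nil r(1) p(1) False xG zG] by simp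
        then have "(x \<otimes> z) \<otimes> inv (z \<otimes> x) = \<one>"
          using xG zG by (simp add: comm_def word_simps)
        then have "x \<otimes> z = z \<otimes> x"
          using xG zG by (metis inv_inv inv_equality inv_closed m_closed)
        then show "x \<in> C"
          using xG by (simp add: C_def)
      qed
    qed
    then obtain s where s: "card C = card R * s"
      using card_subgroup_dvd[OF R'(2) C] by blast
    obtain u where u: "card (carrier G) = u * card R" "\<not> r dvd u"
      using sylow_index[OF R(1) subgroup_self] .
    have "u = s * m"
      using u m s card_pos[OF R'(2)] by simp
    then show False
      using u r by simp
  qed
  then have "C = carrier G"
    using m subgroup.subset[OF C] by (intro subgroup_eqI[OF subgroup_self]) auto
  then show ?thesis
    using z zG by (auto simp: C_def)
qed

end

section \<open>Nilpotency, subnormality and Sylow subgroups in terms of the definitions\<close>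

context fin_group
begin

lemma fin_group_subgroup: "subgroup H G \<Longrightarrow> fin_group (G\<lparr>carrier := H\<rparr>)"
  using subgroup_imp_group[of H] finite_subgroup[of H]
  by (simp add: fin_group_def fin_group_axioms_def)

text \<open>The commutator z of x and y descends through the central series. It is central modulo
  \<open>K i\<close>, so conjugating y by powers of x gives z^(p^k) = 1 there, and conjugating x by
  powers of y gives z^(q^l) = 1; hence z is in \<open>K i\<close>.\<close>

lemma nilpotent_imp_nilp:
  assumes "nilpotent G"
  shows "nilp_mod {\<one>} (carrier G)"
  unfolding nilp_mod_def
proof (intro allI impI)
  fix p q :: nat and x y and k l :: nat
  assume pq: "prime p" "prime q" "p \<noteq> q" and xy: "x \<in> carrier G" "y \<in> carrier G"
    and e: "x [^] (p ^ k) \<in> {\<one>}" "y [^] (q ^ l) \<in> {\<one>}"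
  obtain n :: nat and K where K: "K 0 = {\<one>} \<and> K n = carrier G \<and> (\<forall>i\<le>n. K i \<lhd> G) \<and>
      (\<forall>i<n. K i \<subseteq> K (Suc i) \<and> (\<forall>x\<in>K (Suc i). \<forall>g\<in>carrier G. inv x \<otimes> inv g \<otimes> x \<otimes> g \<in> K i))"
    using assms unfolding nilpotent_def by (elim conjE exE) (rule that, intro conjI, assumption+)
  have c: "inv x \<otimes> inv g \<otimes> x \<otimes> g \<in> K i" if "i < n" "x \<in> K (Suc i)" "g \<in> carrier G" for i x g
    using K that by blast
  have step: "comm x y \<in> K i" if i: "i < n" and z: "comm x y \<in> K (Suc i)" for i
  proof -
    have N: "subgroup (K i) G" "normalises (carrier G) (K i)"
      using K i by (simp_all add: normal_iff_normalises)
    obtain V :: "'a set monoid" and f where "factor_map G V (carrier G) (K i) f"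
      using factor_mapE[OF subgroup_self N(1) subgroup.subset[OF N(1)] N(2)] .
    then interpret F: factor_map G V "carrier G" "K i" f .
    define z where "z = comm x y"
    have zG: "z \<in> carrier G"
      using xy by (simp add: z_def)
    have fz: "f z \<otimes>\<^bsub>V\<^esub> f g = f g \<otimes>\<^bsub>V\<^esub> f z" if g: "g \<in> carrier G" for g
    proof -
      have "inv z \<otimes> inv g \<otimes> z \<otimes> g \<in> K i"
        using c[OF i z g] by (simp add: z_def)
      then have "inv (g \<otimes> z) \<otimes> (z \<otimes> g) \<in> K i"
        using g zG by (simp add: word_simps)
      then have "f (g \<otimes> z) = f (z \<otimes> g)"
        using F.map_eq_iff g zG by simp
      then show ?thesis
        using g zG by (simp add: F.hom)
    qed
    have C: "f x \<in> carrier V" "f y \<in> carrier V" "f z \<in> carrier V"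
      using xy zG by simp_all
    have "x \<otimes> y = z \<otimes> (y \<otimes> x)"
      using xy by (simp add: z_def comm_def word_simps)
    then have xy1: "f x \<otimes>\<^bsub>V\<^esub> f y = f z \<otimes>\<^bsub>V\<^esub> (f y \<otimes>\<^bsub>V\<^esub> f x)"
      using xy zG by (metis F.hom m_closed)
    also have "f z \<otimes>\<^bsub>V\<^esub> (f y \<otimes>\<^bsub>V\<^esub> f x) = f y \<otimes>\<^bsub>V\<^esub> f z \<otimes>\<^bsub>V\<^esub> f x"
      using C fz[OF xy(2)] by (simp flip: F.Q.m_assoc)
    finally have xyz: "f x \<otimes>\<^bsub>V\<^esub> f y = f y \<otimes>\<^bsub>V\<^esub> f z \<otimes>\<^bsub>V\<^esub> f x" .
    then have 1: "f x \<otimes>\<^bsub>V\<^esub> f y \<otimes>\<^bsub>V\<^esub> inv\<^bsub>V\<^esub> f x = f y \<otimes>\<^bsub>V\<^esub> f z"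
      using C by (simp add: F.Q.m_assoc)
    have fx: "f x [^]\<^bsub>V\<^esub> (p ^ k) = \<one>\<^bsub>V\<^esub>" and fy: "f y [^]\<^bsub>V\<^esub> (q ^ l) = \<one>\<^bsub>V\<^esub>"
      using e xy F.map_pow F.map_one by (metis singletonD)+
    have "f y = f y \<otimes>\<^bsub>V\<^esub> f z [^]\<^bsub>V\<^esub> (p ^ k)"
      using F.Q.conj_pow_commuting[OF C 1 fz[OF xy(1), symmetric], of "p ^ k"] C fx by simp
    then have zp: "f z [^]\<^bsub>V\<^esub> (p ^ k) = \<one>\<^bsub>V\<^esub>"
      using C by (metis F.Q.l_cancel_one F.Q.nat_pow_closed)
    have "f y \<otimes>\<^bsub>V\<^esub> f x = f x \<otimes>\<^bsub>V\<^esub> inv\<^bsub>V\<^esub> f z \<otimes>\<^bsub>V\<^esub> f y"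
    proof -
      have "inv\<^bsub>V\<^esub> f z \<otimes>\<^bsub>V\<^esub> (f x \<otimes>\<^bsub>V\<^esub> f y) = f y \<otimes>\<^bsub>V\<^esub> f x"
        using C by (simp add: xy1)
      moreover have "inv\<^bsub>V\<^esub> f z \<otimes>\<^bsub>V\<^esub> f x = f x \<otimes>\<^bsub>V\<^esub> inv\<^bsub>V\<^esub> f z"
        using C fz[OF xy(1)] by (metis F.Q.inv_solve_left F.Q.inv_solve_right F.Q.inv_closed F.Q.m_assoc F.Q.m_closed)
      ultimately show ?thesis
        using C by (simp flip: F.Q.m_assoc)
    qed
    then have 2: "f y \<otimes>\<^bsub>V\<^esub> f x \<otimes>\<^bsub>V\<^esub> inv\<^bsub>V\<^esub> f y = f x \<otimes>\<^bsub>V\<^esub> inv\<^bsub>V\<^esub> f z"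
      using C by (simp add: F.Q.m_assoc)
    have 3: "f y \<otimes>\<^bsub>V\<^esub> inv\<^bsub>V\<^esub> f z = inv\<^bsub>V\<^esub> f z \<otimes>\<^bsub>V\<^esub> f y"
      using C fz[OF xy(2)] by (metis F.Q.inv_solve_left F.Q.inv_solve_right F.Q.inv_closed F.Q.m_assoc F.Q.m_closed)
    have "f x = f x \<otimes>\<^bsub>V\<^esub> (inv\<^bsub>V\<^esub> f z) [^]\<^bsub>V\<^esub> (q ^ l)"
      using F.Q.conj_pow_commuting[OF C(2,1) F.Q.inv_closed[OF C(3)] 2 3, of "q ^ l"] C fy by simp
    then have "(inv\<^bsub>V\<^esub> f z) [^]\<^bsub>V\<^esub> (q ^ l) = \<one>\<^bsub>V\<^esub>"
      using C by (metis F.Q.l_cancel_one F.Q.nat_pow_closed F.Q.inv_closed)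
    then have zq: "f z [^]\<^bsub>V\<^esub> (q ^ l) = \<one>\<^bsub>V\<^esub>"
      using C F.Q.nat_pow_inv by (metis F.Q.inv_eq_1_iff F.Q.nat_pow_closed)
    have "coprime (p ^ k) (q ^ l)"
      using pq by (simp add: primes_coprime)
    then have "f z = \<one>\<^bsub>V\<^esub>"
      using F.Q.coprime_pow_eq_one[OF C(3) zp zq] by simp
    then show ?thesis
      using F.ker zG by (simp add: z_def)
  qed
  \<comment> \<open>Truncated subtraction stops at \<open>K 0\<close>, so the induction can run over
    all j.\<close>
  have "comm x y \<in> K (n - j)" for j
  proof (induction j)
    case 0
    then show ?case
      using K xy by simp
  next
    case (Suc j)
    then show ?case
      using step[of "n - Suc j"] by (cases "n \<le> j") (simp_all add: Suc_diff_Suc)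
  qed
  from this[of n] show "comm x y \<in> {\<one>}"
    using K by simp
qed

text \<open>The preimage of the centre of G/N for normal \<open>N\<close>; iterated from the trivial
  subgroup it gives the upper central series.\<close>

definition next_centre :: "'a set \<Rightarrow> 'a set" where
  "next_centre N = {x \<in> carrier G. \<forall>g\<in>carrier G. inv x \<otimes> inv g \<otimes> x \<otimes> g \<in> N}"

lemma next_centre:
  assumes N: "N \<lhd> G"
  shows "next_centre N \<lhd> G" "N \<subseteq> next_centre N"
    "nilp_mod {\<one>} (carrier G) \<Longrightarrow> N \<noteq> carrier G \<Longrightarrow> N \<noteq> next_centre N"
proof -
  have N': "subgroup N G" "normalises (carrier G) N"
    using N by (simp_all add: normal_iff_normalises)
  obtain V :: "'a set monoid" and f where "factor_map G V (carrier G) N f"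
    using factor_mapE[OF subgroup_self N'(1) subgroup.subset[OF N'(1)] N'(2)] .
  then interpret F: factor_map G V "carrier G" N f .
  have iff: "x \<in> next_centre N \<longleftrightarrow> x \<in> carrier G \<and> (\<forall>g\<in>carrier G. f x \<otimes>\<^bsub>V\<^esub> f g = f g \<otimes>\<^bsub>V\<^esub> f x)" for x
  proof -
    have "inv x \<otimes> inv g \<otimes> x \<otimes> g \<in> N \<longleftrightarrow> f x \<otimes>\<^bsub>V\<^esub> f g = f g \<otimes>\<^bsub>V\<^esub> f x"
      if "x \<in> carrier G" "g \<in> carrier G" for g
    proof -
      have "inv x \<otimes> inv g \<otimes> x \<otimes> g = inv (g \<otimes> x) \<otimes> (x \<otimes> g)"
        using that by (simp add: word_simps)
      then have "inv x \<otimes> inv g \<otimes> x \<otimes> g \<in> N \<longleftrightarrow> f (g \<otimes> x) = f (x \<otimes> g)"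
        using F.map_eq_iff[of "g \<otimes> x" "x \<otimes> g"] that by simp
      then show ?thesis
        using that by (auto simp: F.hom)
    qed
    then show ?thesis
      by (auto simp: next_centre_def)
  qed
  show "N \<subseteq> next_centre N"
    using N'(1) by (auto simp: iff F.map_L subgroup_carrier)
  have "subgroup (next_centre N) G"
  proof (rule finite_group_subgroupI)
    show "next_centre N \<subseteq> carrier G" "\<one> \<in> next_centre N"
      by (auto simp: iff)
    fix x y assume "x \<in> next_centre N" "y \<in> next_centre N"
    then have xy: "x \<in> carrier G" "y \<in> carrier G"
      and c: "\<And>g. g \<in> carrier G \<Longrightarrow> f x \<otimes>\<^bsub>V\<^esub> f g = f g \<otimes>\<^bsub>V\<^esub> f x" "\<And>g. g \<in> carrier G \<Longrightarrow> f y \<otimes>\<^bsub>V\<^esub> f g = f g \<otimes>\<^bsub>V\<^esub> f y"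
      by (auto simp: iff)
    have "f (x \<otimes> y) \<otimes>\<^bsub>V\<^esub> f g = f g \<otimes>\<^bsub>V\<^esub> f (x \<otimes> y)" if g: "g \<in> carrier G" for g
      using F.Q.commute_mult[OF _ _ _ c(1)[OF g] c(2)[OF g]] xy g by (simp add: F.hom)
    then show "x \<otimes> y \<in> next_centre N"
      using xy by (simp add: iff)
  qed
  moreover have "normalises (carrier G) (next_centre N)"
    unfolding normalises_def
  proof (intro ballI)
    fix g x assume g: "g \<in> carrier G" and "x \<in> next_centre N"
    then have x: "x \<in> carrier G" and c: "\<And>g. g \<in> carrier G \<Longrightarrow> f x \<otimes>\<^bsub>V\<^esub> f g = f g \<otimes>\<^bsub>V\<^esub> f x"
      by (auto simp: iff)
    have "f (g \<otimes> x \<otimes> inv g) = f g \<otimes>\<^bsub>V\<^esub> f x \<otimes>\<^bsub>V\<^esub> inv\<^bsub>V\<^esub> f g"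
      using g x by (simp add: F.hom F.map_inv)
    also have "\<dots> = f x"
      unfolding c[OF g, symmetric] using g x by (simp add: F.Q.m_assoc)
    finally show "g \<otimes> x \<otimes> inv g \<in> next_centre N"
      unfolding iff using g x c by simp
  qed
  ultimately show "next_centre N \<lhd> G"
    by (simp add: normal_iff_normalises)
  assume nil: "nilp_mod {\<one>} (carrier G)" and ne: "N \<noteq> carrier G"
  have "F.Q.nilp_mod {\<one>\<^bsub>V\<^esub>} (carrier V)"
    using nilp_mod_quotient[OF nil subgroup_self N'(1) subgroup.subset[OF N'(1)] N'(2)] F.nilp_mod_iff by simp
  moreover have "carrier V \<noteq> {\<one>\<^bsub>V\<^esub>}"
  proof
    assume "carrier V = {\<one>\<^bsub>V\<^esub>}"
    then have "card N = card (carrier G)"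
      using F.card_quotient by simp
    then show False
      using ne subgroup_eqI[OF subgroup_self subgroup.subset[OF N'(1)]] by simp
  qed
  ultimately obtain z where z: "z \<in> carrier V" "z \<noteq> \<one>\<^bsub>V\<^esub>" "\<And>x. x \<in> carrier V \<Longrightarrow> x \<otimes>\<^bsub>V\<^esub> z = z \<otimes>\<^bsub>V\<^esub> x"
    using F.Q.nilp_centre by blast
  obtain w where w: "w \<in> carrier G" "z = f w"
    using z(1) unfolding F.onto[symmetric] by blast
  have "w \<in> next_centre N"
    unfolding iff using w z(3)[OF F.closed] by simp
  moreover have "w \<notin> N"
    using w z(2) F.ker by blast
  ultimately show "N \<noteq> next_centre N"
    by blast
qed

text \<open>For the converse, the upper central series grows strictly until it reaches
  \<open>G\<close>, because proper factor groups inherit the hypothesis and have nontrivial centres.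
  Finiteness ends the growth.\<close>

lemma nilpotent_iff: "nilpotent G \<longleftrightarrow> nilp_mod {\<one>} (carrier G)"
proof
  assume nil: "nilp_mod {\<one>} (carrier G)"
  define K where "K n = (next_centre ^^ n) {\<one>}" for n
  have K0: "K 0 = {\<one>}" and KS: "K (Suc n) = next_centre (K n)" for n
    by (simp_all add: K_def)
  have norm: "K n \<lhd> G" for n
    by (induction n) (simp_all add: K0 KS one_is_normal next_centre(1))
  have sK: "subgroup (K n) G" for n
    using norm normal_imp_subgroup by blast
  have "\<exists>n. K n = carrier G"
  proof (rule ccontr)
    assume ne: "\<nexists>n. K n = carrier G"
    have "n < card (K n)" for n
    proof (induction n)
      case 0
      then show ?case
        using card_pos sK by blast
    next
      case (Suc n)
      have "K n \<subset> K (Suc n)"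
        using next_centre(2,3)[OF norm, of n] nil ne by (auto simp: KS)
      then have "card (K n) < card (K (Suc n))"
        using finite_subgroup[OF sK] by (rule psubset_card_mono[rotated])
      then show ?case
        using Suc by simp
    qed
    then have "card (carrier G) < card (K (card (carrier G)))" .
    then show False
      using card_mono[OF fin subgroup.subset[OF sK]] by (metis not_le)
  qed
  then obtain n where "K n = carrier G"
    by blast
  moreover have "K i \<subseteq> K (Suc i) \<and> (\<forall>x\<in>K (Suc i). \<forall>g\<in>carrier G.
      inv x \<otimes> inv g \<otimes> x \<otimes> g \<in> K i)" for i
    using next_centre(2)[OF norm] by (auto simp: KS) (auto simp: next_centre_def)
  ultimately show "nilpotent G"
    unfolding nilpotent_def using K0 norm by (metis fin is_group)
qed (rule nilpotent_imp_nilp)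

lemma subgroup_restrict_iff:
  "subgroup D G \<Longrightarrow> subgroup H (G\<lparr>carrier := D\<rparr>) \<longleftrightarrow> subgroup H G \<and> H \<subseteq> D"
  using incl_subgroup[of D H] subgroup_incl[of H D] subgroup.subset[of H "G\<lparr>carrier := D\<rparr>"] by auto

lemma sub_index_card:
  assumes "subgroup H G" "subgroup K G" "H \<subseteq> K"
  shows "sub_index (G\<lparr>carrier := D\<rparr>) K H * card H = card K"
proof -
  interpret K: group "G\<lparr>carrier := K\<rparr>"
    using assms(2) subgroup_imp_group by blast
  have "subgroup H (G\<lparr>carrier := K\<rparr>)"
    using assms subgroup_incl by blast
  from K.lagrange[OF this] show ?thesis
    by (simp add: order_def sub_index_def)
qed

lemma psub_imp_series:
  assumes "psub H K"
  shows "\<exists>(n::nat) C. C 0 = H \<and> C n = K \<and> (\<forall>i\<le>n. subgroup (C i) G \<and> C i \<subseteq> K) \<and>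
    (\<forall>i\<in>{1..n}. C (i - 1) \<subseteq> C i \<and> prime (sub_index (G\<lparr>carrier := D\<rparr>) (C i) (C (i - 1))))"
  using assms
proof (induction rule: chain.induct)
  case (refl H)
  then show ?case
    by (intro exI[of _ 0] exI[of _ "\<lambda>_. H"]) simp
next
  case (step H K L r)
  then obtain n :: nat and C where C: "C 0 = H" "C n = K" "\<And>i. i \<le> n \<Longrightarrow> subgroup (C i) G \<and> C i \<subseteq> K"
      "\<And>i. i \<in> {1..n} \<Longrightarrow> C (i - 1) \<subseteq> C i \<and> prime (sub_index (G\<lparr>carrier := D\<rparr>) (C i) (C (i - 1)))"
    by blast
  have K: "subgroup K G"
    using chainD[OF step.hyps(1)] by simp
  have "sub_index (G\<lparr>carrier := D\<rparr>) L K = r"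
    using sub_index_card[OF K step.hyps(2,4)] step.hyps(5) card_pos[OF K] by simp
  then have last: "K \<subseteq> L \<and> prime (sub_index (G\<lparr>carrier := D\<rparr>) L K)"
    using step.hyps by simp
  define C' where "C' = C(Suc n := L)"
  have "C' 0 = H" "C' (Suc n) = L"
    using C by (simp_all add: C'_def)
  moreover have "\<forall>i\<le>Suc n. subgroup (C' i) G \<and> C' i \<subseteq> L"
    using C(3) step.hyps by (auto simp: C'_def le_Suc_eq)
  moreover have "\<forall>i\<in>{1..Suc n}. C' (i - 1) \<subseteq> C' i \<and> prime (sub_index (G\<lparr>carrier := D\<rparr>) (C' i) (C' (i - 1)))"
  proof
    fix i assume i: "i \<in> {1..Suc n}"
    show "C' (i - 1) \<subseteq> C' i \<and> prime (sub_index (G\<lparr>carrier := D\<rparr>) (C' i) (C' (i - 1)))"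
    proof (cases "i = Suc n")
      case True
      then show ?thesis
        using last C(2) by (simp add: C'_def)
    next
      case False
      then show ?thesis
        using C(4)[of i] i by (auto simp: C'_def)
    qed
  qed
  ultimately show ?case
    by blast
qed

lemma P_subnormal_iff:
  assumes D: "subgroup D G"
  shows "P_subnormal H (G\<lparr>carrier := D\<rparr>) \<longleftrightarrow> psub H D"
proof
  assume "psub H D"
  have "subgroup H G" "H \<subseteq> D"
    by (rule chainD[OF \<open>psub H D\<close>])+
  moreover obtain n :: nat and C where "C 0 = H \<and> C n = D \<and> (\<forall>i\<le>n. subgroup (C i) G \<and> C i \<subseteq> D) \<and>
    (\<forall>i\<in>{1..n}. C (i - 1) \<subseteq> C i \<and> prime (sub_index (G\<lparr>carrier := D\<rparr>) (C i) (C (i - 1))))"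
    using psub_imp_series[OF \<open>psub H D\<close>, of D] by (elim exE) (rule that)
  ultimately show "P_subnormal H (G\<lparr>carrier := D\<rparr>)"
    unfolding P_subnormal_def
    by (intro conjI disjI2 exI[of _ n] exI[of _ C]) (simp_all add: subgroup_restrict_iff[OF D])
next
  assume H: "P_subnormal H (G\<lparr>carrier := D\<rparr>)"
  show "psub H D"
  proof (cases "H = D")
    case True
    then show ?thesis
      using D by (auto intro: chain.refl simp: normalises_def)
  next
    case False
    then have "\<exists>(n::nat) C. C 0 = H \<and> C n = D \<and> (\<forall>i\<le>n. subgroup (C i) (G\<lparr>carrier := D\<rparr>)) \<and>
      (\<forall>i\<in>{1..n}. C (i - 1) \<subseteq> C i \<and> prime (sub_index (G\<lparr>carrier := D\<rparr>) (C i) (C (i - 1))))"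
      using H by (simp add: P_subnormal_def)
    then obtain n :: nat and C where nC: "C 0 = H \<and> C n = D \<and> (\<forall>i\<le>n. subgroup (C i) (G\<lparr>carrier := D\<rparr>)) \<and>
      (\<forall>i\<in>{1..n}. C (i - 1) \<subseteq> C i \<and> prime (sub_index (G\<lparr>carrier := D\<rparr>) (C i) (C (i - 1))))"
      by (elim exE) (rule that)
    then have C: "C 0 = H" "C n = D" "\<And>i. i \<le> n \<Longrightarrow> subgroup (C i) G"
      "\<And>i. i \<in> {1..n} \<Longrightarrow> C (i - 1) \<subseteq> C i \<and> prime (sub_index (G\<lparr>carrier := D\<rparr>) (C i) (C (i - 1)))"
      by (simp_all add: subgroup_restrict_iff[OF D])
    have "psub H (C i)" if "i \<le> n" for i
      using that
    proof (induction i)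
      case 0
      then show ?case
        using C by (auto intro: chain.refl simp: normalises_def)
    next
      case (Suc i)
      have 1: "C i \<subseteq> C (Suc i)" "prime (sub_index (G\<lparr>carrier := D\<rparr>) (C (Suc i)) (C i))"
        using C(4)[of "Suc i"] Suc.prems by auto
      have 2: "card (C (Suc i)) = sub_index (G\<lparr>carrier := D\<rparr>) (C (Suc i)) (C i) * card (C i)"
        using sub_index_card[OF _ _ 1(1)] C(3) Suc.prems by simp
      show ?case
        using chain.step[OF _ _ _ 1(1) 2 1(2)] Suc C(3) by (auto simp: normalises_def)
    qed
    then show ?thesis
      using C(2) by auto
  qed
qed

lemma sylow_subgroup_iff:
  "subgroup D G \<Longrightarrow> sylow_subgroup q P (G\<lparr>carrier := D\<rparr>) \<longleftrightarrow> is_sylow q P D"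
  using subgroup_restrict_iff by (auto simp: sylow_subgroup_def is_sylow_def order_def)

lemma w_supersoluble_iff:
  assumes D: "subgroup D G"
  shows "w_supersoluble (G\<lparr>carrier := D\<rparr>) \<longleftrightarrow> wsup D"
  unfolding w_supersoluble_def wsup_def sylow_subgroup_iff[OF D] P_subnormal_iff[OF D]
  using subgroup_imp_group[OF D] finite_subgroup[OF D] by auto

lemma w_supersoluble_self: "w_supersoluble G \<longleftrightarrow> wsup (carrier G)"
  using w_supersoluble_iff[OF subgroup_self] by simp

lemma abelian_sylow_iff:
  "abelian_sylow G \<longleftrightarrow> (\<forall>q P. is_sylow q P (carrier G) \<longrightarrow> (\<forall>a\<in>P. \<forall>b\<in>P. a \<otimes> b = b \<otimes> a))"
proof -
  have s: "sylow_subgroup q P G \<longleftrightarrow> is_sylow q P (carrier G)" for q P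
    using sylow_subgroup_iff[OF subgroup_self] by simp
  have c: "comm_group (G\<lparr>carrier := P\<rparr>) \<longleftrightarrow> (\<forall>a\<in>P. \<forall>b\<in>P. a \<otimes> b = b \<otimes> a)" if P: "subgroup P G" for P
  proof
    assume "comm_group (G\<lparr>carrier := P\<rparr>)"
    then interpret P: comm_group "G\<lparr>carrier := P\<rparr>" .
    show "\<forall>a\<in>P. \<forall>b\<in>P. a \<otimes> b = b \<otimes> a"
      using P.m_comm by simp
  next
    assume *: "\<forall>a\<in>P. \<forall>b\<in>P. a \<otimes> b = b \<otimes> a"
    interpret P: group "G\<lparr>carrier := P\<rparr>"
      using P subgroup_imp_group by blast
    show "comm_group (G\<lparr>carrier := P\<rparr>)"
      by (rule P.group_comm_groupI) (use * in simp)
  qed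
  show ?thesis
    unfolding abelian_sylow_def s using c sylowD(2) by (auto simp: is_group)
qed

end

context factor_map
begin

text \<open>Sylow subgroups of S/L are the images of those of \<open>S\<close>. The right-hand side
  only asks \<open>L\<close> to contain certain elements, a condition that passes to
  intersections.\<close>

lemma abelian_sylow_quotient_iff:
  "abelian_sylow Q \<longleftrightarrow> (\<forall>q P. is_sylow q P S \<longrightarrow> (\<forall>a\<in>P. \<forall>b\<in>P. comm a b \<in> L))"
proof -
  have c: "comm a b \<in> L \<longleftrightarrow> \<phi> a \<otimes>\<^bsub>Q\<^esub> \<phi> b = \<phi> b \<otimes>\<^bsub>Q\<^esub> \<phi> a" if "is_sylow q P S" "a \<in> P" "b \<in> P" for q P a b
    using comm_iff sylowD(3) that by blast
  show ?thesis
    unfolding Q.abelian_sylow_iff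
  proof (intro iffI allI impI ballI)
    fix q P a b assume ab: "\<forall>q P. Q.is_sylow q P (carrier Q) \<longrightarrow> (\<forall>a\<in>P. \<forall>b\<in>P. a \<otimes>\<^bsub>Q\<^esub> b = b \<otimes>\<^bsub>Q\<^esub> a)"
      and P: "is_sylow q P S" "a \<in> P" "b \<in> P"
    then show "comm a b \<in> L"
      using sylow_image[OF P(1)] c[OF P] by blast
  next
    fix q P u v assume ab: "\<forall>q P. is_sylow q P S \<longrightarrow> (\<forall>a\<in>P. \<forall>b\<in>P. comm a b \<in> L)"
      and P: "Q.is_sylow q P (carrier Q)" "u \<in> P" "v \<in> P"
    obtain R where R: "is_sylow q R S" "\<phi> ` R = P"
      using sylow_lift[OF P(1)] by blast
    then obtain a b where ab': "a \<in> R" "b \<in> R" "u = \<phi> a" "v = \<phi> b"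
      using P by blast
    then show "u \<otimes>\<^bsub>Q\<^esub> v = v \<otimes>\<^bsub>Q\<^esub> u"
      using c[OF R(1) ab'(1,2)] ab R(1) by blast
  qed
qed

lemma nilpotent_quotient_iff: "nilpotent Q \<longleftrightarrow> nilp_mod L S"
  by (simp add: Q.nilpotent_iff nilp_mod_iff)

end

section \<open>Products of w-supersoluble subgroups\<close>

context fin_group
begin

lemma psub_sylow_of_wsup:
  "psub A (carrier G) \<Longrightarrow> wsup A \<Longrightarrow> is_sylow q X A \<Longrightarrow> psub X (carrier G)"
  unfolding wsup_def by (meson chain_trans)

lemma wsupI:
  assumes "subgroup D G" "\<And>q. prime q \<Longrightarrow> \<exists>Q. is_sylow q Q D \<and> psub Q D"
  shows "wsup D"
  unfolding wsup_def using assms psub_all_sylow sylowD(1) by meson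

text \<open>Split a Sylow q-subgroup \<open>Q\<close> of AN into its parts in \<open>A\<close> and
  in \<open>N\<close>. The first has chains in the tower sections of \<open>G\<close>. The second
  consists of q-elements of a nilpotent normal subgroup and centralises these sections, so the same
  chains are \<open>Q\<close>-invariant; they are then intersected with AN.\<close>

lemma wsup_setmult_nilpotent:
  assumes d: dispersive and A: "psub A (carrier G)" "wsup A"
    and N: "subgroup N G" "normalises (carrier G) N" "nilp_mod {\<one>} N"
  shows "wsup (A <#> N)"
proof (rule wsupI)
  have sA: "subgroup A G"
    using chainD(1)[OF A(1)] .
  show D: "subgroup (A <#> N) G"
    using subgroup_setmult[OF sA N(1)] normalises_subset[OF N(2) subgroup.subset[OF sA]] by blast
  let ?D = "A <#> N"
  fix q :: nat assume q: "prime q"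
  obtain Q where Q: "is_sylow q Q ?D" "is_sylow q (Q \<inter> A) A" "is_sylow q (Q \<inter> N) N"
      "Q = (Q \<inter> A) <#> (Q \<inter> N)"
    using sylow_factorisation[OF sA N(1) D HOL.refl q] by blast
  note Q' = sylowD[OF Q(1)]
  have QG: "Q \<subseteq> carrier G" and DG: "?D \<subseteq> carrier G"
    using Q'(2) D subgroup.subset by auto
  have X: "psub (Q \<inter> A) (carrier G)" "card (Q \<inter> A) = q ^ multiplicity q (card A)"
    using psub_sylow_of_wsup[OF A Q(2)] sylowD(4)[OF Q(2)] by auto
  have ch: "chain Q {p} (Oge (Suc p) \<inter> ?D) (Oge p \<inter> ?D)" if p: "prime p" "q < p" for p
  proof -
    obtain k where k: "card (Oge p) = p ^ k * card (Oge (Suc p))"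
      using Oge_section_prime[OF d p(1)] by blast
    have "chain (Q \<inter> A) {p} (Oge (Suc p)) (Oge p)"
      using psub_chain_Oge[OF d X q p] .
    then have c: "chain Q {p} (Oge (Suc p)) (Oge p)"
    proof (rule chain_normalises)
      fix M assume M: "subgroup M G" "normalises (Q \<inter> A) M" "Oge (Suc p) \<subseteq> M" "M \<subseteq> Oge p"
      have "normalises (Q \<inter> N) M"
        unfolding normalises_def
      proof (intro ballI)
        fix c m assume c: "c \<in> Q \<inter> N" and m: "m \<in> M"
        have G: "c \<in> carrier G" "m \<in> carrier G"
          using c m QG M(1) subgroup_carrier by auto
        have cq: "c [^] (q ^ multiplicity q (card N)) = \<one>"
          using pow_card_subgroup[OF sylowD(2)[OF Q(3)] c] sylowD(4)[OF Q(3)] by simp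
        have "comm c m \<in> Oge (Suc p)"
          by (rule nilp_mod_centralises[OF N(3,1,2) subgroup_Oge normalises_Oge subgroup_Oge normalises_Oge _ _ _ k p(1) q
                _ _ cq]) (use c m M(4) p in \<open>auto simp: subgroup.one_closed Oge_mono\<close>)
        then have "comm c m \<otimes> m \<in> M"
          using subgroup.m_closed[OF M(1) _ m] M(3) by blast
        moreover have "comm c m \<otimes> m = c \<otimes> m \<otimes> inv c"
          using G by (simp add: comm_def m_assoc)
        ultimately show "c \<otimes> m \<otimes> inv c \<in> M"
          by simp
      qed
      then have "normalises ((Q \<inter> A) <#> (Q \<inter> N)) M"
        using QG M(1,2) subgroup.subset by (intro normalises_by_setmult) auto
      then show "normalises Q M"
        using Q(4) by simp
    qed
    have "normalises (Oge p \<inter> ?D) (Oge (Suc p))"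
      using normalises_Oge by (rule normalises_subset) (use DG in blast)
    then obtain j where j: "card (Oge p \<inter> ?D) = p ^ j * card (Oge (Suc p) \<inter> ?D)"
      using section_Int[OF subgroup_Oge subgroup_Oge D Oge_mono _ k p(1)] by auto
    show ?thesis
      using chain_Int[OF c D normalises_self[OF D Q'(3)] subset_refl subgroup_Oge j] .
  qed
  have "psub (Q <#> (Oge n \<inter> ?D)) ?D" for n
  proof (rule psub_if_chains[OF D Q(1)])
    show "subgroup (Oge n \<inter> ?D) G" for n
      using subgroup_Oge D by (rule subgroup_Int)
    show "normalises ?D (Oge n \<inter> ?D)" for n
      using normalises_subset[OF normalises_Oge DG] normalises_self[OF D subset_refl]
      by (rule normalises_Int)
    show "Oge 0 \<inter> ?D = ?D"
      unfolding Oge_zero using DG by blast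
    show "Oge (Suc n) \<inter> ?D \<subseteq> Oge n \<inter> ?D" for n
      using Oge_mono[of n "Suc n"] by auto
    show "Oge n \<inter> ?D = Oge (Suc n) \<inter> ?D" if "\<not> prime n" for n
      using Oge_section_nonprime[OF d that] by simp
    show "\<exists>k. card (Oge n \<inter> ?D) = n ^ k * card (Oge (Suc n) \<inter> ?D)" if n: "prime n" for n
    proof -
      obtain k where k: "card (Oge n) = n ^ k * card (Oge (Suc n))"
        using Oge_section_prime[OF d n] by blast
      have "normalises (Oge n \<inter> ?D) (Oge (Suc n))"
        using normalises_Oge by (rule normalises_subset) (use DG in blast)
      then show ?thesis
        using section_Int[OF subgroup_Oge subgroup_Oge D Oge_mono _ k n] by auto
    qed
  qed (rule ch)
  \<comment> \<open>Beyond the group order the tower is trivial, which leaves \<open>Q\<close>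
    itself.\<close>
  from this[of "Suc (card (carrier G))"] have "psub (Q <#> ({\<one>} \<inter> ?D)) ?D"
    using Oge_large[of "Suc (card (carrier G))"] by simp
  moreover have "{\<one>} \<inter> ?D = {\<one>}"
    using subgroup.one_closed[OF D] by simp
  moreover have "Q <#> {\<one>} = Q"
    using coset_mult_one[OF QG] by (simp add: r_coset_eq_set_mult)
  ultimately show "\<exists>Q. is_sylow q Q ?D \<and> psub Q ?D"
    using Q(1) by auto
qed

text \<open>The whole tower is multiplied by \<open>N\<close>, so that the descent ends at
  \<open>Q <#> N\<close>. Nilpotency of \<open>K\<close> modulo \<open>N\<close> makes the
  commutators of \<open>Q\<close> centralise the enlarged sections, and this allows the chains of Q
  \<inter> A and Q \<inter> B to be merged.\<close>

lemma wsup_quotient_of_product: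
  assumes A: "psub A (carrier G)" "wsup A" and B: "psub B (carrier G)" "wsup B"
    and AB: "carrier G = A <#> B" and d: dispersive
    and K: "subgroup K G" "normalises (carrier G) K" and N: "subgroup N G" "normalises (carrier G) N"
    and nil: "nilp_mod N K"
    and cK: "\<And>q Q a b. is_sylow q Q (carrier G) \<Longrightarrow> a \<in> Q \<Longrightarrow> b \<in> Q \<Longrightarrow> comm a b \<in> K"
    and q: "prime q"
  shows "\<exists>Q. is_sylow q Q (carrier G) \<and> psub (Q <#> N) (carrier G)"
proof -
  have sA: "subgroup A G" and sB: "subgroup B G"
    using chainD(1)[OF A(1)] chainD(1)[OF B(1)] .
  obtain Q where Q: "is_sylow q Q (carrier G)" "is_sylow q (Q \<inter> A) A" "is_sylow q (Q \<inter> B) B"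
      "Q = (Q \<inter> A) <#> (Q \<inter> B)"
    using sylow_factorisation[OF sA sB subgroup_self AB q] by blast
  note Q' = sylowD[OF Q(1)]
  have TN: "subgroup (Oge n <#> N) G" "normalises (carrier G) (Oge n <#> N)" for n
    using N normalises_subset[OF N(2) subgroup.subset[OF subgroup_Oge]]
    by (simp_all add: subgroup_setmult normalises_setmult normalises_Oge)
  have mono: "Oge (Suc n) <#> N \<subseteq> Oge n <#> N" for n
    by (intro setmult_mono Oge_mono) auto
  have pr: "\<exists>k. card (Oge n <#> N) = n ^ k * card (Oge (Suc n) <#> N)" if n: "prime n" for n
  proof -
    obtain k where k: "card (Oge n) = n ^ k * card (Oge (Suc n))"
      using Oge_section_prime[OF d n] by blast
    show ?thesis
      using section_setmult[OF subgroup_Oge subgroup_Oge N(1) Oge_mono _ k n TN(1) TN(1)]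
        normalises_subset[OF normalises_Oge subgroup.subset[OF subgroup_Oge]] by simp
  qed
  have NT: "N \<subseteq> Oge n <#> N" for n
    using N(1) by (simp add: subset_setmult_right)
  have ch: "chain Q {p} (Oge (Suc p) <#> N) (Oge p <#> N)" if p: "prime p" "q < p" for p
  proof (rule chain_setmult_commuting[where X = "Q \<inter> A" and Y = "Q \<inter> B"])
    have "chain (Q \<inter> A) {p} (Oge (Suc p)) (Oge p)" "chain (Q \<inter> B) {p} (Oge (Suc p)) (Oge p)"
      using psub_chain_Oge[OF d psub_sylow_of_wsup[OF A Q(2)] sylowD(4)[OF Q(2)] q p]
        psub_chain_Oge[OF d psub_sylow_of_wsup[OF B Q(3)] sylowD(4)[OF Q(3)] q p] by auto
    then show "chain (Q \<inter> A) {p} (Oge (Suc p) <#> N) (Oge p <#> N)"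
        "chain (Q \<inter> B) {p} (Oge (Suc p) <#> N) (Oge p <#> N)"
      using N Q'(3) by (auto intro!: chain_setmult_normal)
    show "normalises (carrier G) (Oge (Suc p) <#> N)" "normalises Q (Oge p <#> N)"
      using TN Q'(3) normalises_subset by blast+
    show "Q \<subseteq> (Q \<inter> A) <#> (Q \<inter> B)"
      using Q(4) by simp
    fix a b u assume ab: "a \<in> Q" "b \<in> Q" and u: "u \<in> Oge p <#> N"
    have cQ: "comm a b \<in> Q"
      using comm_in_subgroup[OF Q'(2) ab] .
    have cq: "comm a b [^] (q ^ multiplicity q (card (carrier G))) = \<one>"
      using pow_card_subgroup[OF Q'(2) cQ] Q'(4) by simp
    obtain k where k: "card (Oge p <#> N) = p ^ k * card (Oge (Suc p) <#> N)"
      using pr p by blast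
    show "comm (comm a b) u \<in> Oge (Suc p) <#> N"
      by (rule nilp_mod_centralises[OF nil K TN TN NT _ mono k p(1) q _ cK[OF Q(1) ab] cq u])
        (use p N(1) in \<open>auto simp: subgroup.one_closed\<close>)
  qed (use Q' in auto)
  have "psub (Q <#> (Oge n <#> N)) (carrier G)" for n
  proof (rule psub_if_chains[OF subgroup_self Q(1) TN _ mono pr])
    show "Oge 0 <#> N = carrier G"
      unfolding Oge_zero
      by (intro equalityI setmult_subset[OF subgroup_self subset_refl subgroup.subset[OF N(1)]]
          subset_setmult_left[OF subgroup_self N(1)])
    show "Oge n <#> N = Oge (Suc n) <#> N" if "\<not> prime n" for n
      using Oge_section_nonprime[OF d that] by simp
  qed (assumption | rule ch)+
  from this[of "Suc (card (carrier G))"] have "psub (Q <#> ({\<one>} <#> N)) (carrier G)"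
    using Oge_large[of "Suc (card (carrier G))"] by simp
  moreover have "{\<one>} <#> N = N"
    using lcos_mult_one[OF subgroup.subset[OF N(1)]] by (simp add: l_coset_eq_set_mult)
  ultimately show ?thesis
    using Q(1) by auto
qed

section \<open>The two residuals as least normal subgroups\<close>

lemma factor_map_FactGroup:
  assumes "N \<lhd> G"
  shows "factor_map G (G Mod N) (carrier G) N (\<lambda>x. N #> x)"
proof -
  have "subgroup N G" "normalises (carrier G) N"
    using assms by (simp_all add: normal_iff_normalises)
  then show ?thesis
    using factor_map_Mod[OF subgroup_self _ subgroup.subset] by fastforce
qed

lemma subgroup_Inter_normal:
  assumes "\<F> \<noteq> {}" "\<And>N. N \<in> \<F> \<Longrightarrow> subgroup N G"
  shows "subgroup (\<Inter>\<F>) G"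
  using subgroups_Inter[of \<F>] assms by blast

text \<open>The defining family consists of the normal subgroups that contain all Sylow commutators.
  It contains \<open>carrier G\<close>, and its intersection inherits the condition, so the residual
  is its least member.\<close>

lemma abelian_residual:
  shows "subgroup (residual abelian_sylow G) G" "normalises (carrier G) (residual abelian_sylow G)"
    and "is_sylow q Q (carrier G) \<Longrightarrow> a \<in> Q \<Longrightarrow> b \<in> Q \<Longrightarrow> comm a b \<in> residual abelian_sylow G"
    and "\<lbrakk>subgroup M G; normalises (carrier G) M;
      \<And>q Q a b. is_sylow q Q (carrier G) \<Longrightarrow> a \<in> Q \<Longrightarrow> b \<in> Q \<Longrightarrow> comm a b \<in> M\<rbrakk> \<Longrightarrow> residual abelian_sylow G \<subseteq> M"
proof -
  define F where "F = {N. N \<lhd> G \<and> abelian_sylow (G Mod N)}"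
  have iff: "N \<in> F \<longleftrightarrow> subgroup N G \<and> normalises (carrier G) N \<and>
      (\<forall>q Q. is_sylow q Q (carrier G) \<longrightarrow> (\<forall>a\<in>Q. \<forall>b\<in>Q. comm a b \<in> N))" for N
  proof (cases "N \<lhd> G")
    case True
    interpret F: factor_map G "G Mod N" "carrier G" N "\<lambda>x. N #> x"
      using factor_map_FactGroup[OF True] .
    show ?thesis
      using True F.abelian_sylow_quotient_iff by (simp add: F_def normal_iff_normalises)
  next
    case False
    then show ?thesis
      by (auto simp: F_def normal_iff_normalises)
  qed
  have R: "residual abelian_sylow G = \<Inter>F"
    by (simp add: residual_def F_def)
  have "carrier G \<in> F"
  proof -
    have "comm a b \<in> carrier G" if "is_sylow q Q (carrier G)" "a \<in> Q" "b \<in> Q" for q Q a b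
      using that sylowD(3) by (intro comm_closed) blast+
    then show ?thesis
      unfolding iff using subgroup_self by (auto intro: normalises_self)
  qed
  then have ne: "F \<noteq> {}"
    by blast
  show "subgroup (residual abelian_sylow G) G"
    unfolding R using ne iff by (intro subgroup_Inter_normal) auto
  show "normalises (carrier G) (residual abelian_sylow G)"
    unfolding R using iff by (auto simp: normalises_def)
  show "comm a b \<in> residual abelian_sylow G" if "is_sylow q Q (carrier G)" "a \<in> Q" "b \<in> Q"
    unfolding R using iff that by blast
  show "residual abelian_sylow G \<subseteq> M" if "subgroup M G" "normalises (carrier G) M"
    "\<And>q Q a b. is_sylow q Q (carrier G) \<Longrightarrow> a \<in> Q \<Longrightarrow> b \<in> Q \<Longrightarrow> comm a b \<in> M"
    unfolding R using iff[of M] that by blast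
qed

text \<open>Normality in \<open>G\<close> needs its own reason, as the family consists of subgroups
  normal in \<open>K\<close> only: \<open>K\<close> is normal in \<open>G\<close>, so conjugation by
  elements of \<open>G\<close> maps the family to itself.\<close>

lemma nilpotent_residual:
  assumes K: "subgroup K G" "normalises (carrier G) K"
  shows "subgroup (residual nilpotent (G\<lparr>carrier := K\<rparr>)) G"
    "normalises (carrier G) (residual nilpotent (G\<lparr>carrier := K\<rparr>))"
    "nilp_mod (residual nilpotent (G\<lparr>carrier := K\<rparr>)) K"
    "\<lbrakk>subgroup M G; M \<subseteq> K; normalises K M; nilp_mod M K\<rbrakk> \<Longrightarrow> residual nilpotent (G\<lparr>carrier := K\<rparr>) \<subseteq> M"
proof -
  let ?K = "G\<lparr>carrier := K\<rparr>"
  interpret K: fin_group ?K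
    using fin_group_subgroup K(1) .
  define F where "F = {M. M \<lhd> ?K \<and> nilpotent (?K Mod M)}"
  have KG: "K \<subseteq> carrier G"
    using K subgroup.subset by blast
  have iff: "M \<in> F \<longleftrightarrow> subgroup M G \<and> M \<subseteq> K \<and> normalises K M \<and> nilp_mod M K" for M
  proof -
    have "M \<lhd> ?K \<longleftrightarrow> subgroup M ?K \<and> (\<forall>x\<in>K. \<forall>h\<in>M. x \<otimes> h \<otimes> inv\<^bsub>?K\<^esub> x \<in> M)"
      by (simp add: K.normal_inv_iff)
    also have "\<dots> \<longleftrightarrow> subgroup M G \<and> M \<subseteq> K \<and> normalises K M"
      using subgroup_restrict_iff[OF K(1)] m_inv_consistent[OF K(1)] by (auto simp: normalises_def)
    finally have n: "M \<lhd> ?K \<longleftrightarrow> subgroup M G \<and> M \<subseteq> K \<and> normalises K M" .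
    show ?thesis
    proof (cases "M \<lhd> ?K")
      case True
      then interpret F: factor_map G "?K Mod M" K M "\<lambda>x. M #> x"
        using factor_map_Mod[OF K(1), of M] n by blast
      show ?thesis
        using True n F.nilpotent_quotient_iff by (simp add: F_def)
    next
      case False
      then show ?thesis
        using n unfolding F_def by blast
    qed
  qed
  have R: "residual nilpotent ?K = \<Inter>F"
    by (simp add: residual_def F_def)
  have "nilp_mod K K"
    unfolding nilp_mod_def using comm_in_subgroup[OF K(1)] by blast
  then have KF: "K \<in> F"
    using K(1) by (simp add: iff normalises_self)
  then have ne: "F \<noteq> {}"
    by blast
  show "subgroup (residual nilpotent ?K) G"
    unfolding R using ne iff by (intro subgroup_Inter_normal) auto
  show "nilp_mod (residual nilpotent ?K) K"
    unfolding nilp_mod_def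
  proof (intro allI impI)
    fix p q :: nat and x y and k l :: nat
    assume *: "prime p" "prime q" "p \<noteq> q" "x \<in> K" "y \<in> K"
      "x [^] (p ^ k) \<in> residual nilpotent ?K" "y [^] (q ^ l) \<in> residual nilpotent ?K"
    have "comm x y \<in> M" if M: "M \<in> F" for M
    proof (rule nilp_modD[OF _ *(1-5)])
      show "nilp_mod M K"
        using M iff by blast
      show "x [^] (p ^ k) \<in> M" "y [^] (q ^ l) \<in> M"
        using *(6,7) M unfolding R by blast+
    qed
    then show "comm x y \<in> residual nilpotent ?K"
      unfolding R by blast
  qed
  show "residual nilpotent ?K \<subseteq> M" if "subgroup M G" "M \<subseteq> K" "normalises K M" "nilp_mod M K"
    unfolding R using iff[of M] that by blast
  have conjF: "conj_set g M \<in> F" if g: "g \<in> carrier G" and M: "M \<in> F" for g M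
  proof -
    have M': "subgroup M G" "M \<subseteq> K" "normalises K M" "nilp_mod M K"
      using M iff by auto
    have MG: "M \<subseteq> carrier G"
      using M'(1) subgroup.subset by blast
    have gi: "inv g \<otimes> x \<otimes> g \<in> K" if "x \<in> K" for x
      using normalisesD_inv[OF subgroup_self K(2) g that] .
    have bk: "x \<in> conj_set g M \<longleftrightarrow> inv g \<otimes> x \<otimes> g \<in> M" if "x \<in> carrier G" for x
    proof
      assume "x \<in> conj_set g M"
      then show "inv g \<otimes> x \<otimes> g \<in> M"
        using g MG by (auto simp: word_simps subset_iff)
    next
      assume m: "inv g \<otimes> x \<otimes> g \<in> M"
      have "x = g \<otimes> (inv g \<otimes> x \<otimes> g) \<otimes> inv g"
        using g that by (simp add: word_simps)
      then show "x \<in> conj_set g M"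
        using m by blast
    qed
    have "normalises K (conj_set g M)"
      unfolding normalises_def
    proof (intro ballI)
      fix x h assume x: "x \<in> K" and h: "h \<in> conj_set g M"
      have G: "x \<in> carrier G" "h \<in> carrier G"
        using x h KG MG g by auto
      have "(inv g \<otimes> x \<otimes> g) \<otimes> (inv g \<otimes> h \<otimes> g) \<otimes> inv (inv g \<otimes> x \<otimes> g) \<in> M"
        using normalisesD[OF M'(3) gi[OF x]] h bk G by blast
      moreover have "(inv g \<otimes> x \<otimes> g) \<otimes> (inv g \<otimes> h \<otimes> g) \<otimes> inv (inv g \<otimes> x \<otimes> g) = inv g \<otimes> (x \<otimes> h \<otimes> inv x) \<otimes> g"
        using G g by (simp add: word_simps)
      ultimately show "x \<otimes> h \<otimes> inv x \<in> conj_set g M"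
        using bk G by simp
    qed
    moreover have "nilp_mod (conj_set g M) K"
      unfolding nilp_mod_def
    proof (intro allI impI)
      fix p q :: nat and x y and k l :: nat
      assume pq: "prime p" "prime q" "p \<noteq> q" and xy: "x \<in> K" "y \<in> K"
        and e: "x [^] (p ^ k) \<in> conj_set g M" "y [^] (q ^ l) \<in> conj_set g M"
      have G: "x \<in> carrier G" "y \<in> carrier G"
        using xy KG by auto
      have pw: "(inv g \<otimes> z \<otimes> g) [^] (n::nat) = inv g \<otimes> z [^] n \<otimes> g" if "z \<in> carrier G" for z n
        using conj_pow[of "inv g" z n] that g by simp
      have "comm (inv g \<otimes> x \<otimes> g) (inv g \<otimes> y \<otimes> g) \<in> M"
        by (rule nilp_modD[OF M'(4) pq gi[OF xy(1)] gi[OF xy(2)], where k = k and l = l])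
          (use e bk G in \<open>simp_all add: pw\<close>)
      moreover have "comm (inv g \<otimes> x \<otimes> g) (inv g \<otimes> y \<otimes> g) = inv g \<otimes> comm x y \<otimes> g"
        using G g by (simp add: comm_def word_simps)
      ultimately show "comm x y \<in> conj_set g M"
        using bk G by simp
    qed
    moreover have "conj_set g M \<subseteq> K"
      using M'(2) K(2) g by (auto intro: normalisesD)
    ultimately show ?thesis
      unfolding iff using subgroup_conj[OF M'(1) g] by simp
  qed
  show "normalises (carrier G) (residual nilpotent ?K)"
    unfolding normalises_def R
  proof (intro ballI InterI)
    fix g x M assume g: "g \<in> carrier G" and x: "x \<in> \<Inter>F" and M: "M \<in> F"
    \<comment> \<open>x lies in every member of the family, in particular in g^-1 M g.\<close>
    have "x \<in> conj_set (inv g) M"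
      using x conjF[OF _ M, of "inv g"] g by blast
    then obtain m where m: "m \<in> M" "x = inv g \<otimes> m \<otimes> inv (inv g)"
      by blast
    then have "m \<in> carrier G"
      using M iff subgroup_carrier by blast
    then have "g \<otimes> x \<otimes> inv g = m"
      using g m by (simp add: word_simps)
    then show "g \<otimes> x \<otimes> inv g \<in> M"
      using m by simp
  qed
qed

text \<open>Pull the nilpotent subgroup from \<open>wsup_nilp_cover\<close> back from G/N. The
  preimage contains all Sylow commutators, hence the residual K for \<A>, so that K/(N \<inter> K)
  is nilpotent.\<close>

lemma wsup_quotient_residual_subset:
  assumes N: "N \<lhd> G" and w: "w_supersoluble (G Mod N)"
  shows "residual nilpotent (G\<lparr>carrier := residual abelian_sylow G\<rparr>) \<subseteq> N"
proof -
  let ?K = "residual abelian_sylow G"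
  have N': "subgroup N G" "normalises (carrier G) N"
    using N by (simp_all add: normal_iff_normalises)
  interpret F: factor_map G "G Mod N" "carrier G" N "\<lambda>x. N #> x"
    using factor_map_FactGroup[OF N] .
  have "F.Q.wsup (carrier (G Mod N))"
    using w F.Q.w_supersoluble_self by simp
  from F.Q.wsup_nilp_cover[OF this]
  obtain M where M: "subgroup M (G Mod N) \<and> F.Q.normalises (carrier (G Mod N)) M \<and>
      F.Q.nilp_mod {\<one>\<^bsub>G Mod N\<^esub>} M \<and>
      (\<forall>q Q. F.Q.is_sylow q Q (carrier (G Mod N)) \<longrightarrow> (\<forall>a\<in>Q. \<forall>b\<in>Q. F.Q.comm a b \<in> M))"
    by (elim exE) (rule that)
  note M1 = M[THEN conjunct1] and M2 = M[THEN conjunct2, THEN conjunct1]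
    and M3 = M[THEN conjunct2, THEN conjunct2, THEN conjunct1]
  have M4: "F.Q.comm a b \<in> M" if "F.Q.is_sylow q Q (carrier (G Mod N))" "a \<in> Q" "b \<in> Q" for q Q a b
    using M that by blast
  have fc: "N #> comm a b = F.Q.comm (N #> a) (N #> b)" if "a \<in> carrier G" "b \<in> carrier G" for a b
    using that by (simp add: comm_def F.Q.comm_def F.hom F.map_inv del: mult_FactGroup)
  define W where "W = {x \<in> carrier G. N #> x \<in> M}"
  note pre = F.preimage[OF M1, folded W_def]
  have "normalises (carrier G) W"
    unfolding normalises_def
  proof (intro ballI)
    fix g x assume g: "g \<in> carrier G" and x: "x \<in> W"
    then have xG: "x \<in> carrier G" and xM: "N #> x \<in> M"
      by (auto simp: W_def)
    have "N #> (g \<otimes> x \<otimes> inv g) \<in> M"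
      using F.Q.normalisesD[OF M2 F.closed[OF g] xM] g xG
      by (simp add: F.hom F.map_inv del: mult_FactGroup)
    then show "g \<otimes> x \<otimes> inv g \<in> W"
      using g xG by (simp add: W_def)
  qed
  then have KW: "?K \<subseteq> W"
  proof (rule abelian_residual(4)[OF pre(1)])
    fix q Q a b assume Q: "is_sylow q Q (carrier G)" "a \<in> Q" "b \<in> Q"
    have G: "a \<in> carrier G" "b \<in> carrier G"
      using Q sylowD(3) by blast+
    have "F.Q.comm (N #> a) (N #> b) \<in> M"
      by (rule M4[OF F.sylow_image[OF Q(1)] imageI[OF Q(2)] imageI[OF Q(3)]])
    then show "comm a b \<in> W"
      using fc G by (simp add: W_def)
  qed
  have sI: "subgroup (N \<inter> ?K) G"
    using N'(1) abelian_residual(1) by (rule subgroup_Int)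
  have KG: "?K \<subseteq> carrier G"
    using abelian_residual(1) subgroup.subset by blast
  have "nilp_mod (N \<inter> ?K) ?K"
    unfolding nilp_mod_def
  proof (intro allI impI)
    fix p q :: nat and x y and k l :: nat
    assume pq: "prime p" "prime q" "p \<noteq> q" and xy: "x \<in> ?K" "y \<in> ?K"
      and e: "x [^] (p ^ k) \<in> N \<inter> ?K" "y [^] (q ^ l) \<in> N \<inter> ?K"
    have G: "x \<in> carrier G" "y \<in> carrier G"
      using xy KG by auto
    have m: "N #> x \<in> M" "N #> y \<in> M"
      using xy KW by (auto simp: W_def)
    have "(N #> x) [^]\<^bsub>G Mod N\<^esub> (p ^ k) \<in> {\<one>\<^bsub>G Mod N\<^esub>}" "(N #> y) [^]\<^bsub>G Mod N\<^esub> (q ^ l) \<in> {\<one>\<^bsub>G Mod N\<^esub>}"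
      using e F.map_L F.map_pow[OF G(1), of "p ^ k"] F.map_pow[OF G(2), of "q ^ l"] by auto
    then have "F.Q.comm (N #> x) (N #> y) = \<one>\<^bsub>G Mod N\<^esub>"
      using F.Q.nilp_modD[OF M3 pq m] by blast
    then have "comm x y \<in> N"
      using F.ker[of "comm x y"] fc G by simp
    then show "comm x y \<in> N \<inter> ?K"
      using comm_in_subgroup[OF abelian_residual(1) xy] by simp
  qed
  moreover have "normalises ?K (N \<inter> ?K)"
    using normalises_subset[OF N'(2) KG] normalises_self[OF abelian_residual(1) subset_refl]
    by (rule normalises_Int)
  ultimately have "residual nilpotent (G\<lparr>carrier := ?K\<rparr>) \<subseteq> N \<inter> ?K"
    using nilpotent_residual(4)[OF abelian_residual(1,2) sI] by blast
  then show ?thesis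
    by blast
qed

text \<open>\<open>wsup_prime_divides_index\<close> for \<open>A\<close> as a group of its own, with
  its residual as the least subgroup \<open>R\<close>.\<close>

lemma wsup_prime_divides_residual_index:
  assumes A: "subgroup A G" "wsup A" and q: "prime q" "q dvd card A"
  shows "q dvd order (G\<lparr>carrier := A\<rparr> Mod residual abelian_sylow (G\<lparr>carrier := A\<rparr>))"
proof -
  let ?A = "G\<lparr>carrier := A\<rparr>"
  interpret A: fin_group ?A
    using fin_group_subgroup A(1) .
  have "A.wsup (carrier ?A)"
    using A w_supersoluble_iff A.w_supersoluble_self by blast
  let ?R = "residual abelian_sylow ?A"
  have "?R \<lhd> ?A"
    using A.abelian_residual(1,2) by (simp add: A.normal_iff_normalises)
  then interpret F: factor_map ?A "?A Mod ?R" "carrier ?A" ?R "\<lambda>x. ?R #>\<^bsub>?A\<^esub> x"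
    by (rule A.factor_map_FactGroup)
  have "q dvd card (carrier (?A Mod ?R))"
  proof (rule A.wsup_prime_divides_index[OF \<open>A.wsup (carrier ?A)\<close> q(1) _ A.abelian_residual(1)])
    show "q dvd card (carrier ?A)"
      using q by simp
    show "card (carrier ?A) = card (carrier (?A Mod ?R)) * card ?R"
      using F.card_quotient by simp
  qed (rule A.abelian_residual(4))
  then show ?thesis
    by (simp add: order_def)
qed

end

theorem theorem1:
  fixes G :: "('a, 'b) monoid_scheme" and A B :: "'a set"
  assumes "group G" and "finite (carrier G)"
    and "P_subnormal A G" and "w_supersoluble (G\<lparr>carrier := A\<rparr>)"
    and "P_subnormal B G" and "w_supersoluble (G\<lparr>carrier := B\<rparr>)"
    and "carrier G = A <#>\<^bsub>G\<^esub> B"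
  shows "residual w_supersoluble G =
           residual nilpotent (G\<lparr>carrier := residual abelian_sylow G\<rparr>)
       \<and> (\<forall>N. N \<lhd> G \<and> nilpotent (G\<lparr>carrier := N\<rparr>) \<longrightarrow>
             w_supersoluble (G\<lparr>carrier := A <#>\<^bsub>G\<^esub> N\<rparr>) \<and>
             w_supersoluble (G\<lparr>carrier := B <#>\<^bsub>G\<^esub> N\<rparr>))
       \<and> (coprime
             (order (G\<lparr>carrier := A\<rparr> Mod residual abelian_sylow (G\<lparr>carrier := A\<rparr>)))
             (order (G\<lparr>carrier := B\<rparr> Mod residual abelian_sylow (G\<lparr>carrier := B\<rparr>)))
          \<longrightarrow> w_supersoluble G)"
proof -
  interpret fin_group G
    using assms(1,2) by (simp add: fin_group_def fin_group_axioms_def)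
  have A: "psub A (carrier G)" and B: "psub B (carrier G)"
    using assms(3,5) P_subnormal_iff[OF subgroup_self] by simp_all
  have sA: "subgroup A G" and sB: "subgroup B G"
    using chainD(1)[OF A] chainD(1)[OF B] .
  have wA: "wsup A" and wB: "wsup B"
    using assms(4,6) w_supersoluble_iff sA sB by simp_all
  note AB = assms(7)
  have factors: "\<exists>Q. is_sylow q Q (carrier G) \<and> is_sylow q (Q \<inter> A) A \<and> is_sylow q (Q \<inter> B) B
      \<and> Q = (Q \<inter> A) <#>\<^bsub>G\<^esub> (Q \<inter> B)" if "prime q" for q
    using sylow_factorisation[OF sA sB subgroup_self AB that] .
  \<comment> \<open>The two parts of a Sylow subgroup are Sylow subgroups of \<open>A\<close> and
    \<open>B\<close>, hence P-subnormal in \<open>G\<close>, although their product may fail to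
    be.\<close>
  have d: dispersive
  proof (rule dispersive_if_sylow_factors)
    fix q :: nat assume "prime q"
    then obtain Q where "is_sylow q Q (carrier G)" "is_sylow q (Q \<inter> A) A" "is_sylow q (Q \<inter> B) B"
        "Q = (Q \<inter> A) <#>\<^bsub>G\<^esub> (Q \<inter> B)"
      using factors by blast
    then show "\<exists>Q X Y. is_sylow q Q (carrier G) \<and> Q = X <#>\<^bsub>G\<^esub> Y \<and> X \<subseteq> Q \<and> Y \<subseteq> Q
        \<and> psub X (carrier G) \<and> psub Y (carrier G)"
      using psub_sylow_of_wsup[OF A wA] psub_sylow_of_wsup[OF B wB] by (meson inf_le1)
  qed
  let ?K = "residual abelian_sylow G"
  let ?N = "residual nilpotent (G\<lparr>carrier := ?K\<rparr>)"
  note K = abelian_residual(1,2)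
  note N = nilpotent_residual(1-3)[OF K]
  have nN: "?N \<lhd> G"
    using N by (simp add: normal_iff_normalises)
  interpret F: factor_map G "G Mod ?N" "carrier G" ?N "\<lambda>x. ?N #>\<^bsub>G\<^esub> x"
    using factor_map_FactGroup[OF nN] .
  have "F.Q.wsup (carrier (G Mod ?N))"
  proof (rule F.Q.wsupI[OF F.Q.subgroup_self])
    fix q :: nat assume q: "prime q"
    have "\<exists>Q. is_sylow q Q (carrier G) \<and> psub (Q <#>\<^bsub>G\<^esub> ?N) (carrier G)"
      by (rule wsup_quotient_of_product[OF A wA B wB AB d K N _ q]) (rule abelian_residual(3))
    then obtain Q where Q: "is_sylow q Q (carrier G)" "psub (Q <#>\<^bsub>G\<^esub> ?N) (carrier G)"
      by blast
    have QN: "?N \<subseteq> Q <#>\<^bsub>G\<^esub> ?N"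
      using sylowD(2)[OF Q(1)] N(1) by (rule subset_setmult_right)
    \<comment> \<open>\<open>?N\<close> is the kernel, so \<open>Q\<close> and its product with
      \<open>?N\<close> have the same image.\<close>
    have im: "(\<lambda>x. ?N #>\<^bsub>G\<^esub> x) ` (Q <#>\<^bsub>G\<^esub> ?N) = (\<lambda>x. ?N #>\<^bsub>G\<^esub> x) ` Q"
    proof
      show "(\<lambda>x. ?N #>\<^bsub>G\<^esub> x) ` (Q <#>\<^bsub>G\<^esub> ?N) \<subseteq> (\<lambda>x. ?N #>\<^bsub>G\<^esub> x) ` Q"
      proof
        fix z assume "z \<in> (\<lambda>x. ?N #>\<^bsub>G\<^esub> x) ` (Q <#>\<^bsub>G\<^esub> ?N)"
        then obtain x n where xn: "x \<in> Q" "n \<in> ?N" "z = ?N #>\<^bsub>G\<^esub> (x \<otimes>\<^bsub>G\<^esub> n)"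
          by (auto simp: setmult_iff)
        have "x \<in> carrier G"
          using xn sylowD(3)[OF Q(1)] by blast
        then have "z = ?N #>\<^bsub>G\<^esub> x"
          using xn F.hom[of x n] F.map_L[OF xn(2)] F.Q.r_one[OF F.closed] by simp
        then show "z \<in> (\<lambda>x. ?N #>\<^bsub>G\<^esub> x) ` Q"
          using xn by blast
      qed
      show "(\<lambda>x. ?N #>\<^bsub>G\<^esub> x) ` Q \<subseteq> (\<lambda>x. ?N #>\<^bsub>G\<^esub> x) ` (Q <#>\<^bsub>G\<^esub> ?N)"
        using sylowD(2)[OF Q(1)] N(1) by (intro image_mono subset_setmult_left)
    qed
    show "\<exists>P. F.Q.is_sylow q P (carrier (G Mod ?N)) \<and> F.Q.psub P (carrier (G Mod ?N))"
      using F.sylow_image[OF Q(1)] F.psub_image[OF Q(2) QN subset_refl] by (auto simp: im F.onto)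
  qed
  then have "w_supersoluble (G Mod ?N)"
    using F.Q.w_supersoluble_self by simp
  \<comment> \<open>\<open>?N\<close> belongs to the family that defines the left-hand residual, and
    it lies in every member of that family.\<close>
  then have 1: "residual w_supersoluble G = ?N"
    using nN wsup_quotient_residual_subset by (auto simp: residual_def)
  have 2: "w_supersoluble (G\<lparr>carrier := A <#>\<^bsub>G\<^esub> N\<rparr>) \<and> w_supersoluble (G\<lparr>carrier := B <#>\<^bsub>G\<^esub> N\<rparr>)"
    if N: "N \<lhd> G" "nilpotent (G\<lparr>carrier := N\<rparr>)" for N
  proof -
    have N': "subgroup N G" "normalises (carrier G) N"
      using N(1) by (simp_all add: normal_iff_normalises)
    interpret N: fin_group "G\<lparr>carrier := N\<rparr>"
      using fin_group_subgroup N'(1) .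
    have one: "normalises N {\<one>\<^bsub>G\<^esub>}" "{\<one>\<^bsub>G\<^esub>} \<subseteq> N"
      using N'(1) by (simp_all add: normalises_one subgroup.subset subgroup.one_closed)
    have "N.nilp_mod {\<one>\<^bsub>G\<lparr>carrier := N\<rparr>\<^esub>} (carrier (G\<lparr>carrier := N\<rparr>))"
      using N(2) N.nilpotent_iff by blast
    moreover have "N.comm x y = comm x y" if "x \<in> N" "y \<in> N" for x y
      using that m_inv_consistent[OF N'(1)] by (simp add: comm_def N.comm_def)
    \<comment> \<open>Inverses and powers in the group restricted to \<open>N\<close> agree with
      those of \<open>G\<close>, so the two forms of \<open>nilp_mod\<close> coincide.\<close>
    ultimately have "nilp_mod {\<one>\<^bsub>G\<^esub>} N"
      by (simp add: nilp_mod_def N.nilp_mod_def nat_pow_consistent[symmetric])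
    then have "wsup (A <#>\<^bsub>G\<^esub> N)" "wsup (B <#>\<^bsub>G\<^esub> N)"
      using wsup_setmult_nilpotent[OF d] A wA B wB N' by blast+
    moreover have "subgroup (A <#>\<^bsub>G\<^esub> N) G" "subgroup (B <#>\<^bsub>G\<^esub> N) G"
      using sA sB N' normalises_subset subgroup.subset by (blast intro: subgroup_setmult)+
    ultimately show ?thesis
      using w_supersoluble_iff by blast
  qed
  have 3: "w_supersoluble G"
    if cop: "coprime (order (G\<lparr>carrier := A\<rparr> Mod residual abelian_sylow (G\<lparr>carrier := A\<rparr>)))
      (order (G\<lparr>carrier := B\<rparr> Mod residual abelian_sylow (G\<lparr>carrier := B\<rparr>)))"
  proof -
    have trivial: "X = {\<one>\<^bsub>G\<^esub>}" if "is_sylow q X D" "\<not> q dvd card D" for q X D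
    proof -
      have "card X = 1"
        using sylowD(4)[OF that(1)] not_dvd_imp_multiplicity_0[OF that(2)] by simp
      then show ?thesis
        using subgroup_eqI[OF sylowD(2)[OF that(1)], of "{\<one>\<^bsub>G\<^esub>}"] subgroup.one_closed[OF sylowD(2)[OF that(1)]]
        by simp
    qed
    have "wsup (carrier G)"
    proof (rule wsupI[OF subgroup_self])
      fix q :: nat assume q: "prime q"
      obtain Q where Q: "is_sylow q Q (carrier G)" "is_sylow q (Q \<inter> A) A" "is_sylow q (Q \<inter> B) B"
          "Q = (Q \<inter> A) <#>\<^bsub>G\<^esub> (Q \<inter> B)"
        using factors q by blast
      have "\<not> (q dvd card A \<and> q dvd card B)"
      proof
        assume "q dvd card A \<and> q dvd card B"
        then have "is_unit q"
          using coprime_common_divisor[OF cop wsup_prime_divides_residual_index[OF sA wA q]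
              wsup_prime_divides_residual_index[OF sB wB q]] by blast
        then show False
          using q not_prime_unit by blast
      qed
      \<comment> \<open>One part of \<open>Q\<close> is trivial, so \<open>Q\<close> is a Sylow
        subgroup of \<open>A\<close> or of \<open>B\<close> and inherits P-subnormality from
        there.\<close>
      then have "Q \<inter> B = {\<one>\<^bsub>G\<^esub>} \<or> Q \<inter> A = {\<one>\<^bsub>G\<^esub>}"
        using trivial Q by blast
      then have "Q = Q \<inter> A \<or> Q = Q \<inter> B"
      proof
        assume "Q \<inter> B = {\<one>\<^bsub>G\<^esub>}"
        then have "Q = (Q \<inter> A) <#>\<^bsub>G\<^esub> {\<one>\<^bsub>G\<^esub>}"
          using Q(4) by simp
        also have "\<dots> = Q \<inter> A"
          using coset_mult_one[of "Q \<inter> A"] sylowD(2)[OF Q(2)] subgroup.subset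
          by (metis r_coset_eq_set_mult)
        finally show ?thesis ..
      next
        assume "Q \<inter> A = {\<one>\<^bsub>G\<^esub>}"
        then have "Q = {\<one>\<^bsub>G\<^esub>} <#>\<^bsub>G\<^esub> (Q \<inter> B)"
          using Q(4) by simp
        also have "\<dots> = Q \<inter> B"
          using lcos_mult_one[of "Q \<inter> B"] sylowD(2)[OF Q(3)] subgroup.subset
          by (metis l_coset_eq_set_mult)
        finally show ?thesis ..
      qed
      then have "psub Q (carrier G)"
        using psub_sylow_of_wsup[OF A wA Q(2)] psub_sylow_of_wsup[OF B wB Q(3)] by auto
      then show "\<exists>Q. is_sylow q Q (carrier G) \<and> psub Q (carrier G)"
        using Q(1) by blast
    qed
    then show ?thesis
      using w_supersoluble_self by simp
  qed
  show ?thesis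
    using 1 2 3 by blast
qed

end
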